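(* There exist no complete hermitian manifolds $(M^6,g,J)$ of type $\mathcal W_3$ such that $$\nabla^cT^c=0,\qquad \dim G_{T^c}=1,$$ where $\nabla^c$ is the characteristic connection and $T^c$ its torsion form.
   Context: For an almost hermitian manifold $(M^6,g,J)$ put $\Omega(X,Y)=g(JX,Y)$. Type $\mathcal W_3$ means: $J$ is integrable and $\delta\Omega=0$. The characteristic connection $\nabla^c$ is the unique linear connection with $\nabla^cg=0$, $\nabla^cJ=0$ and totally skew-symmetric torsion; its torsion $T^c$ is regarded as a $3$-form, $\nabla^c_XY=\nabla^{LC}_XY+\frac12T^c(X,Y,-)$. $G_{T^c}$ is the connected component of the identity of the isotropy group of $T^c$ at a point, inside the unitary group $U(3)$ of $(T_pM,g,J)$ (its conjugacy class is independent of the point because $T^c$ is parallel). *)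

theory Defs
  imports "HOL-Analysis.Analysis"
begin

section \<open>Smooth manifolds\<close>

fun Ck_on :: "nat \<Rightarrow> 'a::euclidean_space set \<Rightarrow> ('a \<Rightarrow> 'b::real_normed_vector) \<Rightarrow> bool" where
  "Ck_on 0 S f \<longleftrightarrow> continuous_on S f"
| "Ck_on (Suc k) S f \<longleftrightarrow>
     (\<forall>x\<in>S. f differentiable (at x)) \<and> (\<forall>v. Ck_on k S (\<lambda>x. frechet_derivative f (at x) v))"

text \<open>Only meant for open sets \<open>S\<close>.\<close>

definition Cinf_on :: "'a::euclidean_space set \<Rightarrow> ('a \<Rightarrow> 'b::real_normed_vector) \<Rightarrow> bool" where
  "Cinf_on S f \<longleftrightarrow> (\<forall>k. Ck_on k S f)"

text \<open>A manifold is a Hausdorff second countable type \<open>'m\<close> together with a smooth atlas; a chart is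
  a pair of a coordinate domain and a coordinate map. The atlas need not be maximal.\<close>

type_synonym ('m, 'n) chart = "'m set \<times> ('m \<Rightarrow> real^'n)"

abbreviation cdom :: "('m, 'n) chart \<Rightarrow> 'm set" where
  "cdom c \<equiv> fst c"

abbreviation crd :: "('m, 'n) chart \<Rightarrow> 'm \<Rightarrow> real^'n" where
  "crd c \<equiv> snd c"

abbreviation par :: "('m, 'n) chart \<Rightarrow> real^'n \<Rightarrow> 'm" where
  "par c \<equiv> inv_into (fst c) (snd c)"

definition smooth_atlas ::
  "('m::{t2_space,second_countable_topology}, 'n::finite) chart set \<Rightarrow> bool" where
  "smooth_atlas A \<longleftrightarrow>
     (\<Union>c\<in>A. cdom c) = UNIV \<and>
     (\<forall>c\<in>A. open (cdom c) \<and> open (crd c ` cdom c) \<and>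
        homeomorphism (cdom c) (crd c ` cdom c) (crd c) (par c)) \<and>
     (\<forall>c\<in>A. \<forall>d\<in>A. Cinf_on (crd c ` (cdom c \<inter> cdom d)) (crd d \<circ> par c))"

text \<open>The tangent space at \<open>p\<close> is modelled by \<open>real^'n\<close>, through the coordinate basis of a preferred
  chart \<open>chart_at A p\<close>. Tangent vectors at different points are therefore not comparable as
  elements of \<open>real^'n\<close>: the components of \<open>v \<in> T\<^sub>pM\<close> in an arbitrary chart \<open>c\<close> around
  \<open>p\<close> are \<open>components A c p v\<close>, and smoothness is expressed through these.\<close>

definition chart_at :: "('m, 'n::finite) chart set \<Rightarrow> 'm \<Rightarrow> ('m, 'n) chart" where
  "chart_at A p = (SOME c. c \<in> A \<and> p \<in> cdom c)"

definition change :: "('m, 'n::finite) chart \<Rightarrow> ('m, 'n) chart \<Rightarrow> 'm \<Rightarrow> real^'n \<Rightarrow> real^'n" where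
  "change c d p v = frechet_derivative (crd d \<circ> par c) (at (crd c p)) v"

definition components ::
  "('m, 'n::finite) chart set \<Rightarrow> ('m, 'n) chart \<Rightarrow> 'm \<Rightarrow> real^'n \<Rightarrow> real^'n" where
  "components A c p v = change (chart_at A p) c p v"

definition smooth_fun :: "('m, 'n::finite) chart set \<Rightarrow> 'm set \<Rightarrow> ('m \<Rightarrow> real) \<Rightarrow> bool" where
  "smooth_fun A U f \<longleftrightarrow> (\<forall>c\<in>A. Cinf_on (crd c ` (U \<inter> cdom c)) (f \<circ> par c))"

type_synonym ('m, 'n) field = "'m \<Rightarrow> real^'n"

text \<open>The component functions of a vector field in a chart, as a function of the coordinates.\<close>

definition local_rep ::
  "('m, 'n::finite) chart set \<Rightarrow> ('m, 'n) chart \<Rightarrow> ('m, 'n) field \<Rightarrow> real^'n \<Rightarrow> real^'n" where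
  "local_rep A c X = (\<lambda>x. components A c (par c x) (X (par c x)))"

definition smooth_field :: "('m, 'n::finite) chart set \<Rightarrow> 'm set \<Rightarrow> ('m, 'n) field \<Rightarrow> bool" where
  "smooth_field A U X \<longleftrightarrow> (\<forall>c\<in>A. Cinf_on (crd c ` (U \<inter> cdom c)) (local_rep A c X))"

text \<open>The field around \<open>p\<close> with constant components \<open>v\<close> in the chart \<open>chart_at A p\<close>; it is smooth
  on the domain of that chart and has the value \<open>v\<close> at \<open>p\<close>.\<close>

definition ext :: "('m, 'n::finite) chart set \<Rightarrow> 'm \<Rightarrow> real^'n \<Rightarrow> ('m, 'n) field" where
  "ext A p v = (\<lambda>q. change (chart_at A p) (chart_at A q) q v)"

text \<open>The derivative \<open>v(f)\<close> of a function \<open>f\<close> along \<open>v \<in> T\<^sub>pM\<close>.\<close>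

definition dir_deriv ::
  "('m, 'n::finite) chart set \<Rightarrow> 'm \<Rightarrow> real^'n \<Rightarrow> ('m \<Rightarrow> real) \<Rightarrow> real" where
  "dir_deriv A p v f =
     frechet_derivative (f \<circ> par (chart_at A p)) (at (crd (chart_at A p) p)) v"

definition lie_bracket ::
  "('m, 'n::finite) chart set \<Rightarrow> ('m, 'n) field \<Rightarrow> ('m, 'n) field \<Rightarrow> ('m, 'n) field" where
  "lie_bracket A X Y = (\<lambda>p.
     let c = chart_at A p; x = crd c p in
       frechet_derivative (local_rep A c Y) (at x) (X p)
       - frechet_derivative (local_rep A c X) (at x) (Y p))"


section \<open>Almost hermitian manifolds\<close>

definition riemannian_metric ::
  "('m::topological_space, 'n::finite) chart set \<Rightarrow> ('m \<Rightarrow> real^'n \<Rightarrow> real^'n \<Rightarrow> real) \<Rightarrow> bool" where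
  "riemannian_metric A g \<longleftrightarrow>
     (\<forall>p. bilinear (g p) \<and> (\<forall>v w. g p v w = g p w v) \<and> (\<forall>v. v \<noteq> 0 \<longrightarrow> g p v v > 0)) \<and>
     (\<forall>U X Y. open U \<and> smooth_field A U X \<and> smooth_field A U Y
        \<longrightarrow> smooth_fun A U (\<lambda>p. g p (X p) (Y p)))"

definition almost_complex ::
  "('m::topological_space, 'n::finite) chart set \<Rightarrow> ('m \<Rightarrow> real^'n \<Rightarrow> real^'n) \<Rightarrow> bool" where
  "almost_complex A J \<longleftrightarrow>
     (\<forall>p. linear (J p) \<and> (\<forall>v. J p (J p v) = - v)) \<and>
     (\<forall>U X. open U \<and> smooth_field A U X \<longrightarrow> smooth_field A U (\<lambda>p. J p (X p)))"

definition almost_hermitian ::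
  "('m::topological_space, 'n::finite) chart set \<Rightarrow> ('m \<Rightarrow> real^'n \<Rightarrow> real^'n \<Rightarrow> real)
     \<Rightarrow> ('m \<Rightarrow> real^'n \<Rightarrow> real^'n) \<Rightarrow> bool" where
  "almost_hermitian A g J \<longleftrightarrow>
     riemannian_metric A g \<and> almost_complex A J \<and> (\<forall>p v w. g p (J p v) (J p w) = g p v w)"

definition kaehler_form ::
  "('m \<Rightarrow> real^'n \<Rightarrow> real^'n \<Rightarrow> real) \<Rightarrow> ('m \<Rightarrow> real^'n \<Rightarrow> real^'n)
     \<Rightarrow> 'm \<Rightarrow> real^'n \<Rightarrow> real^'n \<Rightarrow> real" where
  "kaehler_form g J = (\<lambda>p v w. g p (J p v) w)"

definition nijenhuis ::
  "('m, 'n::finite) chart set \<Rightarrow> ('m \<Rightarrow> real^'n \<Rightarrow> real^'n)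
     \<Rightarrow> ('m, 'n) field \<Rightarrow> ('m, 'n) field \<Rightarrow> ('m, 'n) field" where
  "nijenhuis A J X Y = (\<lambda>p.
     lie_bracket A (\<lambda>q. J q (X q)) (\<lambda>q. J q (Y q)) p
     - J p (lie_bracket A (\<lambda>q. J q (X q)) Y p)
     - J p (lie_bracket A X (\<lambda>q. J q (Y q)) p)
     - lie_bracket A X Y p)"

text \<open>Integrability in the sense of Kobayashi--Nomizu and Gray--Hervella: the Nijenhuis tensor
  vanishes. This is implied by the other common definition, that \<open>J\<close> comes from a holomorphic atlas.\<close>

definition integrable_J ::
  "('m::topological_space, 'n::finite) chart set \<Rightarrow> ('m \<Rightarrow> real^'n \<Rightarrow> real^'n) \<Rightarrow> bool" where
  "integrable_J A J \<longleftrightarrow>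
     (\<forall>U X Y. open U \<and> smooth_field A U X \<and> smooth_field A U Y
        \<longrightarrow> (\<forall>p\<in>U. nijenhuis A J X Y p = 0))"


section \<open>Linear connections\<close>

text \<open>\<open>D p v Y\<close> is the covariant derivative at \<open>p\<close> of the vector field \<open>Y\<close> along \<open>v \<in> T\<^sub>pM\<close>.
  The axioms are imposed for fields defined on arbitrary open sets. Locality follows from them:
  in the Leibniz rule take \<open>f\<close> to be the indicator function of an open neighbourhood of \<open>p\<close>.\<close>

type_synonym ('m, 'n) conn = "'m \<Rightarrow> real^'n \<Rightarrow> ('m, 'n) field \<Rightarrow> real^'n"

definition linear_connection ::
  "('m::topological_space, 'n::finite) chart set \<Rightarrow> ('m, 'n) conn \<Rightarrow> bool" where
  "linear_connection A D \<longleftrightarrow>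
     (\<forall>U Y. open U \<and> smooth_field A U Y \<longrightarrow> (\<forall>p\<in>U. linear (\<lambda>v. D p v Y))) \<and>
     (\<forall>U Y Z. open U \<and> smooth_field A U Y \<and> smooth_field A U Z \<longrightarrow>
        (\<forall>p\<in>U. \<forall>v. D p v (\<lambda>q. Y q + Z q) = D p v Y + D p v Z)) \<and>
     (\<forall>U f Y. open U \<and> smooth_fun A U f \<and> smooth_field A U Y \<longrightarrow>
        (\<forall>p\<in>U. \<forall>v. D p v (\<lambda>q. f q *\<^sub>R Y q) = dir_deriv A p v f *\<^sub>R Y p + f p *\<^sub>R D p v Y)) \<and>
     (\<forall>U X Y. open U \<and> smooth_field A U X \<and> smooth_field A U Y \<longrightarrow>
        smooth_field A U (\<lambda>p. D p (X p) Y))"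

definition torsion ::
  "('m, 'n::finite) chart set \<Rightarrow> ('m, 'n) conn \<Rightarrow> ('m, 'n) field \<Rightarrow> ('m, 'n) field
     \<Rightarrow> ('m, 'n) field" where
  "torsion A D X Y = (\<lambda>p. D p (X p) Y - D p (Y p) X - lie_bracket A X Y p)"

text \<open>The torsion as a tensor of type (0,3), \<open>T(u,v,w) = g(T(u,v),w)\<close> for tangent vectors at \<open>p\<close>.
  The torsion being tensorial, it does not matter how the vectors are extended to fields.\<close>

definition torsion_form ::
  "('m, 'n::finite) chart set \<Rightarrow> ('m \<Rightarrow> real^'n \<Rightarrow> real^'n \<Rightarrow> real) \<Rightarrow> ('m, 'n) conn
     \<Rightarrow> 'm \<Rightarrow> real^'n \<Rightarrow> real^'n \<Rightarrow> real^'n \<Rightarrow> real" where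
  "torsion_form A g D = (\<lambda>p u v w. g p (torsion A D (ext A p u) (ext A p v) p) w)"

definition cov_deriv2 ::
  "('m, 'n::finite) chart set \<Rightarrow> ('m, 'n) conn \<Rightarrow> ('m \<Rightarrow> real^'n \<Rightarrow> real^'n \<Rightarrow> real)
     \<Rightarrow> 'm \<Rightarrow> real^'n \<Rightarrow> ('m, 'n) field \<Rightarrow> ('m, 'n) field \<Rightarrow> real" where
  "cov_deriv2 A D S p v X Y =
     dir_deriv A p v (\<lambda>q. S q (X q) (Y q)) - S p (D p v X) (Y p) - S p (X p) (D p v Y)"

definition cov_deriv3 ::
  "('m, 'n::finite) chart set \<Rightarrow> ('m, 'n) conn
     \<Rightarrow> ('m \<Rightarrow> real^'n \<Rightarrow> real^'n \<Rightarrow> real^'n \<Rightarrow> real)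
     \<Rightarrow> 'm \<Rightarrow> real^'n \<Rightarrow> ('m, 'n) field \<Rightarrow> ('m, 'n) field \<Rightarrow> ('m, 'n) field \<Rightarrow> real" where
  "cov_deriv3 A D S p v X Y Z =
     dir_deriv A p v (\<lambda>q. S q (X q) (Y q) (Z q))
     - S p (D p v X) (Y p) (Z p) - S p (X p) (D p v Y) (Z p) - S p (X p) (Y p) (D p v Z)"

definition parallel2 ::
  "('m::topological_space, 'n::finite) chart set \<Rightarrow> ('m, 'n) conn
     \<Rightarrow> ('m \<Rightarrow> real^'n \<Rightarrow> real^'n \<Rightarrow> real) \<Rightarrow> bool" where
  "parallel2 A D S \<longleftrightarrow>
     (\<forall>U X Y. open U \<and> smooth_field A U X \<and> smooth_field A U Y
        \<longrightarrow> (\<forall>p\<in>U. \<forall>v. cov_deriv2 A D S p v X Y = 0))"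

definition parallel3 ::
  "('m::topological_space, 'n::finite) chart set \<Rightarrow> ('m, 'n) conn
     \<Rightarrow> ('m \<Rightarrow> real^'n \<Rightarrow> real^'n \<Rightarrow> real^'n \<Rightarrow> real) \<Rightarrow> bool" where
  "parallel3 A D S \<longleftrightarrow>
     (\<forall>U X Y Z. open U \<and> smooth_field A U X \<and> smooth_field A U Y \<and> smooth_field A U Z
        \<longrightarrow> (\<forall>p\<in>U. \<forall>v. cov_deriv3 A D S p v X Y Z = 0))"

definition parallel_endo ::
  "('m::topological_space, 'n::finite) chart set \<Rightarrow> ('m, 'n) conn
     \<Rightarrow> ('m \<Rightarrow> real^'n \<Rightarrow> real^'n) \<Rightarrow> bool" where
  "parallel_endo A D J \<longleftrightarrow>
     (\<forall>U X. open U \<and> smooth_field A U X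
        \<longrightarrow> (\<forall>p\<in>U. \<forall>v. D p v (\<lambda>q. J q (X q)) = J p (D p v X)))"

definition levi_civita ::
  "('m::topological_space, 'n::finite) chart set \<Rightarrow> ('m \<Rightarrow> real^'n \<Rightarrow> real^'n \<Rightarrow> real)
     \<Rightarrow> ('m, 'n) conn \<Rightarrow> bool" where
  "levi_civita A g L \<longleftrightarrow>
     linear_connection A L \<and> parallel2 A L g \<and>
     (\<forall>U X Y. open U \<and> smooth_field A U X \<and> smooth_field A U Y
        \<longrightarrow> (\<forall>p\<in>U. torsion A L X Y p = 0))"

definition characteristic_connection ::
  "('m::topological_space, 'n::finite) chart set \<Rightarrow> ('m \<Rightarrow> real^'n \<Rightarrow> real^'n \<Rightarrow> real)
     \<Rightarrow> ('m \<Rightarrow> real^'n \<Rightarrow> real^'n) \<Rightarrow> ('m, 'n) conn \<Rightarrow> bool" where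
  "characteristic_connection A g J D \<longleftrightarrow>
     linear_connection A D \<and> parallel2 A D g \<and> parallel_endo A D J \<and>
     (\<forall>p u v w. torsion_form A g D p v u w = - torsion_form A g D p u v w
              \<and> torsion_form A g D p u w v = - torsion_form A g D p u v w)"

definition orthonormal_frame :: "(real^'n \<Rightarrow> real^'n \<Rightarrow> real) \<Rightarrow> ('n::finite \<Rightarrow> real^'n) \<Rightarrow> bool" where
  "orthonormal_frame h e \<longleftrightarrow> (\<forall>i j. h (e i) (e j) = (if i = j then 1 else 0))"

text \<open>The codifferential \<open>(\<delta>\<omega>)(w) = - \<Sum>\<^sub>i (\<nabla>\<^sub>e\<^sub>i \<omega>)(e\<^sub>i, w)\<close> of a 2-form, where \<open>L\<close> is the Levi-Civita
  connection; it does not depend on the orthonormal basis of \<open>T\<^sub>pM\<close>.\<close>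

definition codifferential ::
  "('m, 'n::finite) chart set \<Rightarrow> ('m \<Rightarrow> real^'n \<Rightarrow> real^'n \<Rightarrow> real) \<Rightarrow> ('m, 'n) conn
     \<Rightarrow> ('m \<Rightarrow> real^'n \<Rightarrow> real^'n \<Rightarrow> real) \<Rightarrow> 'm \<Rightarrow> real^'n \<Rightarrow> real" where
  "codifferential A g L \<omega> p w =
     (let e = (SOME e. orthonormal_frame (g p) e) in
       - (\<Sum>i\<in>UNIV. cov_deriv2 A L \<omega> p (e i) (ext A p (e i)) (ext A p w)))"

text \<open>Here \<open>L\<close> is the Levi-Civita connection of \<open>g\<close>.\<close>

definition type_W3 ::
  "('m::topological_space, 'n::finite) chart set \<Rightarrow> ('m \<Rightarrow> real^'n \<Rightarrow> real^'n \<Rightarrow> real)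
     \<Rightarrow> ('m \<Rightarrow> real^'n \<Rightarrow> real^'n) \<Rightarrow> ('m, 'n) conn \<Rightarrow> bool" where
  "type_W3 A g J L \<longleftrightarrow>
     integrable_J A J \<and> (\<forall>p w. codifferential A g L (kaehler_form g J) p w = 0)"


section \<open>Geodesic completeness\<close>

definition smooth_curve ::
  "('m::topological_space, 'n::finite) chart set \<Rightarrow> (real \<Rightarrow> 'm) \<Rightarrow> bool" where
  "smooth_curve A \<gamma> \<longleftrightarrow>
     continuous_on UNIV \<gamma> \<and> (\<forall>c\<in>A. Cinf_on (\<gamma> -` cdom c) (crd c \<circ> \<gamma>))"

definition velocity ::
  "('m, 'n::finite) chart set \<Rightarrow> (real \<Rightarrow> 'm) \<Rightarrow> real \<Rightarrow> real^'n" where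
  "velocity A \<gamma> t = vector_derivative (crd (chart_at A (\<gamma> t)) \<circ> \<gamma>) (at t)"

text \<open>The geodesic equation \<open>x'' + \<Gamma>(x',x') = 0\<close>, written at each \<open>t\<close> in the preferred chart at
  \<open>\<gamma> t\<close>. The Christoffel term is the covariant derivative along \<open>x'\<close> of the field with constant
  components \<open>x'\<close> in that chart.\<close>

definition geodesic ::
  "('m::topological_space, 'n::finite) chart set \<Rightarrow> ('m, 'n) conn \<Rightarrow> (real \<Rightarrow> 'm) \<Rightarrow> bool" where
  "geodesic A L \<gamma> \<longleftrightarrow> smooth_curve A \<gamma> \<and>
     (\<forall>t. let x = crd (chart_at A (\<gamma> t)) \<circ> \<gamma>; u = velocity A \<gamma> t in
        vector_derivative (\<lambda>s. vector_derivative x (at s)) (at t)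
        + L (\<gamma> t) u (ext A (\<gamma> t) u) = 0)"

definition complete_manifold ::
  "('m::topological_space, 'n::finite) chart set \<Rightarrow> ('m, 'n) conn \<Rightarrow> bool" where
  "complete_manifold A L \<longleftrightarrow>
     (\<forall>p v. \<exists>\<gamma>. geodesic A L \<gamma> \<and> \<gamma> 0 = p \<and> velocity A \<gamma> 0 = v)"


section \<open>The isotropy group of the torsion\<close>

text \<open>Linear endomorphisms of \<open>T\<^sub>pM\<close> are given by matrices.\<close>

definition unitary_group ::
  "(real^'n \<Rightarrow> real^'n \<Rightarrow> real) \<Rightarrow> (real^'n \<Rightarrow> real^'n) \<Rightarrow> (real^'n^'n::finite) set" where
  "unitary_group h j = {B. invertible B \<and> (\<forall>v w. h (B *v v) (B *v w) = h v w)
                          \<and> (\<forall>v. j (B *v v) = B *v j v)}"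

definition isotropy_group ::
  "(real^'n \<Rightarrow> real^'n \<Rightarrow> real^'n \<Rightarrow> real) \<Rightarrow> (real^'n^'n::finite) set \<Rightarrow> (real^'n^'n) set" where
  "isotropy_group T G = {B\<in>G. \<forall>u v w. T (B *v u) (B *v v) (B *v w) = T u v w}"

definition mat_exp :: "real^'n^'n::finite \<Rightarrow> real^'n^'n" where
  "mat_exp B = (\<Sum>k. (1 / fact k) *\<^sub>R (((**) B ^^ k) (mat 1)))"

text \<open>For a closed subgroup \<open>G\<close> of the general linear group this is its Lie algebra; its dimension
  is the dimension of the Lie group \<open>G\<close>.\<close>

definition lie_algebra :: "(real^'n^'n::finite) set \<Rightarrow> (real^'n^'n) set" where
  "lie_algebra G = {B. \<forall>t::real. mat_exp (t *\<^sub>R B) \<in> G}"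

definition lie_group_dim :: "(real^'n^'n::finite) set \<Rightarrow> nat" where
  "lie_group_dim G = dim (lie_algebra G)"

text \<open>The identity component of the isotropy group of the torsion form of \<open>D\<close> at \<open>p\<close>.\<close>

definition torsion_isotropy ::
  "('m, 'n::finite) chart set \<Rightarrow> ('m \<Rightarrow> real^'n \<Rightarrow> real^'n \<Rightarrow> real) \<Rightarrow> ('m \<Rightarrow> real^'n \<Rightarrow> real^'n)
     \<Rightarrow> ('m, 'n) conn \<Rightarrow> 'm \<Rightarrow> (real^'n^'n) set" where
  "torsion_isotropy A g J D p =
     connected_component_set
       (isotropy_group (torsion_form A g D p) (unitary_group (g p) (J p))) (mat 1)"

end

theory Submission
  imports Defs
begin

text \<open>
  The contradiction arises in a single tangent space \<open>V = T\<^sub>pM\<close>, with metric \<open>h\<close>, complex structure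
  \<open>j\<close> and torsion \<open>T\<close>, from the algebra of \<open>T\<close> and the first Bianchi identity at \<open>p\<close>.

  Geometric input. Integrability of \<open>J\<close> says that \<open>T\<close> is of type \<open>(2,1) + (1,2)\<close>
  (\<open>torsion_type\<close>), and \<open>\<delta>\<Omega> = 0\<close> says that it is primitive, that is, its contraction with
  \<open>\<Omega>\<close> vanishes (\<open>torsion_primitive\<close>). Since the metric, \<open>J\<close> and \<open>T\<close> are parallel, the Ricci
  identity puts every curvature operator \<open>R(u,v)\<close> of the characteristic connection into the Lie algebra
  \<open>\<gg>\<close> of skew, \<open>j\<close>-linear derivations of \<open>T\<close>, and the Bianchi identity reads
  \<open>\<SS> R(u,v)w = \<SS> T(T(u,v),w)\<close> with cyclic sums (\<open>curvature\<close>). Differentiating one-parameter groups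
  shows that \<open>\<gg>\<close> is the Lie algebra of the isotropy group (\<open>isotropy_lie_algebra\<close>). So suppose
  that \<open>\<gg>\<close> is spanned by one operator \<open>F\<close>.

  Step 1: \<open>F\<close> has a kernel (\<open>stabilizer_line_kernel\<close>). Take a unitary eigenbasis
  \<open>F e\<^sub>k = x\<^sub>k j e\<^sub>k\<close>. The form \<open>T\<close> is determined by a skew complex bilinear map \<open>K\<close>, which \<open>F\<close>
  preserves, so that \<open>K(e\<^sub>i,e\<^sub>k)\<close> has a component along \<open>e\<^sub>n\<close> only if \<open>x\<^sub>n = x\<^sub>i + x\<^sub>k\<close>. If no weight \<open>x\<^sub>k\<close>
  vanishes, at most one of the three values of \<open>K\<close> is nonzero, and then a diagonal operator with a zero
  and a nonzero weight belongs to \<open>\<gg>\<close>; it is not a multiple of \<open>F\<close>.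

  Step 2: let \<open>F \<xi> = 0\<close>. All \<open>R(u,v)\<close> are multiples of \<open>F\<close>, so pairing the Bianchi identity with
  \<open>\<xi>\<close> kills the curvature; what remains says that \<open>T(\<xi>,\<cdot>)\<close> is a derivation of \<open>T\<close>. A trace
  computation shows that it also commutes with \<open>j\<close> (\<open>torsion_derivation_commutes_j\<close>), so
  \<open>T(\<xi>,\<cdot>) \<in> \<gg>\<close> is a multiple of \<open>F\<close>. The same holds for \<open>j \<xi>\<close>, and after turning \<open>\<xi>\<close> in the
  complex line that it spans, \<open>T(\<xi>,\<cdot>) = 0\<close>.

  Step 3: on the complement of \<open>\<xi>, j \<xi>\<close> a primitive \<open>3\<close>-form vanishes, so \<open>T = (j \<xi>)\<^sup>\<flat> \<and> \<omega>\<close> with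
  \<open>\<omega>\<close> a multiple of \<open>F\<close>. Such a form is fixed by the two-dimensional torus diagonal in the remaining
  eigenvectors, which contradicts \<open>dim \<gg> = 1\<close> (\<open>stabilizer_line_not_holonomy\<close>).
\<close>

section \<open>Smooth functions on open subsets of a euclidean space\<close>

lemma Ck_on_Suc_continuous: "Ck_on (Suc k) S f \<Longrightarrow> continuous_on S f"
  by (simp add: continuous_at_imp_continuous_on differentiable_imp_continuous_within)

lemma Ck_on_mono: "Ck_on (Suc k) S f \<Longrightarrow> Ck_on k S f"
proof (induction k arbitrary: f)
  case 0
  then show ?case unfolding Ck_on.simps(1) by (rule Ck_on_Suc_continuous)
next
  case (Suc k)
  then have "Ck_on k S (\<lambda>x. frechet_derivative f (at x) v)" for v by simp
  then show ?case using Suc.prems by simp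
qed

lemma Cinf_on_Suc_iff:
  "Cinf_on S f \<longleftrightarrow> (\<forall>x\<in>S. f differentiable (at x)) \<and> (\<forall>v. Cinf_on S (\<lambda>x. frechet_derivative f (at x) v))"
  unfolding Cinf_on_def by (metis Ck_on.simps(2) Ck_on_mono)

lemma Cinf_on_differentiable: "Cinf_on S f \<Longrightarrow> x \<in> S \<Longrightarrow> f differentiable (at x)"
  using Cinf_on_Suc_iff by blast

lemma Cinf_on_has_derivative:
  "Cinf_on S f \<Longrightarrow> x \<in> S \<Longrightarrow> (f has_derivative frechet_derivative f (at x)) (at x)"
  using Cinf_on_differentiable frechet_derivative_works by blast

lemma Cinf_on_deriv: "Cinf_on S f \<Longrightarrow> Cinf_on S (\<lambda>x. frechet_derivative f (at x) v)"
  using Cinf_on_Suc_iff by blast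

lemma Cinf_on_continuous: "Cinf_on S f \<Longrightarrow> continuous_on S f"
  unfolding Cinf_on_def using Ck_on.simps(1) by blast

lemma frechet_derivative_eqI: "(f has_derivative f') (at x) \<Longrightarrow> frechet_derivative f (at x) = f'"
  using frechet_derivative_at by metis

lemma frechet_derivative_cong_open:
  assumes "open S" "x \<in> S" "\<And>y. y \<in> S \<Longrightarrow> f y = g y"
  shows "frechet_derivative f (at x) = frechet_derivative g (at x)"
proof -
  have "(f has_derivative f') (at x) \<longleftrightarrow> (g has_derivative f') (at x)" for f'
    using has_derivative_transform_within_open[OF _ assms(1,2)] assms(3) by metis
  then show ?thesis unfolding frechet_derivative_def by simp
qed

lemma differentiable_cong_open:
  assumes "open S" "x \<in> S" "\<And>y. y \<in> S \<Longrightarrow> f y = g y" "f differentiable (at x)"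
  shows "g differentiable (at x)"
  using assms has_derivative_transform_within_open unfolding differentiable_def by metis

lemma Ck_on_cong:
  assumes "open S" "\<And>y. y \<in> S \<Longrightarrow> f y = g y" "Ck_on k S f"
  shows "Ck_on k S g"
  using assms(2,3)
proof (induction k arbitrary: f g)
  case 0
  then show ?case using continuous_on_cong by fastforce
next
  case (Suc k)
  have "frechet_derivative f (at x) = frechet_derivative g (at x)" if "x \<in> S" for x
    by (rule frechet_derivative_cong_open[OF assms(1) that Suc.prems(1)])
  then have "Ck_on k S (\<lambda>x. frechet_derivative g (at x) v)" for v
    using Suc.IH[of "\<lambda>x. frechet_derivative f (at x) v" "\<lambda>x. frechet_derivative g (at x) v"]
      Suc.prems(2) by simp
  moreover have "g differentiable (at x)" if "x \<in> S" for x
    using differentiable_cong_open[OF assms(1) that Suc.prems(1)] Suc.prems(2) that by simp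
  ultimately show ?case by simp
qed

lemma Cinf_on_cong:
  assumes "open S" "\<And>y. y \<in> S \<Longrightarrow> f y = g y" "Cinf_on S f"
  shows "Cinf_on S g"
  using assms Ck_on_cong unfolding Cinf_on_def by metis

lemma Ck_on_subset: "T \<subseteq> S \<Longrightarrow> Ck_on k S f \<Longrightarrow> Ck_on k T f"
  by (induction k arbitrary: f) (auto intro: continuous_on_subset)

lemma Cinf_on_subset: "T \<subseteq> S \<Longrightarrow> Cinf_on S f \<Longrightarrow> Cinf_on T f"
  unfolding Cinf_on_def using Ck_on_subset by blast

lemma Ck_on_const: "Ck_on k S (\<lambda>x. c)"
  by (induction k arbitrary: c) (auto simp: frechet_derivative_const)

lemma Cinf_on_const: "Cinf_on S (\<lambda>x. c)"
  unfolding Cinf_on_def using Ck_on_const by blast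

lemma Ck_on_bounded_linear:
  assumes "open S" "bounded_linear L" "Ck_on k S f"
  shows "Ck_on k S (\<lambda>x. L (f x))"
  using assms(3)
proof (induction k arbitrary: f)
  case 0
  then show ?case using assms(2) by (simp add: bounded_linear.continuous_on)
next
  case (Suc k)
  have d: "((\<lambda>x. L (f x)) has_derivative (\<lambda>v. L (frechet_derivative f (at x) v))) (at x)" if "x \<in> S" for x
    using Suc.prems that by (intro bounded_linear.has_derivative[OF assms(2)]) (simp add: frechet_derivative_works)
  have "Ck_on k S (\<lambda>x. frechet_derivative (\<lambda>x. L (f x)) (at x) v)" for v
    apply (rule Ck_on_cong[OF assms(1) _ Suc.IH[of "\<lambda>x. frechet_derivative f (at x) v"]])
    subgoal for x using frechet_derivative_eqI[OF d] by simp
    using Suc.prems by simp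
  then show ?case using differentiableI[OF d] by simp
qed

lemma Cinf_on_bounded_linear:
  "open S \<Longrightarrow> bounded_linear L \<Longrightarrow> Cinf_on S f \<Longrightarrow> Cinf_on S (\<lambda>x. L (f x))"
  unfolding Cinf_on_def using Ck_on_bounded_linear by blast

lemma Ck_on_add:
  assumes "open S" "Ck_on k S f" "Ck_on k S g"
  shows "Ck_on k S (\<lambda>x. f x + g x)"
  using assms(2,3)
proof (induction k arbitrary: f g)
  case 0
  then show ?case by (simp add: continuous_on_add)
next
  case (Suc k)
  have d: "((\<lambda>x. f x + g x) has_derivative
     (\<lambda>v. frechet_derivative f (at x) v + frechet_derivative g (at x) v)) (at x)" if "x \<in> S" for x
    using Suc.prems that by (intro has_derivative_add) (simp_all add: frechet_derivative_works)
  have "Ck_on k S (\<lambda>x. frechet_derivative (\<lambda>x. f x + g x) (at x) v)" for v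
    apply (rule Ck_on_cong[OF assms(1) _ Suc.IH[of "\<lambda>x. frechet_derivative f (at x) v" "\<lambda>x. frechet_derivative g (at x) v"]])
    subgoal for x using frechet_derivative_eqI[OF d] by simp
    using Suc.prems by simp_all
  then show ?case using differentiableI[OF d] by simp
qed

lemma Cinf_on_add: "open S \<Longrightarrow> Cinf_on S f \<Longrightarrow> Cinf_on S g \<Longrightarrow> Cinf_on S (\<lambda>x. f x + g x)"
  unfolding Cinf_on_def using Ck_on_add by blast

lemma Cinf_on_sum:
  assumes "open S" "\<And>i. i \<in> I \<Longrightarrow> Cinf_on S (f i)"
  shows "Cinf_on S (\<lambda>x. \<Sum>i\<in>I. f i x)"
  using assms(2)
  by (induction I rule: infinite_finite_induct) (auto intro: Cinf_on_const Cinf_on_add[OF assms(1)])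

lemma Ck_on_scaleR:
  assumes "open S" "Ck_on k S f" "Ck_on k S g"
  shows "Ck_on k S (\<lambda>x. f x *\<^sub>R g x)"
  using assms(2,3)
proof (induction k arbitrary: f g)
  case 0
  then show ?case by (simp add: continuous_on_scaleR)
next
  case (Suc k)
  have d: "((\<lambda>x. f x *\<^sub>R g x) has_derivative
     (\<lambda>v. f x *\<^sub>R frechet_derivative g (at x) v + frechet_derivative f (at x) v *\<^sub>R g x)) (at x)" if "x \<in> S" for x
    using Suc.prems that by (intro has_derivative_scaleR) (simp_all add: frechet_derivative_works)
  have "Ck_on k S (\<lambda>x. frechet_derivative (\<lambda>x. f x *\<^sub>R g x) (at x) v)" for v
  proof (rule Ck_on_cong[OF assms(1)])
    have "Ck_on k S f" "Ck_on k S g" using Suc.prems Ck_on_mono by auto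
    moreover have "Ck_on k S (\<lambda>x. frechet_derivative f (at x) v)"
      "Ck_on k S (\<lambda>x. frechet_derivative g (at x) v)" using Suc.prems by auto
    ultimately show "Ck_on k S (\<lambda>x. f x *\<^sub>R frechet_derivative g (at x) v + frechet_derivative f (at x) v *\<^sub>R g x)"
      by (intro Ck_on_add[OF assms(1)] Suc.IH)
    show "f x *\<^sub>R frechet_derivative g (at x) v + frechet_derivative f (at x) v *\<^sub>R g x
        = frechet_derivative (\<lambda>x. f x *\<^sub>R g x) (at x) v" if "x \<in> S" for x
      using frechet_derivative_eqI[OF d[OF that]] by simp
  qed
  then show ?case using differentiableI[OF d] by simp
qed

lemma Cinf_on_scaleR: "open S \<Longrightarrow> Cinf_on S f \<Longrightarrow> Cinf_on S g \<Longrightarrow> Cinf_on S (\<lambda>x. f x *\<^sub>R g x)"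
  unfolding Cinf_on_def using Ck_on_scaleR by blast

lemma linear_eq_sum_axis:
  fixes L :: "real^'n::finite \<Rightarrow> 'b::real_vector"
  assumes "linear L" shows "L v = (\<Sum>i\<in>UNIV. (v$i) *\<^sub>R L (axis i 1))"
proof -
  have "L v = L (\<Sum>i\<in>UNIV. (v$i) *\<^sub>R axis i 1)"
    using basis_expansion[of v] by (simp add: scalar_mult_eq_scaleR)
  then show ?thesis using assms by (simp add: linear_sum linear_scale)
qed

text \<open>The chain rule writes the derivative of \<open>g \<circ> f\<close> as a finite sum of products of components of
  \<open>f'\<close> with partial derivatives of \<open>g\<close> along \<open>f\<close>; this is why the inner space is coordinatised.\<close>
lemma Ck_on_compose:
  fixes f :: "'a::euclidean_space \<Rightarrow> real^'n::finite" and g :: "real^'n \<Rightarrow> 'b::real_normed_vector"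
  assumes "open S" "Ck_on k S f" "Ck_on k S' g" "f ` S \<subseteq> S'"
  shows "Ck_on k S (\<lambda>x. g (f x))"
  using assms(2,3)
proof (induction k arbitrary: g)
  case 0
  then show ?case using assms(4) by (simp add: continuous_on_compose2)
next
  case (Suc k)
  have d: "((\<lambda>x. g (f x)) has_derivative
     (\<lambda>v. frechet_derivative g (at (f x)) (frechet_derivative f (at x) v))) (at x)" if "x \<in> S" for x
  proof -
    have "(f has_derivative frechet_derivative f (at x)) (at x)"
      using Suc.prems that by (simp add: frechet_derivative_works)
    moreover have "(g has_derivative frechet_derivative g (at (f x))) (at (f x))"
      using Suc.prems that assms(4) by (simp add: frechet_derivative_works image_subset_iff)
    ultimately show ?thesis using diff_chain_at[of f _ x g] by (simp add: o_def)
  qed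
  have fk: "Ck_on k S (\<lambda>x. g' (f x))" if "Ck_on k S' g'" for g' :: "real^'n \<Rightarrow> 'b"
    using Suc.IH[OF Ck_on_mono[OF Suc.prems(1)]] that by blast
  have "Ck_on k S (\<lambda>x. frechet_derivative (\<lambda>x. g (f x)) (at x) v)" for v
  proof (rule Ck_on_cong[OF assms(1)])
    show "(\<Sum>i\<in>UNIV. (frechet_derivative f (at x) v $ i) *\<^sub>R frechet_derivative g (at (f x)) (axis i 1))
      = frechet_derivative (\<lambda>x. g (f x)) (at x) v" if "x \<in> S" for x
    proof -
      have "linear (frechet_derivative g (at (f x)))"
        using Suc.prems(2) that assms(4) by (auto intro!: linear_frechet_derivative)
      then show ?thesis
        unfolding frechet_derivative_eqI[OF d[OF that]] by (rule linear_eq_sum_axis[symmetric])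
    qed
    have "Ck_on k S (\<lambda>x. (frechet_derivative f (at x) v $ i) *\<^sub>R frechet_derivative g (at (f x)) (axis i 1))" for i
      using Suc.prems
      by (intro Ck_on_scaleR[OF assms(1)] fk Ck_on_bounded_linear[OF assms(1) bounded_linear_vec_nth]) auto
    then have "Ck_on k S (\<lambda>x. \<Sum>i\<in>I. (frechet_derivative f (at x) v $ i) *\<^sub>R frechet_derivative g (at (f x)) (axis i 1))" for I
      by (induction I rule: infinite_finite_induct) (auto intro: Ck_on_const Ck_on_add[OF assms(1)])
    then show "Ck_on k S (\<lambda>x. \<Sum>i\<in>UNIV. (frechet_derivative f (at x) v $ i) *\<^sub>R frechet_derivative g (at (f x)) (axis i 1))" .
  qed
  then show ?case using differentiableI[OF d] by simp
qed

lemma Cinf_on_compose: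
  fixes f :: "'a::euclidean_space \<Rightarrow> real^'n::finite" and g :: "real^'n \<Rightarrow> 'b::real_normed_vector"
  assumes "open S" "Cinf_on S f" "Cinf_on S' g" "f ` S \<subseteq> S'"
  shows "Cinf_on S (\<lambda>x. g (f x))"
  using assms Ck_on_compose unfolding Cinf_on_def by blast

text \<open>The mean value theorem in the direction \<open>u\<close>, then in the direction \<open>v\<close>. The left-hand side is
  symmetric in \<open>u\<close> and \<open>v\<close>.\<close>

lemma second_difference_mean_value:
  fixes f :: "'a::euclidean_space \<Rightarrow> real"
  assumes f: "Cinf_on S f" and s: "s > 0"
    and sub: "\<And>a b. 0 \<le> a \<Longrightarrow> a \<le> s \<Longrightarrow> 0 \<le> b \<Longrightarrow> b \<le> s \<Longrightarrow> x + a *\<^sub>R u + b *\<^sub>R v \<in> S"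
  shows "\<exists>a b. 0 \<le> a \<and> a \<le> s \<and> 0 \<le> b \<and> b \<le> s \<and>
     f (x + s *\<^sub>R u + s *\<^sub>R v) - f (x + s *\<^sub>R u) - f (x + s *\<^sub>R v) + f x
     = s * s * frechet_derivative (\<lambda>y. frechet_derivative f (at y) u) (at (x + a *\<^sub>R u + b *\<^sub>R v)) v"
proof -
  let ?g = "\<lambda>y. frechet_derivative f (at y) u"
  let ?F = "\<lambda>a. f (x + a *\<^sub>R u + s *\<^sub>R v) - f (x + a *\<^sub>R u)"
  have lin: "linear (frechet_derivative f (at y))" "linear (frechet_derivative ?g (at y))" if "y \<in> S" for y
    using Cinf_on_differentiable[OF f that] Cinf_on_differentiable[OF Cinf_on_deriv[OF f, of u] that]
      linear_frechet_derivative by blast+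
  have d1: "((\<lambda>a. f (x + a *\<^sub>R u + b *\<^sub>R v)) has_real_derivative ?g (x + a *\<^sub>R u + b *\<^sub>R v)) (at a)"
    if "0 \<le> a" "a \<le> s" "0 \<le> b" "b \<le> s" for a b
  proof -
    have "((\<lambda>a. x + a *\<^sub>R u + b *\<^sub>R v) has_derivative (\<lambda>t. t *\<^sub>R u)) (at a)"
      by (auto intro!: derivative_eq_intros)
    from diff_chain_at[OF this Cinf_on_has_derivative[OF f sub[OF that]]]
    show ?thesis
      by (simp add: o_def has_field_derivative_def linear_scale[OF lin(1)[OF sub[OF that]]] mult_commute_abs)
  qed
  have d2: "((\<lambda>b. ?g (x + a *\<^sub>R u + b *\<^sub>R v)) has_real_derivative
      frechet_derivative ?g (at (x + a *\<^sub>R u + b *\<^sub>R v)) v) (at b)"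
    if "0 \<le> a" "a \<le> s" "0 \<le> b" "b \<le> s" for a b
  proof -
    have "((\<lambda>b. x + a *\<^sub>R u + b *\<^sub>R v) has_derivative (\<lambda>t. t *\<^sub>R v)) (at b)"
      by (auto intro!: derivative_eq_intros)
    from diff_chain_at[OF this Cinf_on_has_derivative[OF Cinf_on_deriv[OF f, of u] sub[OF that]]]
    show ?thesis
      by (simp add: o_def has_field_derivative_def linear_scale[OF lin(2)[OF sub[OF that]]] mult_commute_abs)
  qed
  have "(?F has_real_derivative ?g (x + a *\<^sub>R u + s *\<^sub>R v) - ?g (x + a *\<^sub>R u)) (at a)"
    if "0 \<le> a" "a \<le> s" for a
    using d1[OF that, of s] d1[OF that, of 0] s by (intro DERIV_diff) auto
  then obtain a where a: "0 < a" "a < s"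
    "?F s - ?F 0 = (s - 0) * (?g (x + a *\<^sub>R u + s *\<^sub>R v) - ?g (x + a *\<^sub>R u))"
    using MVT2[OF s, of ?F "\<lambda>a. ?g (x + a *\<^sub>R u + s *\<^sub>R v) - ?g (x + a *\<^sub>R u)"] by blast
  obtain b where b: "0 < b" "b < s"
    "?g (x + a *\<^sub>R u + s *\<^sub>R v) - ?g (x + a *\<^sub>R u + 0 *\<^sub>R v)
      = (s - 0) * frechet_derivative ?g (at (x + a *\<^sub>R u + b *\<^sub>R v)) v"
    using MVT2[OF s, of "\<lambda>b. ?g (x + a *\<^sub>R u + b *\<^sub>R v)"
        "\<lambda>b. frechet_derivative ?g (at (x + a *\<^sub>R u + b *\<^sub>R v)) v"] d2 a by force
  have "f (x + s *\<^sub>R u + s *\<^sub>R v) - f (x + s *\<^sub>R u) - f (x + s *\<^sub>R v) + f x = ?F s - ?F 0"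
    by simp
  also have "\<dots> = s * s * frechet_derivative ?g (at (x + a *\<^sub>R u + b *\<^sub>R v)) v"
    using a(3) b(3) by simp
  finally show ?thesis using a b by (intro exI[of _ a] exI[of _ b]) auto
qed

text \<open>Both mixed second derivatives are limits of the same second difference quotient.\<close>
lemma second_derivative_symmetric_real:
  fixes f :: "'a::euclidean_space \<Rightarrow> real"
  assumes S: "open S" "x \<in> S" and f: "Cinf_on S f"
  shows "frechet_derivative (\<lambda>y. frechet_derivative f (at y) u) (at x) v
       = frechet_derivative (\<lambda>y. frechet_derivative f (at y) v) (at x) u" (is "?P x = ?Q x")
proof -
  have cP: "isCont ?P x" and cQ: "isCont ?Q x"
    using Cinf_on_continuous[OF Cinf_on_deriv[OF Cinf_on_deriv[OF f]]] S
    by (simp_all add: continuous_on_eq_continuous_at)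
  obtain e where e: "e > 0" "ball x e \<subseteq> S" using S openE by blast
  define N where "N = norm u + norm v + 1"
  have N: "N > 0" unfolding N_def by (smt (verit) norm_ge_zero)
  have near: "dist (x + a *\<^sub>R u + b *\<^sub>R v) x < d"
    if "0 \<le> a" "a \<le> s" "0 \<le> b" "b \<le> s" "s * N < d" "s > 0" for a b s d
  proof -
    have "norm (a *\<^sub>R u + b *\<^sub>R v) \<le> a * norm u + b * norm v"
      using that by (metis (no_types) abs_of_nonneg norm_scaleR norm_triangle_ineq)
    also have "\<dots> \<le> s * norm u + s * norm v" using that by (intro add_mono mult_right_mono) auto
    also have "\<dots> < s * N" using that unfolding N_def by (simp add: algebra_simps)
    finally show ?thesis using that by (simp add: dist_norm add.assoc)
  qed
  have "dist (?P x) (?Q x) < r" if r: "r > 0" for r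
  proof -
    obtain d1 where d1: "d1 > 0" "\<And>y. dist y x < d1 \<Longrightarrow> dist (?P y) (?P x) < r/2"
      using cP r unfolding continuous_at_eps_delta by (metis half_gt_zero)
    obtain d2 where d2: "d2 > 0" "\<And>y. dist y x < d2 \<Longrightarrow> dist (?Q y) (?Q x) < r/2"
      using cQ r unfolding continuous_at_eps_delta by (metis half_gt_zero)
    define d where "d = min e (min d1 d2)"
    \<comment> \<open>Keeps the parallelogram spanned by \<open>s u\<close> and \<open>s v\<close> within distance \<open>d\<close> of \<open>x\<close>.\<close>
    define s where "s = d / (2 * N)"
    have d: "d > 0" using e d1 d2 by (simp add: d_def)
    then have s: "s > 0" "s * N < d" using N by (simp_all add: s_def)
    have "x + a *\<^sub>R u + b *\<^sub>R v \<in> S" "x + a *\<^sub>R v + b *\<^sub>R u \<in> S"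
      if "0 \<le> a" "a \<le> s" "0 \<le> b" "b \<le> s" for a b
      using near[OF that s(2,1)] near[OF that(3,4,1,2) s(2,1)] e(2)
      by (auto simp: d_def dist_commute add_ac subset_iff)
    note sub = this
    obtain a b where ab: "0 \<le> a" "a \<le> s" "0 \<le> b" "b \<le> s"
      "f (x + s *\<^sub>R u + s *\<^sub>R v) - f (x + s *\<^sub>R u) - f (x + s *\<^sub>R v) + f x = s * s * ?P (x + a *\<^sub>R u + b *\<^sub>R v)"
      using second_difference_mean_value[OF f s(1) sub(1)] by blast
    obtain a' b' where ab': "0 \<le> a'" "a' \<le> s" "0 \<le> b'" "b' \<le> s"
      "f (x + s *\<^sub>R v + s *\<^sub>R u) - f (x + s *\<^sub>R v) - f (x + s *\<^sub>R u) + f x = s * s * ?Q (x + a' *\<^sub>R v + b' *\<^sub>R u)"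
      using second_difference_mean_value[OF f s(1) sub(2)] by blast
    have "s * s * ?P (x + a *\<^sub>R u + b *\<^sub>R v) = s * s * ?Q (x + a' *\<^sub>R v + b' *\<^sub>R u)"
      unfolding ab(5)[symmetric] ab'(5)[symmetric] by (simp add: add_ac)
    then have eq: "?P (x + a *\<^sub>R u + b *\<^sub>R v) = ?Q (x + a' *\<^sub>R v + b' *\<^sub>R u)" using s by simp
    have "dist (?P (x + a *\<^sub>R u + b *\<^sub>R v)) (?P x) < r/2"
      by (rule d1(2)) (use near[OF ab(1-4) s(2,1)] d_def in auto)
    moreover have "dist (?Q (x + a' *\<^sub>R v + b' *\<^sub>R u)) (?Q x) < r/2"
      by (rule d2(2)) (use near[OF ab'(3,4,1,2) s(2,1)] d_def in \<open>auto simp: add_ac\<close>)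
    ultimately show ?thesis using eq by (metis dist_commute dist_triangle_half_l)
  qed
  then show ?thesis by (metis dist_pos_lt less_irrefl)
qed

lemma second_derivative_symmetric:
  fixes f :: "'a::euclidean_space \<Rightarrow> real^'n::finite"
  assumes S: "open S" "x \<in> S" and f: "Cinf_on S f"
  shows "frechet_derivative (\<lambda>y. frechet_derivative f (at y) u) (at x) v
       = frechet_derivative (\<lambda>y. frechet_derivative f (at y) v) (at x) u"
proof -
  have comp: "frechet_derivative (\<lambda>z. h z $ i) (at y) w = frechet_derivative h (at y) w $ i"
    if "Cinf_on S h" "y \<in> S" for h :: "'a \<Rightarrow> real^'n" and i y w
    using frechet_derivative_eqI[OF bounded_linear.has_derivative[OF bounded_linear_vec_nth Cinf_on_has_derivative[OF that]]]
    by metis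
  have *: "frechet_derivative (\<lambda>y. frechet_derivative f (at y) u) (at x) v $ i
     = frechet_derivative (\<lambda>y. frechet_derivative (\<lambda>z. f z $ i) (at y) u) (at x) v" for u v i
    using comp[OF Cinf_on_deriv[OF f] S(2), of u i v]
      frechet_derivative_cong_open[OF S, of "\<lambda>y. frechet_derivative f (at y) u $ i" "\<lambda>y. frechet_derivative (\<lambda>z. f z $ i) (at y) u"]
      comp[OF f] by simp
  show ?thesis
    unfolding vec_eq_iff *
    using second_derivative_symmetric_real[OF S Cinf_on_bounded_linear[OF S(1) bounded_linear_vec_nth f]] by blast
qed

section \<open>Hermitian vector spaces\<close>

locale hermitian_space =
  fixes h :: "'a::euclidean_space \<Rightarrow> 'a \<Rightarrow> real" and j :: "'a \<Rightarrow> 'a"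
  assumes h_bilinear: "bilinear h"
    and h_sym: "h v w = h w v"
    and h_pos: "v \<noteq> 0 \<Longrightarrow> h v v > 0"
    and j_linear: "linear j"
    and j_j [simp]: "j (j v) = - v"
    and h_j [simp]: "h (j v) (j w) = h v w"
begin

lemmas h_simps [simp] =
  bilinear_ladd[OF h_bilinear] bilinear_radd[OF h_bilinear] bilinear_lmul[OF h_bilinear]
  bilinear_rmul[OF h_bilinear] bilinear_lneg[OF h_bilinear] bilinear_rneg[OF h_bilinear]
  bilinear_lsub[OF h_bilinear] bilinear_rsub[OF h_bilinear] bilinear_lzero[OF h_bilinear]
  bilinear_rzero[OF h_bilinear]

lemmas j_simps [simp] =
  linear_add[OF j_linear] linear_scale[OF j_linear] linear_neg[OF j_linear]
  linear_diff[OF j_linear] linear_0[OF j_linear]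

lemma linear_h_left: "linear (\<lambda>v. h v w)"
  using h_bilinear by (simp add: bilinear_def)

lemma linear_h_right: "linear (h v)"
  using h_bilinear by (simp add: bilinear_def)

lemma h_sum_left: "h (\<Sum>x\<in>S. f x) w = (\<Sum>x\<in>S. h (f x) w)"
  by (rule linear_sum[OF linear_h_left])

lemma h_eq_0_iff: "h v v = 0 \<longleftrightarrow> v = 0"
  using h_pos[of v] by fastforce

lemma h_ge_0: "h v v \<ge> 0"
  using h_pos[of v] by (cases "v = 0") auto

lemma h_eqI: "(\<And>z. h v z = h w z) \<Longrightarrow> v = w"
  using h_eq_0_iff[of "v - w"] by simp

lemma h_j_left: "h (j v) w = - h v (j w)"
  using h_j[of v "j w"] by (metis h_j h_simps(6) j_j minus_minus)

lemma h_j_self [simp]: "h v (j v) = 0" "h (j v) v = 0"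
  using h_j_left[of v v] h_sym[of v "j v"] by simp_all

text \<open>A set instead of an indexed family, so that frames with different index types can be compared.\<close>
definition orthonormal :: "'a set \<Rightarrow> bool" where
  "orthonormal S \<longleftrightarrow> finite S \<and> (\<forall>x\<in>S. \<forall>y\<in>S. h x y = (if x = y then 1 else 0))"

lemma orthonormal_residual:
  assumes "orthonormal S" "x \<in> S"
  shows "h (v - (\<Sum>y\<in>S. h v y *\<^sub>R y)) x = 0"
proof -
  have "(\<Sum>y\<in>S. h v y * h y x) = (\<Sum>y\<in>S. if y = x then h v x else 0)"
    using assms by (intro sum.cong) (auto simp: orthonormal_def)
  also have "\<dots> = h v x" using assms by (simp add: orthonormal_def)
  finally show ?thesis by (simp add: h_sum_left)
qed

lemma h_zero_on_span: "(\<And>x. x \<in> S \<Longrightarrow> h v x = 0) \<Longrightarrow> w \<in> span S \<Longrightarrow> h v w = 0"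
  using linear_eq_0_on_span[OF linear_h_right] by blast

lemma orthonormal_independent:
  assumes "orthonormal S" shows "independent S"
proof
  assume "dependent S"
  then obtain x where x: "x \<in> S" "x \<in> span (S - {x})" unfolding dependent_def by blast
  have "h x y = 0" if "y \<in> S - {x}" for y using assms that x(1) by (auto simp: orthonormal_def)
  from h_zero_on_span[OF this x(2)] have "h x x = 0" by simp
  then show False using assms x by (auto simp: orthonormal_def)
qed

lemma orthonormal_expand:
  assumes S: "orthonormal S" "card S = DIM('a)"
  shows "v = (\<Sum>x\<in>S. h v x *\<^sub>R x)"
proof -
  let ?r = "v - (\<Sum>x\<in>S. h v x *\<^sub>R x)"
  have "?r \<in> span S"
    using card_ge_dim_independent[OF subset_UNIV orthonormal_independent[OF S(1)]] S(2)
    by (auto simp: dim_UNIV)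
  then have "h ?r ?r = 0" using h_zero_on_span orthonormal_residual[OF S(1)] by blast
  then have "?r = 0" by (simp only: h_eq_0_iff)
  then show ?thesis by (simp only: eq_iff_diff_eq_0[symmetric])
qed

lemma orthogonal_vector_exists:
  assumes S: "orthonormal S" "card S < DIM('a)"
  obtains v where "v \<noteq> 0" "\<And>x. x \<in> S \<Longrightarrow> h v x = 0"
proof -
  have "dim S \<le> card S" using S by (simp add: dim_le_card' orthonormal_def)
  then have "span S \<noteq> UNIV" using S(2) by (metis dim_UNIV dim_span leD)
  then obtain v where v: "v \<notin> span S" by blast
  let ?r = "v - (\<Sum>y\<in>S. h v y *\<^sub>R y)"
  have "?r \<noteq> 0" using v by (metis (no_types, lifting) eq_iff_diff_eq_0 span_base span_scale span_sum)
  then show ?thesis using that orthonormal_residual[OF S(1)] by blast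
qed

text \<open>Transfers the primitivity of the torsion, which is given in one frame, to the eigenframes of the
  isotropy algebra.\<close>
lemma trace_frame_independent:
  assumes S: "orthonormal S" "card S = DIM('a)" and S': "orthonormal S'" "card S' = DIM('a)"
    and \<beta>: "bilinear (\<beta> :: 'a \<Rightarrow> 'a \<Rightarrow> real)"
  shows "(\<Sum>x\<in>S. \<beta> x x) = (\<Sum>y\<in>S'. \<beta> y y)"
proof -
  have l: "linear (\<lambda>x. \<beta> x z)" "linear (\<beta> z)" for z using \<beta> by (simp_all add: bilinear_def)
  have "(\<Sum>x\<in>S. \<beta> x x) = (\<Sum>x\<in>S. \<beta> (\<Sum>y\<in>S'. h x y *\<^sub>R y) x)"
    by (simp only: orthonormal_expand[OF S', symmetric])
  also have "\<dots> = (\<Sum>x\<in>S. \<Sum>y\<in>S'. h x y * \<beta> y x)"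
    by (simp add: linear_sum[OF l(1)] linear_scale[OF l(1)])
  also have "\<dots> = (\<Sum>y\<in>S'. \<Sum>x\<in>S. h x y * \<beta> y x)" by (rule sum.swap)
  also have "\<dots> = (\<Sum>y\<in>S'. \<beta> y (\<Sum>x\<in>S. h y x *\<^sub>R x))"
    by (simp add: linear_sum[OF l(2)] linear_scale[OF l(2)] h_sym)
  also have "\<dots> = (\<Sum>y\<in>S'. \<beta> y y)" by (simp only: orthonormal_expand[OF S, symmetric])
  finally show ?thesis .
qed

lemma trace_commute:
  assumes S: "orthonormal S" "card S = DIM('a)" and F: "linear F" and G: "linear G"
  shows "(\<Sum>x\<in>S. h (F (G x)) x) = (\<Sum>x\<in>S. h (G (F x)) x)"
proof -
  have *: "h (F (G x)) x = (\<Sum>y\<in>S. h (G x) y * h (F y) x)" if "linear F" for F G x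
  proof -
    have "h (F (G x)) x = h (F (\<Sum>y\<in>S. h (G x) y *\<^sub>R y)) x"
      by (simp only: orthonormal_expand[OF S, symmetric])
    also have "\<dots> = (\<Sum>y\<in>S. h (G x) y * h (F y) x)"
      by (simp add: linear_sum[OF that] linear_scale[OF that] h_sum_left)
    finally show ?thesis .
  qed
  have "(\<Sum>x\<in>S. h (F (G x)) x) = (\<Sum>x\<in>S. \<Sum>y\<in>S. h (G x) y * h (F y) x)"
    using *[OF F] by simp
  also have "\<dots> = (\<Sum>y\<in>S. \<Sum>x\<in>S. h (F y) x * h (G x) y)"
    by (subst sum.swap) (simp add: mult.commute)
  also have "\<dots> = (\<Sum>x\<in>S. h (G (F x)) x)" using *[OF G] by simp
  finally show ?thesis .
qed

text \<open>A maximiser of the Rayleigh quotient is an eigenvector: the form \<open>l h - h(A \<cdot>, \<cdot>)\<close> is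
  nonnegative and vanishes at it, so its first variation there vanishes as well.\<close>

lemma symmetric_eigenvector:
  assumes A: "linear A" "\<And>v w. h (A v) w = h v (A w)"
    and W: "subspace W" "W \<noteq> {0}" "\<And>v. v \<in> W \<Longrightarrow> A v \<in> W"
  obtains u l where "u \<in> W" "u \<noteq> 0" "A u = l *\<^sub>R u"
proof -
  let ?K = "W \<inter> sphere 0 1"
  let ?q = "\<lambda>v. h (A v) v" and ?n = "\<lambda>v. h v v"
  have K: "compact ?K"
    using closed_subspace[OF W(1)] by (simp add: closed_Int_compact)
  obtain w where w: "w \<in> W" "w \<noteq> 0" using W(1,2) subspace_0 by blast
  then have "(1 / norm w) *\<^sub>R w \<in> ?K" using W(1) by (simp add: subspace_scale)
  then have Kne: "?K \<noteq> {}" by blast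
  have bb: "bounded_bilinear h" using h_bilinear by (simp add: bilinear_conv_bounded_bilinear)
  have "continuous_on ?K ?n" "continuous_on ?K ?q"
    by (intro bounded_bilinear.continuous_on[OF bb] continuous_on_id linear_continuous_on
        linear_conv_bounded_linear[THEN iffD1] A(1))+
  then have "continuous_on ?K (\<lambda>v. ?q v / ?n v)"
    by (intro continuous_on_divide) (auto simp: h_eq_0_iff)
  then obtain u where u: "u \<in> ?K" "\<And>v. v \<in> ?K \<Longrightarrow> ?q v / ?n v \<le> ?q u / ?n u"
    using continuous_attains_sup[OF K Kne] by blast
  define l where "l = ?q u / ?n u"
  have u0: "u \<noteq> 0" "u \<in> W" using u(1) by auto
  have le: "?q v \<le> l * ?n v" if v: "v \<in> W" for v
  proof (cases "v = 0")
    case False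
    let ?v = "(1 / norm v) *\<^sub>R v"
    have "?v \<in> ?K" using v W(1) False by (simp add: subspace_scale)
    from u(2)[OF this] have "?q v / ?n v \<le> l"
      using False by (simp add: linear_scale[OF A(1)] l_def)
    then show ?thesis using h_pos[OF False] by (simp add: divide_le_eq)
  qed (simp add: linear_0[OF A(1)])
  have equ: "?q u = l * ?n u" using h_pos[OF u0(1)] by (simp add: l_def)
  define r where "r = A u - l *\<^sub>R u"
  have rW: "r \<in> W" unfolding r_def using W u0 by (simp add: subspace_diff subspace_scale)
  define C where "C = l * ?n r - ?q r"
  have "2 * t * ?n r \<le> t * t * C" for t
  proof -
    have "u + t *\<^sub>R r \<in> W" using W(1) u0 rW by (simp add: subspace_add subspace_scale)
    from le[OF this] have "?q u + 2 * t * h (A u) r + t * t * ?q r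
        \<le> l * (?n u + 2 * t * h u r + t * t * ?n r)"
      using A(2)[of r u] h_sym[of r "A u"] h_sym[of r u]
      by (simp add: linear_add[OF A(1)] linear_scale[OF A(1)] algebra_simps)
    then have "2 * t * (h (A u) r - l * h u r) \<le> t * t * C"
      unfolding C_def using equ by (simp add: algebra_simps)
    moreover have "h (A u) r - l * h u r = ?n r" by (simp add: r_def algebra_simps)
    ultimately show ?thesis by simp
  qed
  note ineq = this
  have "?n r = 0"
  proof (rule ccontr)
    assume "?n r \<noteq> 0"
    then have n: "?n r > 0" using h_ge_0[of r] by linarith
    \<comment> \<open>Small enough for the linear term of the variation to dominate the quadratic one.\<close>
    let ?t = "?n r / (\<bar>C\<bar> + 1)"
    have t: "?t > 0" using n by simp
    have "2 * ?n r \<le> ?t * C" using ineq[of ?t] t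
      by (metis (no_types, opaque_lifting) mult.assoc mult.left_commute mult_le_cancel_left_pos)
    also have "\<dots> \<le> ?t * (\<bar>C\<bar> + 1)" using t by (intro mult_left_mono) auto
    also have "\<dots> = ?n r" by (simp add: field_simps)
    finally show False using n by simp
  qed
  then have "r = 0" by (simp only: h_eq_0_iff)
  then have "A u = l *\<^sub>R u" by (simp add: r_def)
  then show ?thesis using that u0 by blast
qed

text \<open>The Lie algebra \<open>\<uu>(h,j)\<close>.\<close>
definition unitary_algebra :: "('a \<Rightarrow> 'a) \<Rightarrow> bool" where
  "unitary_algebra F \<longleftrightarrow>
     linear F \<and> (\<forall>v w. h (F v) w = - h v (F w)) \<and> (\<forall>v. F (j v) = j (F v))"

text \<open>For \<open>F\<close> in \<open>\<uu>(h,j)\<close> the operator \<open>j F\<close> is symmetric, and it preserves the orthogonal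
  complement of \<open>j\<close>-invariant eigenvectors that are already found.\<close>
lemma orthogonal_eigenvector_exists:
  assumes F: "unitary_algebra F" and S: "orthonormal S" "card S < DIM('a)"
    and Sj: "\<And>x. x \<in> S \<Longrightarrow> j x \<in> S \<or> - j x \<in> S"
    and SF: "\<And>x. x \<in> S \<Longrightarrow> \<exists>c. F x = c *\<^sub>R j x"
  obtains e x where "h e e = 1" "F e = x *\<^sub>R j e" "\<And>y. y \<in> S \<Longrightarrow> h e y = 0"
proof -
  let ?W = "{v. \<forall>x\<in>S. h v x = 0}"
  have F': "linear F" "\<And>v w. h (F v) w = - h v (F w)" "\<And>v. F (j v) = j (F v)"
    using F by (auto simp: unitary_algebra_def)
  have jx: "h v (j x) = 0" if "v \<in> ?W" "x \<in> S" for v x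
    using Sj[OF that(2)] that(1) by (metis (mono_tags, lifting) h_simps(6) mem_Collect_eq neg_equal_0_iff_equal)
  have W: "j v \<in> ?W" "F v \<in> ?W" if "v \<in> ?W" for v
  proof -
    show "j v \<in> ?W" using jx[OF that] by (auto simp: h_j_left)
    have "h (F v) x = 0" if "x \<in> S" for x
      using SF[OF that] jx[OF \<open>v \<in> ?W\<close> that] by (auto simp: F'(2))
    then show "F v \<in> ?W" by simp
  qed
  have sub: "subspace ?W" by (auto simp: subspace_def)
  obtain w where "w \<noteq> 0" "\<And>x. x \<in> S \<Longrightarrow> h w x = 0" 
    by (rule orthogonal_vector_exists[OF S]) blast
  then have "w \<in> ?W" "w \<notin> {0}" by simp_all
  then have ne: "?W \<noteq> {0}" by metis
  have lin: "linear (\<lambda>v. j (F v))"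
    using linear_compose[OF F'(1) j_linear] by (simp add: o_def)
  have "h (j (F v)) w = h v (j (F w))" for v w
    by (simp add: h_j_left F'(2,3))
  from symmetric_eigenvector[OF lin this sub ne W(1)[OF W(2)]]
  obtain u l where u: "u \<in> ?W" "u \<noteq> 0" "j (F u) = l *\<^sub>R u" .
  from u(3) have "j (j (F u)) = j (l *\<^sub>R u)" by simp
  then have Fu: "F u = (-l) *\<^sub>R j u" by (metis j_j j_simps(2) minus_equation_iff scaleR_minus_left)
  let ?e = "(1 / sqrt (h u u)) *\<^sub>R u"
  have "h ?e ?e = 1" using h_pos[OF u(2)]
    by (simp add: field_simps)
  moreover have "F ?e = (-l) *\<^sub>R j ?e" using Fu by (simp add: linear_scale[OF F'(1)])
  moreover have "h ?e y = 0" if "y \<in> S" for y using u(1) that by simp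
  ultimately show ?thesis by (rule that)
qed

text \<open>The index set is \<open>{0,1,2}\<close>; over the reals the frame consists of the \<open>e k\<close> and the \<open>j (e k)\<close>.\<close>
definition unitary_frame :: "(nat \<Rightarrow> 'a) \<Rightarrow> bool" where
  "unitary_frame e \<longleftrightarrow>
     (\<forall>i<3. \<forall>k<3. h (e i) (e k) = (if i = k then 1 else 0) \<and> h (e i) (j (e k)) = 0)"

lemma unitary_eigenframe_exists:
  assumes dim: "DIM('a) = 6" and F: "unitary_algebra F"
    and \<xi>: "h \<xi> \<xi> = 1" "F \<xi> = c *\<^sub>R j \<xi>"
  obtains e x where "unitary_frame e" "\<And>k. k < 3 \<Longrightarrow> F (e k) = x k *\<^sub>R j (e k)" "e 2 = \<xi>" "x 2 = c"
proof -
  have F': "linear F" "\<And>v w. h (F v) w = - h v (F w)" "\<And>v. F (j v) = j (F v)"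
    using F by (auto simp: unitary_algebra_def)
  have neq: "a \<noteq> b" if "h a a = 1" "h a b = 0" for a b using that by auto
  have nj: "j v \<noteq> v" "v \<noteq> j v" if "h v v = 1" for v
    using that h_j_self(1)[of v] by (metis zero_neq_one)+
  have o1: "orthonormal {\<xi>, j \<xi>}" using \<xi> nj[OF \<xi>(1)] by (auto simp: orthonormal_def)
  have c1: "card {\<xi>, j \<xi>} < DIM('a)" by (simp add: dim card_insert_if)
  have Fj: "\<exists>c'. F (j v) = c' *\<^sub>R j (j v)" if "F v = c *\<^sub>R j v" for v c using that F'(3) by auto
  obtain a x where a: "h a a = 1" "F a = x *\<^sub>R j a" "\<And>y. y \<in> {\<xi>, j \<xi>} \<Longrightarrow> h a y = 0"
  proof (rule orthogonal_eigenvector_exists[OF F o1 c1])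
    show "j x \<in> {\<xi>, j \<xi>} \<or> - j x \<in> {\<xi>, j \<xi>}" if "x \<in> {\<xi>, j \<xi>}" for x using that by auto
    show "\<exists>c. F x = c *\<^sub>R j x" if "x \<in> {\<xi>, j \<xi>}" for x using that \<xi>(2) Fj[OF \<xi>(2)] by blast
  qed blast
  have a': "h a \<xi> = 0" "h a (j \<xi>) = 0" "h \<xi> a = 0" "h \<xi> (j a) = 0" "h (j \<xi>) a = 0" "h (j a) \<xi> = 0"
  proof -
    show "h a \<xi> = 0" "h a (j \<xi>) = 0" using a(3) by simp_all
    then show "h \<xi> a = 0" "h \<xi> (j a) = 0" "h (j \<xi>) a = 0" "h (j a) \<xi> = 0"
      using h_sym[of \<xi> a] h_sym[of "j \<xi>" a] h_j_left[of a \<xi>] h_sym[of \<xi> "j a"] by simp_all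
  qed
  have o2: "orthonormal {\<xi>, j \<xi>, a, j a}"
  proof -
    have "j \<xi> \<noteq> j a" "j a \<noteq> j \<xi>" using \<xi>(1) a'(3) h_j[of \<xi> \<xi>] h_j[of \<xi> a] by force+
    then show ?thesis using \<xi> a(1) a' nj[OF \<xi>(1)] nj[OF a(1)] by (auto simp: orthonormal_def)
  qed
  have c2: "card {\<xi>, j \<xi>, a, j a} < DIM('a)" by (simp add: dim card_insert_if)
  obtain b z where b: "h b b = 1" "F b = z *\<^sub>R j b" "\<And>y. y \<in> {\<xi>, j \<xi>, a, j a} \<Longrightarrow> h b y = 0"
  proof (rule orthogonal_eigenvector_exists[OF F o2 c2])
    show "j x \<in> {\<xi>, j \<xi>, a, j a} \<or> - j x \<in> {\<xi>, j \<xi>, a, j a}" if "x \<in> {\<xi>, j \<xi>, a, j a}" for x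
      using that by auto
    show "\<exists>c. F x = c *\<^sub>R j x" if "x \<in> {\<xi>, j \<xi>, a, j a}" for x
      using that \<xi>(2) a(2) Fj[OF \<xi>(2)] Fj[OF a(2)] by blast
  qed blast
  have b': "h b \<xi> = 0" "h b (j \<xi>) = 0" "h \<xi> b = 0" "h \<xi> (j b) = 0"
    "h b a = 0" "h b (j a) = 0" "h a b = 0" "h a (j b) = 0"
  proof -
    show "h b \<xi> = 0" "h b (j \<xi>) = 0" "h b a = 0" "h b (j a) = 0" using b(3) by simp_all
    then show "h \<xi> b = 0" "h \<xi> (j b) = 0" "h a b = 0" "h a (j b) = 0"
      using h_sym[of \<xi> b] h_sym[of a b] h_j_left[of b \<xi>] h_j_left[of b a]
        h_sym[of \<xi> "j b"] h_sym[of a "j b"] by simp_all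
  qed
  define e where "e k = (if k = 0 then a else if k = 1 then b else \<xi>)" for k :: nat
  define X where "X k = (if k = 0 then x else if k = 1 then z else c)" for k :: nat
  have less3: "k < 3 \<longleftrightarrow> k = 0 \<or> k = 1 \<or> k = 2" for k :: nat by auto
  show ?thesis
  proof
    show "unitary_frame e"
      unfolding unitary_frame_def less3 using \<xi> a b a' b' by (auto simp: e_def)
    show "F (e k) = X k *\<^sub>R j (e k)" for k using \<xi> a b by (auto simp: e_def X_def)
  qed (auto simp: e_def X_def)
qed

lemma unitary_frame_orthonormal:
  assumes e: "unitary_frame e"
  shows "orthonormal (e ` {..<3} \<union> (\<lambda>k. j (e k)) ` {..<3})"
    "inj_on e {..<3}" "inj_on (\<lambda>k. j (e k)) {..<3}" "e ` {..<3} \<inter> (\<lambda>k. j (e k)) ` {..<3} = {}"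
proof -
  have e': "h (e i) (e k) = (if i = k then 1 else 0)" "h (e i) (j (e k)) = 0" "h (j (e i)) (e k) = 0"
    if "i < 3" "k < 3" for i k
    using e that by (auto simp: unitary_frame_def h_j_left)
  show inj: "inj_on e {..<3}"
    by (rule inj_onI) (metis e'(1) lessThan_iff zero_neq_one)
  show "inj_on (\<lambda>k. j (e k)) {..<3}"
    by (rule inj_onI) (metis e'(1) h_j lessThan_iff zero_neq_one)
  have ne: "e i \<noteq> j (e k)" if "i < 3" "k < 3" for i k
    using e'(1)[OF that(1) that(1)] e'(2)[OF that] by auto
  then show "e ` {..<3} \<inter> (\<lambda>k. j (e k)) ` {..<3} = {}" by auto
  show "orthonormal (e ` {..<3} \<union> (\<lambda>k. j (e k)) ` {..<3})"
    unfolding orthonormal_def using e' ne ne[symmetric]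
    by (auto split: if_splits)
qed

lemma sum_unitary_frame:
  assumes "unitary_frame e"
  shows "(\<Sum>x \<in> e ` {..<3} \<union> (\<lambda>k. j (e k)) ` {..<3}. f x) = (\<Sum>k<3. f (e k) + f (j (e k)))"
  using unitary_frame_orthonormal[OF assms]
  by (subst sum.union_disjoint) (auto simp: sum.reindex sum.distrib)

lemma card_unitary_frame:
  assumes "unitary_frame e"
  shows "card (e ` {..<3} \<union> (\<lambda>k. j (e k)) ` {..<3}) = 6"
  using unitary_frame_orthonormal[OF assms]
  by (subst card_Un_disjoint) (auto simp: card_image)

lemma unitary_frame_expand:
  assumes "DIM('a) = 6" "unitary_frame e"
  shows "v = (\<Sum>k<3. h v (e k) *\<^sub>R e k + h v (j (e k)) *\<^sub>R j (e k))"
  using orthonormal_expand[OF unitary_frame_orthonormal(1)[OF assms(2)], of v]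
    card_unitary_frame[OF assms(2)] assms sum_unitary_frame[OF assms(2), of "\<lambda>x. h v x *\<^sub>R x"]
  by simp

lemma unitary_frame_zeroI:
  assumes "DIM('a) = 6" "unitary_frame e" "\<And>k. k < 3 \<Longrightarrow> h v (e k) = 0" "\<And>k. k < 3 \<Longrightarrow> h v (j (e k)) = 0"
  shows "v = 0"
  by (subst unitary_frame_expand[OF assms(1,2)]) (simp add: assms(3,4))

end

section \<open>Torsion tensors of type \<open>\<W>\<^sub>3\<close> on a hermitian vector space\<close>

text \<open>The two skewness axioms make \<open>h (T x y) z\<close> a \<open>3\<close>-form; \<open>T_type\<close> says that it has no \<open>(3,0)\<close> part,
  and for the torsion of a connection with parallel \<open>j\<close> it is the vanishing of the Nijenhuis tensor.\<close>
locale hermitian_torsion = hermitian_space h j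
  for h :: "'a::euclidean_space \<Rightarrow> 'a \<Rightarrow> real" and j :: "'a \<Rightarrow> 'a" +
  fixes T :: "'a \<Rightarrow> 'a \<Rightarrow> 'a"
  assumes T_bilinear: "bilinear T"
    and T_skew: "T y x = - T x y"
    and T_skew_form: "h (T x y) z = - h (T x z) y"
    and T_type: "T (j x) (j y) - T x y = j (T (j x) y + T x (j y))"
begin

lemmas T_simps [simp] =
  bilinear_ladd[OF T_bilinear] bilinear_radd[OF T_bilinear] bilinear_lmul[OF T_bilinear]
  bilinear_rmul[OF T_bilinear] bilinear_lneg[OF T_bilinear] bilinear_rneg[OF T_bilinear]
  bilinear_lsub[OF T_bilinear] bilinear_rsub[OF T_bilinear] bilinear_lzero[OF T_bilinear]
  bilinear_rzero[OF T_bilinear]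

lemma linear_T_right: "linear (T x)"
  using T_bilinear by (simp add: bilinear_def)

lemma T_self [simp]: "T x x = 0"
proof -
  have "T x x + T x x = 0" using T_skew[of x x] by (metis add.right_inverse)
  then show ?thesis by (simp flip: scaleR_2)
qed

lemma T_cyclic: "h (T x y) z = h (T y z) x"
  by (metis T_skew T_skew_form h_simps(5) minus_minus)

lemma T_form_repeated [simp]: "h (T x y) y = 0" "h (T x y) x = 0"
  using T_skew_form[of x y y] T_cyclic[of x y x] T_skew_form[of y x x] by simp_all

definition torsion_stabilizer :: "('a \<Rightarrow> 'a) \<Rightarrow> bool" where
  "torsion_stabilizer F \<longleftrightarrow> unitary_algebra F \<and> (\<forall>v w. F (T v w) = T (F v) w + T v (F w))"

text \<open>For \<open>T\<close> without \<open>(3,0)\<close> part this is twice the complex bilinear part of \<open>T\<close>.\<close>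
definition K :: "'a \<Rightarrow> 'a \<Rightarrow> 'a" where
  "K x y = T x y - T (j x) (j y)"

lemma K_j: "K (j x) y = j (K x y)" "K x (j y) = j (K x y)"
proof -
  have *: "j (K x y) = T (j x) y + T x (j y)"
    using arg_cong[OF T_type[of x y], of j] unfolding K_def by (simp add: algebra_simps)
  show "K (j x) y = j (K x y)" "K x (j y) = j (K x y)" unfolding * by (simp_all add: K_def)
qed

lemma linear_K: "linear (K u)" "linear (\<lambda>u. K u v)"
  unfolding K_def by (rule linearI; simp add: algebra_simps)+

lemma K_skew: "K y x = - K x y"
  unfolding K_def using T_skew[of x y] T_skew[of "j x" "j y"] by simp

text \<open>In the cyclic sum of \<open>h (K x y) z\<close> the terms with \<open>j\<close> add up to \<open>- h (T x y) z\<close> by the type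
  condition.\<close>
lemma T_from_K: "2 * h (T x y) z = h (K x y) z + h (K y z) x + h (K z x) y"
proof -
  have "h (T (j x) (j y)) z - h (T x y) z = - h (T (j x) y) (j z) - h (T x (j y)) (j z)"
    using arg_cong[OF T_type[of x y], of "\<lambda>v. h v z"] by (simp add: h_j_left)
  moreover have "h (T (j x) y) (j z) = h (T (j z) (j x)) y" "h (T x (j y)) (j z) = h (T (j y) (j z)) x"
    using T_cyclic by metis+
  moreover have "h (T x y) z = h (T y z) x" "h (T x y) z = h (T z x) y" using T_cyclic by metis+
  ultimately show ?thesis unfolding K_def by simp
qed

lemma torsion_stabilizer_iff_K:
  assumes F: "unitary_algebra F" and FK: "\<And>x y. F (K x y) = K (F x) y + K x (F y)"
  shows "torsion_stabilizer F"
proof -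
  have F': "h (F v) w = - h v (F w)" for v w using F by (simp add: unitary_algebra_def)
  have k: "h (K (F x) y) z + h (K x (F y)) z + h (K x y) (F z) = 0" for x y z
    using arg_cong[OF FK[of x y], of "\<lambda>v. h v z"] F'[of "K x y" z] by simp
  have "h (F (T x y)) z = h (T (F x) y + T x (F y)) z" for x y z
  proof -
    have "2 * (h (F (T x y)) z - h (T (F x) y + T x (F y)) z)
      = - (2 * h (T x y) (F z) + 2 * h (T (F x) y) z + 2 * h (T x (F y)) z)"
      by (simp add: F')
    also have "\<dots> = 0"
      unfolding T_from_K using k[of x y z] k[of y z x] k[of z x y] by simp
    finally show ?thesis by simp
  qed
  then show ?thesis using F h_eqI unfolding torsion_stabilizer_def by blast
qed

text \<open>The element of \<open>\<uu>(h,j)\<close> with \<open>e k \<mapsto> y k j (e k)\<close> on a unitary frame.\<close>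
definition diagonal :: "(nat \<Rightarrow> 'a) \<Rightarrow> (nat \<Rightarrow> real) \<Rightarrow> 'a \<Rightarrow> 'a" where
  "diagonal e y v = (\<Sum>k<3. y k *\<^sub>R (h v (e k) *\<^sub>R j (e k) - h v (j (e k)) *\<^sub>R e k))"

lemma sum_less_3: "(\<Sum>k<3::nat. f k) = f 0 + f 1 + f 2"
  by (simp add: eval_nat_numeral)

lemma less_3_cases: "(k::nat) < 3 \<longleftrightarrow> k = 0 \<or> k = 1 \<or> k = 2"
  by auto

lemma diagonal_unitary: "unitary_algebra (diagonal e y)"
  unfolding unitary_algebra_def
proof (intro conjI allI)
  show "linear (diagonal e y)"
    by (rule linearI) (simp_all add: diagonal_def sum_less_3 algebra_simps)
  show "h (diagonal e y v) w = - h v (diagonal e y w)" for v w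
  proof -
    have "h (j (e k)) w = h w (j (e k))" "h (e k) w = h w (e k)" for k by (rule h_sym)+
    then show ?thesis by (simp add: diagonal_def sum_less_3 algebra_simps)
  qed
  show "diagonal e y (j v) = j (diagonal e y v)" for v
    by (simp add: diagonal_def sum_less_3 algebra_simps h_j_left)
qed

lemma diagonal_frame:
  assumes "unitary_frame e" "k < 3"
  shows "diagonal e y (e k) = y k *\<^sub>R j (e k)"
  using assms unfolding unitary_frame_def diagonal_def sum_less_3 less_3_cases by auto

text \<open>The failure of the operator to preserve \<open>K\<close> is itself complex bilinear and skew, so it vanishes once
  it does on pairs of frame vectors.\<close>

lemma diagonal_torsion_stabilizer:
  assumes dim: "DIM('a) = 6" and e: "unitary_frame e"
    and w: "\<And>i k. i < k \<Longrightarrow> k < 3 \<Longrightarrow> diagonal e y (K (e i) (e k)) = (y i + y k) *\<^sub>R j (K (e i) (e k))"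
  shows "torsion_stabilizer (diagonal e y)"
proof (rule torsion_stabilizer_iff_K[OF diagonal_unitary])
  let ?F = "diagonal e y"
  have F: "linear ?F" "\<And>v. ?F (j v) = j (?F v)"
    using diagonal_unitary by (auto simp: unitary_algebra_def)
  define Q where "Q u v = ?F (K u v) - K (?F u) v - K u (?F v)" for u v
  note Klin = linear_K
  have Qlin: "linear (Q u)" "linear (\<lambda>u. Q u v)" for u v
    by (rule linearI; simp add: Q_def linear_add[OF F(1)] linear_scale[OF F(1)] linear_add[OF Klin(1)]
        linear_scale[OF Klin(1)] linear_add[OF Klin(2)] linear_scale[OF Klin(2)] algebra_simps)+
  have Qj: "Q (j u) v = j (Q u v)" "Q u (j v) = j (Q u v)" for u v
    by (simp_all add: Q_def F(2) K_j)
  have Qskew: "Q v u = - Q u v" for u v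
    unfolding Q_def using K_skew[of u v] K_skew[of "?F u" v] K_skew[of u "?F v"] by (simp add: linear_neg[OF F(1)])
  have Qlt: "Q (e i) (e k) = 0" if "i < k" "k < 3" for i k
    using w[OF that] that
    by (simp add: Q_def diagonal_frame[OF e] linear_scale[OF Klin(1)] linear_scale[OF Klin(2)] K_j algebra_simps)
  have Qe: "Q (e i) (e k) = 0" if "i < 3" "k < 3" for i k
  proof (cases i k rule: linorder_cases)
    case equal
    have "Q (e i) (e i) + Q (e i) (e i) = 0" using Qskew[of "e i" "e i"] by (metis add.right_inverse)
    then show ?thesis using equal by (simp flip: scaleR_2)
  next
    case greater then show ?thesis using Qlt[of k i] Qskew[of "e k" "e i"] that by simp
  qed (use Qlt that in auto)
  have "Q (e i) v = 0" if "i < 3" for i v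
    by (subst unitary_frame_expand[OF dim e, of v])
      (simp add: linear_sum[OF Qlin(1)] linear_add[OF Qlin(1)] linear_scale[OF Qlin(1)] Qj Qe that)
  then have "Q u v = 0" for u v
    by (subst unitary_frame_expand[OF dim e, of u])
      (simp add: linear_sum[OF Qlin(2)] linear_add[OF Qlin(2)] linear_scale[OF Qlin(2)] Qj)
  then show "?F (K x y) = K (?F x) y + K x (?F y)" for x y
    unfolding Q_def by (metis (no_types, lifting) add_diff_cancel_left' diff_diff_add eq_iff_diff_eq_0)
qed

lemma proportional_weights:
  assumes e: "unitary_frame e" and F: "\<And>k. k < 3 \<Longrightarrow> F (e k) = x k *\<^sub>R j (e k)"
    and c: "\<And>v. diagonal e y v = c *\<^sub>R F v" and k: "k < 3"
  shows "y k = c * x k"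
proof -
  have "y k *\<^sub>R j (e k) = c *\<^sub>R F (e k)" using diagonal_frame[OF e k, of y] c by simp
  from arg_cong[OF this, of "\<lambda>v. h v (j (e k))"] show ?thesis
    using e k F[OF k] by (simp add: unitary_frame_def)
qed

text \<open>An operator that preserves \<open>K\<close> acts on \<open>K (e i) (e k)\<close> with weight \<open>x i + x k\<close>, and eigenvectors
  of different weights are orthogonal.\<close>
lemma stabilizer_weights:
  assumes F: "torsion_stabilizer F" and e: "unitary_frame e"
    and x: "\<And>k. k < 3 \<Longrightarrow> F (e k) = x k *\<^sub>R j (e k)"
    and ik: "i < 3" "k < 3" "n < 3" and ne: "x n \<noteq> x i + x k"
  shows "h (K (e i) (e k)) (e n) = 0" "h (K (e i) (e k)) (j (e n)) = 0"
proof -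
  have F': "linear F" "h (F v) w = - h v (F w)" "F (j v) = j (F v)" "F (T v w) = T (F v) w + T v (F w)" for v w
    using F by (auto simp: torsion_stabilizer_def unitary_algebra_def)
  have FK: "F (K u v) = K (F u) v + K u (F v)" for u v
    unfolding K_def by (simp add: linear_diff[OF F'(1)] F'(3,4))
  let ?K = "K (e i) (e k)"
  have "F ?K = (x i + x k) *\<^sub>R j ?K"
    unfolding FK x[OF ik(1)] x[OF ik(2)]
    by (simp add: linear_scale[OF linear_K(1)] linear_scale[OF linear_K(2)] K_j algebra_simps)
  then have *: "(x i + x k) * h (j ?K) v = - h ?K (F v)" for v using F'(2)[of ?K v] by simp
  have "(x i + x k - x n) * h ?K (j (e n)) = 0"
    using *[of "e n"] x[OF ik(3)] by (simp add: h_j_left algebra_simps)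
  then show "h ?K (j (e n)) = 0" using ne by simp
  have "(x i + x k - x n) * h ?K (e n) = 0"
    using *[of "j (e n)"] x[OF ik(3)] by (simp add: F'(3) algebra_simps)
  then show "h ?K (e n) = 0" using ne by simp
qed

text \<open>\<open>F\<close> spans the stabilizer algebra of \<open>T\<close>, which is thus one-dimensional.\<close>
definition stabilizer_line :: "('a \<Rightarrow> 'a) \<Rightarrow> bool" where
  "stabilizer_line F \<longleftrightarrow> torsion_stabilizer F \<and> (\<exists>v. F v \<noteq> 0) \<and>
     (\<forall>G. torsion_stabilizer G \<longrightarrow> (\<exists>c. \<forall>v. G v = c *\<^sub>R F v))"

text \<open>Suppose that all weights \<open>x k\<close> are nonzero. Then \<open>K (e i) (e k)\<close> can only have a component along
  the third vector \<open>e m\<close>, with \<open>x m = x i + x k\<close>; two such relations force a weight to vanish. Hence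
  for some labelling only \<open>K (e i) (e k)\<close> may be nonzero, and the weights \<open>1, 0, 1\<close> at \<open>i, k, m\<close>
  define another stabilizing operator.\<close>
lemma stabilizer_line_kernel:
  assumes dim: "DIM('a) = 6" and F: "stabilizer_line F"
  shows "\<exists>\<xi>. \<xi> \<noteq> 0 \<and> F \<xi> = 0"
proof (rule ccontr)
  assume "\<nexists>\<xi>. \<xi> \<noteq> 0 \<and> F \<xi> = 0"
  then have inj: "F \<xi> \<noteq> 0" if "\<xi> \<noteq> 0" for \<xi> using that by blast
  have st: "torsion_stabilizer F" and un: "unitary_algebra F"
    using F by (simp_all add: stabilizer_line_def torsion_stabilizer_def)
  have "orthonormal {}" "card {} < DIM('a)" by (simp_all add: orthonormal_def dim)
  from orthogonal_eigenvector_exists[OF un this]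
  obtain \<xi> c where "h \<xi> \<xi> = 1" "F \<xi> = c *\<^sub>R j \<xi>" by blast
  from unitary_eigenframe_exists[OF dim un this]
  obtain e x where e: "unitary_frame e" and x: "\<And>k. k < 3 \<Longrightarrow> F (e k) = x k *\<^sub>R j (e k)" by metis
  have x0: "x k \<noteq> 0" if "k < 3" for k
  proof -
    have "h (e k) (e k) = 1" using e that by (simp add: unitary_frame_def)
    then have "e k \<noteq> 0" by auto
    from inj[OF this] x[OF that] show ?thesis by (metis scaleR_zero_left)
  qed
  have van: "K (e i) (e k) = 0" if ik: "i < 3" "k < 3" "m < 3" "i \<noteq> k" "i \<noteq> m" "k \<noteq> m" and m: "x m \<noteq> x i + x k"
    for i k m
  proof (rule unitary_frame_zeroI[OF dim e])
    fix n :: nat assume n: "n < 3"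
    have "n = i \<or> n = k \<or> n = m" using n ik unfolding less_3_cases by auto
    then have "x n \<noteq> x i + x k" using x0 ik m by auto
    from stabilizer_weights[OF st e x ik(1,2) n this]
    show "h (K (e i) (e k)) (e n) = 0" "h (K (e i) (e k)) (j (e n)) = 0" by auto
  qed
  have contra: False if p: "i < 3" "k < 3" "m < 3" "i \<noteq> k" "i \<noteq> m" "k \<noteq> m"
    and z: "K (e i) (e m) = 0" "K (e k) (e m) = 0" for i k m
  proof -
    define y :: "nat \<Rightarrow> real" where "y n = (if n = k then 0 else 1)" for n
    have z': "K (e m) (e i) = 0" "K (e m) (e k) = 0"
      using z K_skew[of "e i" "e m"] K_skew[of "e k" "e m"] by simp_all
    have D: "linear (diagonal e y)" using diagonal_unitary unfolding unitary_algebra_def by blast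
    have main: "diagonal e y (K (e i) (e k)) = (y i + y k) *\<^sub>R j (K (e i) (e k))"
    proof (cases "K (e i) (e k) = 0")
      case True then show ?thesis by (simp add: linear_0[OF D])
    next
      case False
      then have xm: "x m = x i + x k" using van p by blast
      let ?K = "K (e i) (e k)"
      have "x i \<noteq> x i + x k" "x k \<noteq> x i + x k" using x0 p by simp_all
      then have hK: "h ?K (e i) = 0" "h ?K (j (e i)) = 0" "h ?K (e k) = 0" "h ?K (j (e k)) = 0"
        using stabilizer_weights[OF st e x] p by blast+
      have "?K = h ?K (e m) *\<^sub>R e m + h ?K (j (e m)) *\<^sub>R j (e m)"
        using unitary_frame_expand[OF dim e, of ?K] p hK unfolding sum_less_3 less_3_cases by auto
      then obtain a b where ab: "?K = a *\<^sub>R e m + b *\<^sub>R j (e m)" by blast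
      have "diagonal e y (j (e m)) = y m *\<^sub>R j (j (e m))"
        using diagonal_unitary[of e y] diagonal_frame[OF e p(3), of y] by (simp add: unitary_algebra_def)
      then have "diagonal e y ?K = y m *\<^sub>R j ?K"
        unfolding ab using diagonal_frame[OF e p(3), of y]
        by (simp add: linear_add[OF D] linear_scale[OF D] algebra_simps)
      then show ?thesis using p by (simp add: y_def)
    qed
    have "torsion_stabilizer (diagonal e y)"
    proof (rule diagonal_torsion_stabilizer[OF dim e])
      fix a b :: nat assume "a < b" "b < 3"
      moreover have "n = i \<or> n = k \<or> n = m" if "n < 3" for n
        using that p unfolding less_3_cases by auto
      ultimately consider "a = i" "b = k" | "a = k" "b = i" | "K (e a) (e b) = 0"
        using z z' by (metis dual_order.strict_trans less_irrefl)
      then show "diagonal e y (K (e a) (e b)) = (y a + y b) *\<^sub>R j (K (e a) (e b))"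
      proof cases
        case 2
        then show ?thesis using main K_skew[of "e i" "e k"] by (simp add: linear_neg[OF D] add.commute)
      qed (use main in \<open>simp_all add: linear_0[OF D]\<close>)
    qed
    then obtain c where c: "\<And>v. diagonal e y v = c *\<^sub>R F v"
      using F unfolding stabilizer_line_def by blast
    have "c * x k = 0" "c * x i = 1"
      using proportional_weights[where F = F, OF e x c p(2)] proportional_weights[where F = F, OF e x c p(1)] p by (simp_all add: y_def)
    then show False using x0[OF p(2)] by simp
  qed
  show False
  proof (cases "K (e 0) (e 1) = 0")
    case True
    show False
    proof (cases "K (e 0) (e 2) = 0")
      case t: True
      show False using contra[of 1 2 0] True t K_skew[of "e 0" "e 1"] K_skew[of "e 0" "e 2"] by simp
    next
      case False
      then have "x 1 = x 0 + x 2" using van[of 0 2 1] by auto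
      then have "K (e 1) (e 2) = 0" using van[of 1 2 0] x0[of 2] by auto
      then show False using contra[of 0 2 1] True K_skew[of "e 1" "e 2"] by simp
    qed
  next
    case False
    then have "x 2 = x 0 + x 1" using van[of 0 1 2] by auto
    then have "K (e 1) (e 2) = 0" "K (e 0) (e 2) = 0"
      using van[of 1 2 0] van[of 0 2 1] x0[of 1] x0[of 0] by auto
    then show False using contra[of 0 1 2] by simp
  qed
qed

end

text \<open>The trace condition is \<open>\<delta>\<Omega> = 0\<close> for the torsion of the characteristic connection; together with
  the type condition it characterises \<open>\<W>\<^sub>3\<close>.\<close>

locale primitive_torsion = hermitian_torsion h j T
  for h :: "'a::euclidean_space \<Rightarrow> 'a \<Rightarrow> real" and j T +
  fixes S :: "'a set"
  assumes S: "orthonormal S" "card S = DIM('a)"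
    and primitive: "(\<Sum>x\<in>S. h (T x (j x)) w) = 0"
begin

lemma primitive_frame:
  assumes "DIM('a) = 6" "unitary_frame e"
  shows "(\<Sum>k<3. h (T (e k) (j (e k))) w) = 0"
proof -
  have bil: "bilinear (\<lambda>x y. h (T x (j y)) w)"
    unfolding bilinear_def by (intro conjI allI linearI; simp)
  have card: "card (e ` {..<3} \<union> (\<lambda>k. j (e k)) ` {..<3}) = DIM('a)"
    using card_unitary_frame[OF assms(2)] assms(1) by simp
  from trace_frame_independent[OF S unitary_frame_orthonormal(1)[OF assms(2)] card bil]
  have sum: "(\<Sum>k<3. h (T (e k) (j (e k))) w + h (T (j (e k)) (j (j (e k)))) w) = 0"
    unfolding sum_unitary_frame[OF assms(2)] primitive by simp
  have two: "h (T (j x) (j (j x))) w = h (T x (j x)) w" for x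
    using T_skew[of x "j x"] by simp
  from sum show ?thesis unfolding two sum.distrib by simp
qed

text \<open>Write \<open>a = T(\<xi>,\<cdot>)\<close>, \<open>b = T(j\<xi>,\<cdot>)\<close>. As \<open>a\<close> is a derivation, \<open>[a,b] = T(\<zeta>,\<cdot>)\<close> with
  \<open>\<zeta> = T(\<xi>,j\<xi>)\<close>, and primitivity says that \<open>j T(\<zeta>,\<cdot>)\<close> has trace zero. The type condition is
  \<open>b j - j b = a + j a j =: N\<close>, which turns this into \<open>tr (a N) = 0\<close>, equivalently \<open>tr (N\<^sup>2) = 0\<close>.
  As \<open>N\<close> is skew, \<open>N = 0\<close>.\<close>
lemma torsion_derivation_commutes_j:
  assumes der: "\<And>u v. T \<xi> (T u v) = T (T \<xi> u) v + T u (T \<xi> v)"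
  shows "T \<xi> (j v) = j (T \<xi> v)"
proof -
  let ?a = "T \<xi>" and ?b = "T (j \<xi>)"
  let ?N = "\<lambda>v. ?a v + j (?a (j v))"
  have la: "linear ?a" "linear ?b" by (rule linear_T_right)+
  have N: "?N v = ?b (j v) - j (?b v)" for v
    using T_type[of \<xi> v] by (simp add: algebra_simps)
  have skew: "h (?a v) w = - h v (?a w)" for v w
    using T_skew_form[of \<xi> v w] h_sym[of v "?a w"] by simp
  have cyc: "(\<Sum>x\<in>S. h (F (G x)) x) = (\<Sum>x\<in>S. h (G (F x)) x)" if "linear F" "linear G" for F G
    by (rule trace_commute[OF S that])
  have lin: "linear (\<lambda>v. j (?a v))" "linear (\<lambda>v. j (?a (j v)))" "linear (\<lambda>v. ?a (?b v))"
    "linear (\<lambda>v. ?a (j v))" "linear (\<lambda>v. j (?a (?a v)))"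
    by (rule linearI; simp)+
  have zero: "(\<Sum>x\<in>S. h (T \<zeta> (j x)) x) = 0" for \<zeta>
  proof -
    have "h (T \<zeta> (j x)) x = h (T x \<zeta>) (j x)" "h (T x \<zeta>) (j x) = - h (T x (j x)) \<zeta>" for x
      using T_cyclic T_skew_form by metis+
    then show ?thesis using primitive[of \<zeta>] by (simp add: sum_negf)
  qed
  have "?a (?b v) = T (T \<xi> (j \<xi>)) v + ?b (?a v)" for v using der[of "j \<xi>" v] .
  then have "(\<Sum>x\<in>S. h (?a (?b (j x))) x) = (\<Sum>x\<in>S. h (?b (?a (j x))) x)"
    using zero[of "T \<xi> (j \<xi>)"] by (simp add: sum.distrib)
  also have "\<dots> = (\<Sum>x\<in>S. h (?a (j (?b x))) x)" by (rule cyc[OF la(2) lin(4)])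
  finally have "(\<Sum>x\<in>S. h (?a (?N x)) x) = 0"
    unfolding N by (simp add: sum_subtractf)
  then have 1: "(\<Sum>x\<in>S. h (?a (?a x)) x) + (\<Sum>x\<in>S. h (?a (j (?a (j x)))) x) = 0"
    by (simp add: sum.distrib)
  have 2: "(\<Sum>x\<in>S. h (j (?a (j (?a x)))) x) = (\<Sum>x\<in>S. h (?a (j (?a (j x)))) x)"
    using cyc[OF j_linear, of "\<lambda>v. ?a (j (?a v))"] by (simp add: linear_compose[unfolded o_def, OF lin(1) la(1)])
  have 3: "(\<Sum>x\<in>S. h (j (?a (?a (j x)))) x) = - (\<Sum>x\<in>S. h (?a (?a x)) x)"
    using cyc[OF lin(5) j_linear] by (simp add: sum_negf)
  have "(\<Sum>x\<in>S. h (?N (?N x)) x) = (\<Sum>x\<in>S. h (?a (?a x)) x) + (\<Sum>x\<in>S. h (?a (j (?a (j x)))) x)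
     + (\<Sum>x\<in>S. h (j (?a (j (?a x)))) x) - (\<Sum>x\<in>S. h (j (?a (?a (j x)))) x)"
    by (simp add: sum.distrib sum_negf sum_subtractf algebra_simps)
  then have "(\<Sum>x\<in>S. h (?N (?N x)) x) = 0" using 1 2 3 by simp
  moreover have Nskew: "h (?N v) w = - h v (?N w)" for v w
    by (simp add: skew h_j_left)
  moreover have "(\<Sum>x\<in>S. h (?N x) (?N x)) = - (\<Sum>x\<in>S. h (?N (?N x)) x)"
    unfolding sum_negf[symmetric]
  proof (rule sum.cong[OF refl])
    show "h (?N x) (?N x) = - h (?N (?N x)) x" for x using Nskew[of "?N x" x] by linarith
  qed
  ultimately have "(\<Sum>x\<in>S. h (?N x) (?N x)) = 0" by (metis minus_zero)
  then have "\<forall>x\<in>S. h (?N x) (?N x) = 0"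
    using sum_nonneg_eq_0_iff[of S "\<lambda>x. h (?N x) (?N x)", OF _ h_ge_0] S(1)
    unfolding orthonormal_def by metis
  then have "\<forall>x\<in>S. ?N x = 0" by (simp only: h_eq_0_iff)
  moreover have "linear ?N" by (rule linearI; simp add: algebra_simps)
  moreover have "?N v = ?N (\<Sum>x\<in>S. h v x *\<^sub>R x)" by (simp only: orthonormal_expand[OF S, symmetric])
  ultimately have "?N v = 0"
    by (simp only: linear_sum[OF \<open>linear ?N\<close>] linear_scale[OF \<open>linear ?N\<close>]) simp
  then have "j (?N v) = 0" by simp
  then show ?thesis by (simp add: algebra_simps)
qed

text \<open>The operators \<open>R u v\<close> stand for the curvature. See Steps 2 and 3 of the introduction.\<close>
theorem stabilizer_line_not_holonomy:
  assumes dim: "DIM('a) = 6" and F: "stabilizer_line F"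
    and R: "\<And>u v. torsion_stabilizer (R u v)"
    and bianchi: "\<And>u v w. R u v w + R v w u + R w u v = T (T u v) w + T (T v w) u + T (T w u) v"
  shows False
proof -
  have st: "torsion_stabilizer F" and un: "unitary_algebra F"
    using F by (simp_all add: stabilizer_line_def torsion_stabilizer_def)
  have F': "linear F" "h (F v) w = - h v (F w)" "F (j v) = j (F v)" for v w
    using un by (auto simp: unitary_algebra_def)
  have line: "\<exists>c. \<forall>v. G v = c *\<^sub>R F v" if "torsion_stabilizer G" for G
    using F that unfolding stabilizer_line_def by blast
  have Tst: "torsion_stabilizer (T \<xi>)" if \<xi>: "F \<xi> = 0" for \<xi>
  proof -
    have "h (R u v w) \<xi> = 0" for u v w
      using line[OF R[of u v]] F'(2)[of w \<xi>] \<xi> by auto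
    then have B: "h (T (T u v) w) \<xi> + h (T (T v w) u) \<xi> + h (T (T w u) v) \<xi> = 0" for u v w
      using arg_cong[OF bianchi[of u v w], of "\<lambda>z. h z \<xi>"] by simp
    have der: "T \<xi> (T u v) = T (T \<xi> u) v + T u (T \<xi> v)" for u v
    proof (rule h_eqI)
      fix w
      have "h (T \<xi> (T u v)) w = h (T (T u v) w) \<xi>" by (rule T_cyclic)
      moreover have "h (T (T \<xi> u) v) w = - h (T (T v w) u) \<xi>"
        by (metis T_cyclic T_skew h_simps(5) h_sym T_skew_form minus_minus)
      moreover have "h (T u (T \<xi> v)) w = - h (T (T w u) v) \<xi>"
        by (metis T_cyclic T_skew h_simps(5) h_sym T_skew_form minus_minus)
      ultimately show "h (T \<xi> (T u v)) w = h (T (T \<xi> u) v + T u (T \<xi> v)) w"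
        using B[of u v w] by simp
    qed
    have "h (T \<xi> v) w = - h v (T \<xi> w)" for v w
      using T_skew_form[of \<xi> v w] h_sym[of v "T \<xi> w"] by simp
    then show ?thesis
      using der torsion_derivation_commutes_j[OF der] linear_T_right[of \<xi>]
      unfolding torsion_stabilizer_def unitary_algebra_def by blast
  qed
  obtain \<xi>0 where \<xi>0: "\<xi>0 \<noteq> 0" "F \<xi>0 = 0" using stabilizer_line_kernel[OF dim F] by blast
  have j\<xi>0: "F (j \<xi>0) = 0" using F'(3) \<xi>0(2) by simp
  obtain a where a: "\<And>v. T \<xi>0 v = a *\<^sub>R F v" using line[OF Tst[OF \<xi>0(2)]] by blast
  obtain b where b: "\<And>v. T (j \<xi>0) v = b *\<^sub>R F v" using line[OF Tst[OF j\<xi>0]] by blast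
  have "\<exists>\<xi>. \<xi> \<noteq> 0 \<and> F \<xi> = 0 \<and> (\<forall>v. T \<xi> v = 0)"
  proof (cases "a = 0")
    case True
    then show ?thesis using a \<xi>0 by auto
  next
    case False
    \<comment> \<open>\<open>\<xi>0\<close> and \<open>j \<xi>0\<close> have torsion operators \<open>a F\<close> and \<open>b F\<close>, which this combination cancels.\<close>
    let ?\<xi> = "b *\<^sub>R \<xi>0 - a *\<^sub>R j \<xi>0"
    have "h ?\<xi> (j \<xi>0) \<noteq> 0" using False h_pos[OF \<xi>0(1)] by simp
    then have "?\<xi> \<noteq> 0" by (metis h_simps(9))
    moreover have "F ?\<xi> = 0" by (simp add: linear_diff[OF F'(1)] linear_scale[OF F'(1)] \<xi>0(2) j\<xi>0)
    moreover have "T ?\<xi> v = 0" for v by (simp add: a b)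
    ultimately show ?thesis by blast
  qed
  then obtain \<xi>1 where \<xi>1: "\<xi>1 \<noteq> 0" "F \<xi>1 = 0" "\<And>v. T \<xi>1 v = 0" by blast
  let ?\<xi> = "(1 / sqrt (h \<xi>1 \<xi>1)) *\<^sub>R \<xi>1"
  have "h ?\<xi> ?\<xi> = 1" using h_pos[OF \<xi>1(1)] by simp
  moreover have "F ?\<xi> = 0 *\<^sub>R j ?\<xi>" using \<xi>1(2) by (simp add: linear_scale[OF F'(1)])
  ultimately obtain e x where e: "unitary_frame e" and x: "\<And>k. k < 3 \<Longrightarrow> F (e k) = x k *\<^sub>R j (e k)"
    and e2: "e 2 = ?\<xi>" "x 2 = 0"
    using unitary_eigenframe_exists[OF dim un] by metis
  have T2: "T (e 2) v = 0" for v unfolding e2(1) using \<xi>1(3) by simp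
  have "F (j (e 2)) = 0" using x[of 2] e2(2) F'(3) by simp
  from line[OF Tst[OF this]] obtain \<mu> where \<mu>: "\<And>v. T (j (e 2)) v = \<mu> *\<^sub>R F v" by blast
  have x': "F (e 0) = x 0 *\<^sub>R j (e 0)" "F (e 1) = x 1 *\<^sub>R j (e 1)" using x by simp_all
  have eh: "h (e 0) (e 1) = 0" "h (e 1) (e 0) = 0" "h (e 0) (j (e 1)) = 0" "h (e 1) (j (e 0)) = 0"
    using e by (simp_all add: unitary_frame_def)
  have prim: "h (T (e 0) (j (e 0))) w + h (T (e 1) (j (e 1))) w = 0" for w
    using primitive_frame[OF dim e, of w] T2 by (simp add: sum_less_3)
  have p01: "h (T (e 0) (j (e 0))) (e 1) = 0" "h (T (e 0) (j (e 0))) (j (e 1)) = 0"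
    "h (T (e 1) (j (e 1))) (e 0) = 0" "h (T (e 1) (j (e 1))) (j (e 0)) = 0"
    using prim[of "e 1"] prim[of "j (e 1)"] prim[of "e 0"] prim[of "j (e 0)"] by simp_all
  have Tz: "h (T u v) (e 2) = 0" "h (T u v) (j (e 2)) = \<mu> * h (F u) v" for u v
    using T_cyclic[of "e 2" u v] T_cyclic[of "j (e 2)" u v] T2 \<mu> by simp_all
  \<comment> \<open>Primitivity contracted with the four vectors of the complement kills \<open>T\<close> there.\<close>
  have K01: "K (e 0) (e 1) = 0"
  proof (rule unitary_frame_zeroI[OF dim e])
    fix k :: nat assume "k < 3"
    then consider "k = 0" | "k = 1" | "k = 2" by linarith
    note k = this
    have cyc: "h (T (j (e 0)) (j (e 1))) (e 0) = 0" "h (T (j (e 0)) (j (e 1))) (e 1) = 0"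
       "h (T (e 0) (e 1)) (j (e 0)) = 0" "h (T (e 0) (e 1)) (j (e 1)) = 0"
      using p01 T_cyclic T_skew_form by (metis neg_equal_0_iff_equal)+
    show "h (K (e 0) (e 1)) (e k) = 0"
      by (rule k) (simp_all add: K_def cyc Tz del: One_nat_def)
    show "h (K (e 0) (e 1)) (j (e k)) = 0"
      by (rule k) (simp_all add: K_def cyc Tz x' eh F'(3) h_j_left del: One_nat_def)
  qed
  have Kk2: "K (e k) (e 2) = (- (\<mu> * x k)) *\<^sub>R e k" if "k < 3" for k
  proof -
    have "K (e k) (e 2) = - T (e 2) (e k) + T (j (e 2)) (j (e k))"
      unfolding K_def using T_skew[of "e 2" "e k"] T_skew[of "j (e 2)" "j (e k)"] by simp
    then show ?thesis using T2 \<mu> x[OF that] by (simp add: F'(3))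
  qed
  have tor: "torsion_stabilizer (diagonal e y)" if y: "y 2 = 0" for y
  proof (rule diagonal_torsion_stabilizer[OF dim e])
    fix i k :: nat assume ik: "i < k" "k < 3"
    have D: "linear (diagonal e y)" using diagonal_unitary unfolding unitary_algebra_def by blast
    consider "i = 0" "k = 1" | "k = 2" using ik by linarith
    then show "diagonal e y (K (e i) (e k)) = (y i + y k) *\<^sub>R j (K (e i) (e k))"
    proof cases
      case 1
      then show ?thesis using K01 by (simp add: linear_0[OF D])
    next
      case 2
      have i: "i < 3" using ik by simp
      show ?thesis unfolding 2 Kk2[OF i] using y diagonal_frame[OF e i, of y]
        by (simp add: linear_scale[OF D] linear_neg[OF D])
    qed
  qed
  have w: "\<exists>c. \<forall>k<3. y k = c * x k" if "y 2 = 0" for y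
    using line[OF tor[of y, OF that]] proportional_weights[where F = F and y = y, OF e x] by metis
  \<comment> \<open>The weights \<open>(1,0,0)\<close> and \<open>(0,1,0)\<close> cannot both be multiples of the weights of \<open>F\<close>.\<close>
  obtain c where c: "\<forall>k<3. (if k = 0 then 1 else 0) = c * x k"
    using w[of "\<lambda>k. if k = 0 then 1 else 0"] by auto
  obtain d where d: "\<forall>k<3. (if k = 1 then 1 else 0) = d * x k"
    using w[of "\<lambda>k. if k = 1 then 1 else 0"] by auto
  show False using c[rule_format, of 0] c[rule_format, of 1] d[rule_format, of 1] by auto
qed

end

section \<open>The Lie algebra of the isotropy group\<close>

lemma linear_matrix_mult_left: "linear (\<lambda>X :: real^'n^'n::finite. B ** X)"
  by (rule linearI) (simp_all add: matrix_add_ldistrib matrix_scalar_ac scalar_matrix_assoc)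

lemma mat_exp_powers:
  fixes B :: "real^'n^'n::finite"
  shows "((**) (s *\<^sub>R B) ^^ k) (mat 1) = s ^ k *\<^sub>R ((**) B ^^ k) (mat 1)"
  by (induction k) (simp_all add: matrix_scalar_ac scalar_matrix_assoc[symmetric] mult.commute)

lemma mat_exp_summable:
  fixes B :: "real^'n^'n::finite"
  shows "summable (\<lambda>k. (s ^ k / fact k) *\<^sub>R ((**) B ^^ k) (mat 1))"
proof -
  obtain M where M: "M > 0" "\<And>X :: real^'n^'n. norm (B ** X) \<le> M * norm X"
    using linear_bounded_pos[OF linear_matrix_mult_left[of B]] by blast
  have P: "norm (((**) B ^^ k) (mat 1 :: real^'n^'n)) \<le> M ^ k * norm (mat 1 :: real^'n^'n)" for k
  proof (induction k)
    case (Suc k)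
    have "norm (((**) B ^^ Suc k) (mat 1 :: real^'n^'n)) \<le> M * norm (((**) B ^^ k) (mat 1 :: real^'n^'n))"
      using M(2) by simp
    also have "\<dots> \<le> M * (M ^ k * norm (mat 1 :: real^'n^'n))"
      using Suc.IH M(1) by (intro mult_left_mono) auto
    finally show ?case by simp
  qed simp
  have "norm ((s ^ k / fact k) *\<^sub>R ((**) B ^^ k) (mat 1 :: real^'n^'n))
     \<le> (\<bar>s\<bar> * M) ^ k /\<^sub>R fact k * norm (mat 1 :: real^'n^'n)" for k
    using mult_left_mono[OF P[of k], of "\<bar>s\<bar> ^ k / fact k"]
    by (simp add: power_abs power_mult_distrib field_simps)
  moreover have "summable (\<lambda>k. (\<bar>s\<bar> * M) ^ k /\<^sub>R fact k * norm (mat 1 :: real^'n^'n))"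
    by (intro summable_mult2 summable_exp_generic)
  ultimately show ?thesis by (metis (no_types, lifting) summable_comparison_test)
qed

text \<open>Applying a functional reduces the exponential to a scalar power series, which may be differentiated
  termwise.\<close>
lemma mat_exp_functional:
  fixes B :: "real^'n^'n::finite"
  assumes "bounded_linear (L :: real^'n^'n \<Rightarrow> real)"
  shows "L (mat_exp (s *\<^sub>R B)) = (\<Sum>k. (L (((**) B ^^ k) (mat 1)) / fact k) * s ^ k)"
    "summable (\<lambda>k. (L (((**) B ^^ k) (mat 1)) / fact k) * s ^ k)"
proof -
  have *: "L ((s ^ k / fact k) *\<^sub>R X) = (L X / fact k) * s ^ k" for k X
    using assms by (simp add: bounded_linear.linear linear_scale)
  have "mat_exp (s *\<^sub>R B) = (\<Sum>k. (s ^ k / fact k) *\<^sub>R ((**) B ^^ k) (mat 1))"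
    unfolding mat_exp_def mat_exp_powers by simp
  then show "L (mat_exp (s *\<^sub>R B)) = (\<Sum>k. (L (((**) B ^^ k) (mat 1)) / fact k) * s ^ k)"
    using bounded_linear.suminf[OF assms mat_exp_summable[of s B]] by (simp only: *)
  show "summable (\<lambda>k. (L (((**) B ^^ k) (mat 1)) / fact k) * s ^ k)"
    using bounded_linear.summable[OF assms mat_exp_summable[of s B]] by (simp only: *)
qed

lemma mat_exp_derivative:
  fixes B :: "real^'n^'n::finite"
  shows "((\<lambda>s. mat_exp (s *\<^sub>R B)) has_vector_derivative B ** mat_exp (s *\<^sub>R B)) (at s)"
proof -
  have "((\<lambda>s. L (mat_exp (s *\<^sub>R B))) has_real_derivative L (B ** mat_exp (s *\<^sub>R B))) (at s)"
    if L: "bounded_linear (L :: real^'n^'n \<Rightarrow> real)" for L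
  proof -
    define c where "c k = L (((**) B ^^ k) (mat 1)) / fact k" for k
    have L': "bounded_linear (\<lambda>X. L (B ** X))"
      using bounded_linear_compose[OF L] linear_matrix_mult_left linear_conv_bounded_linear by blast
    have "diffs c k = L (B ** ((**) B ^^ k) (mat 1)) / fact k" for k
      by (simp add: diffs_def c_def divide_simps del: of_nat_Suc)
    then have "L (B ** mat_exp (s *\<^sub>R B)) = (\<Sum>k. diffs c k * s ^ k)"
      using mat_exp_functional(1)[OF L'] by simp
    moreover have "((\<lambda>s. \<Sum>k. c k * s ^ k) has_real_derivative (\<Sum>k. diffs c k * s ^ k)) (at s)"
      by (rule termdiffs_strong_converges_everywhere)
        (use mat_exp_functional(2)[OF L] in \<open>simp add: c_def\<close>)
    ultimately show ?thesis by (simp add: mat_exp_functional(1)[OF L] c_def)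
  qed
  from this[OF bounded_linear_inner_left] show ?thesis
    unfolding has_vector_derivative_def
    by (subst has_derivative_componentwise_within)
      (simp add: has_field_derivative_def mult_commute_abs)
qed

lemma mat_exp_0:
  fixes B :: "real^'n^'n::finite"
  shows "mat_exp (0 *\<^sub>R B) = mat 1"
proof -
  have "(1 / fact k) *\<^sub>R ((**) (0 *\<^sub>R B) ^^ k) (mat 1 :: real^'n^'n) = (if k = 0 then mat 1 else 0)" for k
    unfolding mat_exp_powers by (simp add: power_0_left)
  then have "mat_exp (0 *\<^sub>R B) = (\<Sum>k. if k = 0 then mat 1 else (0 :: real^'n^'n))"
    unfolding mat_exp_def by presburger
  then show ?thesis using suminf_finite[of "{0 :: nat}" "\<lambda>k. if k = 0 then mat 1 else (0 :: real^'n^'n)"] by simp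
qed

lemma bounded_bilinear_matrix_vector: "bounded_bilinear (\<lambda>(X :: real^'n^'m::finite) v. X *v v)"
proof -
  have "bilinear (\<lambda>(X :: real^'n^'m) v. X *v v)"
    unfolding bilinear_def
    by (auto intro!: linearI simp: matrix_vector_mult_add_rdistrib matrix_vector_right_distrib
        scaleR_matrix_vector_assoc[symmetric] matrix_vector_mult_scaleR)
  then show ?thesis by (simp add: bilinear_conv_bounded_bilinear)
qed

lemma mat_exp_vector_derivative:
  fixes B :: "real^'n^'n::finite"
  shows "((\<lambda>s. mat_exp (s *\<^sub>R B) *v v) has_vector_derivative B *v (mat_exp (s *\<^sub>R B) *v v)) (at s)"
  using bounded_bilinear.has_vector_derivative[OF bounded_bilinear_matrix_vector mat_exp_derivative
      has_vector_derivative_const[of v], of B s]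
  by (simp add: matrix_vector_mul_assoc)

lemma vector_derivative_zero_constant:
  fixes f :: "real \<Rightarrow> real"
  assumes "\<And>s. (f has_vector_derivative 0) (at s)"
  shows "f s = f 0"
  using assms DERIV_isconst_all[of f s 0]
  by (simp add: has_real_derivative_iff_has_vector_derivative)

context hermitian_torsion begin

lemma has_vector_derivative_h:
  assumes "(a has_vector_derivative a') (at s)" "(b has_vector_derivative b') (at s)"
  shows "((\<lambda>s. h (a s) (b s)) has_vector_derivative h (a s) b' + h a' (b s)) (at s)"
  using bounded_bilinear.has_vector_derivative[OF _ assms] h_bilinear
  by (simp add: bilinear_conv_bounded_bilinear)

lemma has_vector_derivative_T:
  assumes "(a has_vector_derivative a') (at s)" "(b has_vector_derivative b') (at s)"
  shows "((\<lambda>s. T (a s) (b s)) has_vector_derivative T (a s) b' + T a' (b s)) (at s)"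
  using bounded_bilinear.has_vector_derivative[OF _ assms] T_bilinear
  by (simp add: bilinear_conv_bounded_bilinear)

lemma has_vector_derivative_j:
  assumes "(a has_vector_derivative a') (at s)"
  shows "((\<lambda>s. j (a s)) has_vector_derivative j a') (at s)"
  using bounded_linear.has_vector_derivative[OF _ assms] j_linear
  by (simp add: linear_conv_bounded_linear)

end

text \<open>Both inclusions come from differentiating along the one-parameter groups: the invariants are
  constant in the parameter iff their derivatives vanish.\<close>

lemma isotropy_lie_algebra:
  fixes T :: "real^'n::finite \<Rightarrow> real^'n \<Rightarrow> real^'n"
  assumes "hermitian_torsion h j T"
  shows "lie_algebra (connected_component_set
      (isotropy_group (\<lambda>u v w. h (T u v) w) (unitary_group h j)) (mat 1))
    = {B. hermitian_torsion.torsion_stabilizer h j T ((*v) B)}" (is "lie_algebra (connected_component_set ?G _) = ?S")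
proof (intro set_eqI iffI)
  interpret hermitian_torsion h j T by fact
  fix B :: "real^'n^'n"
  let ?E = "\<lambda>s. mat_exp (s *\<^sub>R B)"
  have d: "((\<lambda>s. ?E s *v v) has_vector_derivative B *v (?E s *v v)) (at s)" for s v
    by (rule mat_exp_vector_derivative)
  have E0: "?E 0 *v v = v" for v unfolding mat_exp_0 by simp
  note dh = has_vector_derivative_h[OF d d] and dj = has_vector_derivative_j[OF d]
    and dT = has_vector_derivative_h[OF has_vector_derivative_T[OF d d] d]
  have uniq: "f' = 0" if "(f has_vector_derivative f') (at 0)" "\<And>s. f s = f 0"
    for f :: "real \<Rightarrow> 'b::real_normed_vector" and f'
  proof -
    have "f = (\<lambda>s. f 0)" using that(2) by blast
    then have "(f has_vector_derivative 0) (at 0)" using has_vector_derivative_const by metis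
    then show ?thesis using that(1) vector_derivative_unique_at by blast
  qed
  {
    assume "B \<in> lie_algebra (connected_component_set ?G (mat 1))"
    then have "?E s \<in> ?G" for s
      using connected_component_subset unfolding lie_algebra_def by blast
    then have inv: "h (?E s *v v) (?E s *v w) = h v w" "j (?E s *v v) = ?E s *v j v"
      "h (T (?E s *v u) (?E s *v v)) (?E s *v w) = h (T u v) w" for s u v w
      unfolding isotropy_group_def unitary_group_def by auto
    have skew: "h (B *v v) w = - h v (B *v w)" for v w
    proof -
      have "h v (B *v w) + h (B *v v) w = 0"
        using uniq[OF dh[of v w 0]] inv(1) by (simp only: E0)
      then show ?thesis by simp
    qed
    have comm: "B *v j v = j (B *v v)" for v
    proof -
      have "((\<lambda>s. j (?E s *v v) - ?E s *v j v) has_vector_derivative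
          j (B *v (?E 0 *v v)) - B *v (?E 0 *v j v)) (at 0)"
        by (intro has_vector_derivative_diff dj d)
      then have "j (B *v (?E 0 *v v)) - B *v (?E 0 *v j v) = 0"
        by (rule uniq) (simp only: inv(2) diff_self)
      then show ?thesis unfolding E0 by simp
    qed
    have "h (B *v T u v) w = h (T (B *v u) v + T u (B *v v)) w" for u v w
    proof -
      have "h (T u v) (B *v w) + h (T u (B *v v) + T (B *v u) v) w = 0"
        using uniq[OF dT[of u v w 0]] inv(3) by (simp only: E0)
      then show ?thesis using skew[of "T u v" w] by simp
    qed
    then have "B *v T u v = T (B *v u) v + T u (B *v v)" for u v by (rule h_eqI)
    then show "B \<in> ?S"
      using skew comm unfolding torsion_stabilizer_def unitary_algebra_def by auto
  next
    assume "B \<in> ?S"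
    then have skew: "h (B *v v) w = - h v (B *v w)" and comm: "B *v j v = j (B *v v)"
      and der: "B *v T u v = T (B *v u) v + T u (B *v v)" for u v w
      unfolding torsion_stabilizer_def unitary_algebra_def by auto
    have hE: "h (?E s *v v) (?E s *v w) = h v w" for s v w
    proof -
      have "((\<lambda>s. h (?E s *v v) (?E s *v w)) has_vector_derivative 0) (at s)" for s
        using dh[of v w s] by (simp add: skew)
      from vector_derivative_zero_constant[OF this, of s] show ?thesis by (simp only: E0)
    qed
    \<comment> \<open>The commutator with \<open>j\<close> solves the same linear equation, along which \<open>h\<close> is conserved, and it starts at \<open>0\<close>.\<close>
    have "h (j (?E s *v v) - ?E s *v j v) (j (?E s *v v) - ?E s *v j v) = 0" for s v
    proof -
      let ?y = "\<lambda>s. j (?E s *v v) - ?E s *v j v"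
      have "(?y has_vector_derivative B *v ?y s) (at s)" for s
        using has_vector_derivative_diff[OF dj[of v] d[of "j v"]]
        by (simp add: comm matrix_vector_mult_diff_distrib)
      from has_vector_derivative_h[OF this this]
      have "((\<lambda>s. h (?y s) (?y s)) has_vector_derivative 0) (at s)" for s
        by (metis (no_types, lifting) skew add.right_inverse)
      from vector_derivative_zero_constant[OF this, of s] show ?thesis by (simp only: E0) simp
    qed
    then have jE: "j (?E s *v v) = ?E s *v j v" for s v
      by (simp only: h_eq_0_iff) simp
    have TE: "h (T (?E s *v u) (?E s *v v)) (?E s *v w) = h (T u v) w" for s u v w
    proof -
      have "((\<lambda>s. h (T (?E s *v u) (?E s *v v)) (?E s *v w)) has_vector_derivative 0) (at s)" for s
      proof -
        have "h (T (?E s *v u) (?E s *v v)) (B *v (?E s *v w)) = - h (B *v T (?E s *v u) (?E s *v v)) (?E s *v w)"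
          using skew by simp
        then show ?thesis using dT[of u v w s] unfolding der by (simp add: add.commute)
      qed
      from vector_derivative_zero_constant[OF this, of s] show ?thesis by (simp only: E0)
    qed
    have inv: "invertible (?E s)" for s
    proof -
      have "v = w" if "?E s *v v = ?E s *v w" for v w
      proof -
        have "h (v - w) (v - w) = h (?E s *v (v - w)) (?E s *v (v - w))" by (simp only: hE)
        also have "\<dots> = 0" using that by (simp add: matrix_vector_mult_diff_distrib)
        finally show ?thesis by (simp only: h_eq_0_iff) simp
      qed
      then show ?thesis
        unfolding invertible_left_inverse matrix_left_invertible_injective by (auto simp: inj_def)
    qed
    have EG: "?E s \<in> ?G" for s
      unfolding isotropy_group_def unitary_group_def using hE jE TE inv by auto
    have "connected_component ?G (mat 1) (?E s)" for s
    proof -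
      have "continuous (at s) ?E" for s
        using mat_exp_derivative[of B s] has_vector_derivative_continuous by blast
      then have "connected (range ?E)"
        by (intro connected_continuous_image) (auto simp: continuous_on_eq_continuous_at)
      moreover have "mat 1 \<in> range ?E" using mat_exp_0[of B] by (metis rangeI)
      ultimately show ?thesis
        unfolding connected_component_def using EG by (intro exI[of _ "range ?E"]) auto
    qed
    then show "B \<in> lie_algebra (connected_component_set ?G (mat 1))"
      unfolding lie_algebra_def by blast
  }
qed

section \<open>Connections in coordinates: Ricci identity and first Bianchi identity\<close>

text \<open>The product rule for inserting a vector function into a slot of a tensor field; iterated, it
  differentiates tensors on variable arguments.\<close>
lemma evaluation_derivative:
  fixes \<Phi> :: "'a::euclidean_space \<Rightarrow> real^'n::finite \<Rightarrow> 'b::real_normed_vector"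
  assumes S: "open S" and lin: "\<And>y. y \<in> S \<Longrightarrow> linear (\<Phi> y)"
    and \<Phi>: "\<And>u. Cinf_on S (\<lambda>y. \<Phi> y u)" and a: "Cinf_on S a"
  shows "Cinf_on S (\<lambda>y. \<Phi> y (a y))"
    and "x \<in> S \<Longrightarrow> frechet_derivative (\<lambda>y. \<Phi> y (a y)) (at x) z
      = frechet_derivative (\<lambda>y. \<Phi> y (a x)) (at x) z + \<Phi> x (frechet_derivative a (at x) z)"
proof -
  have exp: "\<Phi> y u = (\<Sum>i\<in>UNIV. (u $ i) *\<^sub>R \<Phi> y (axis i 1))" if "y \<in> S" for y u
    by (rule linear_eq_sum_axis[OF lin[OF that]])
  have C: "Cinf_on S (\<lambda>y. \<Sum>i\<in>UNIV. (a y $ i) *\<^sub>R \<Phi> y (axis i 1))"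
    by (intro Cinf_on_sum[OF S] Cinf_on_scaleR[OF S] Cinf_on_bounded_linear[OF S bounded_linear_vec_nth a] \<Phi>)
  show "Cinf_on S (\<lambda>y. \<Phi> y (a y))"
    by (rule Cinf_on_cong[OF S _ C]) (rule exp[symmetric])
  assume x: "x \<in> S"
  have da: "((\<lambda>y. a y $ i) has_derivative (\<lambda>z. frechet_derivative a (at x) z $ i)) (at x)" for i
    by (rule bounded_linear.has_derivative[OF bounded_linear_vec_nth Cinf_on_has_derivative[OF a x]])
  have d\<Phi>: "((\<lambda>y. \<Phi> y u) has_derivative frechet_derivative (\<lambda>y. \<Phi> y u) (at x)) (at x)" for u
    by (rule Cinf_on_has_derivative[OF \<Phi> x])
  have 0: "frechet_derivative (\<lambda>y. \<Phi> y (a y)) (at x)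
      = frechet_derivative (\<lambda>y. \<Sum>i\<in>UNIV. (a y $ i) *\<^sub>R \<Phi> y (axis i 1)) (at x)"
    by (rule frechet_derivative_cong_open[OF S x]) (rule exp)
  have 1: "frechet_derivative (\<lambda>y. \<Phi> y (a y)) (at x) =
      (\<lambda>z. \<Sum>i\<in>UNIV. (a x $ i) *\<^sub>R frechet_derivative (\<lambda>y. \<Phi> y (axis i 1)) (at x) z
         + (frechet_derivative a (at x) z $ i) *\<^sub>R \<Phi> x (axis i 1))"
    unfolding 0
    by (intro frechet_derivative_eqI has_derivative_sum has_derivative_scaleR da d\<Phi>)
  have 3: "frechet_derivative (\<lambda>y. \<Phi> y (a x)) (at x)
      = frechet_derivative (\<lambda>y. \<Sum>i\<in>UNIV. (a x $ i) *\<^sub>R \<Phi> y (axis i 1)) (at x)"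
    by (rule frechet_derivative_cong_open[OF S x]) (rule exp)
  have 2: "frechet_derivative (\<lambda>y. \<Phi> y (a x)) (at x) =
      (\<lambda>z. \<Sum>i\<in>UNIV. (a x $ i) *\<^sub>R frechet_derivative (\<lambda>y. \<Phi> y (axis i 1)) (at x) z)"
    unfolding 3
    by (intro frechet_derivative_eqI has_derivative_sum has_derivative_scaleR_right d\<Phi>)
  show "frechet_derivative (\<lambda>y. \<Phi> y (a y)) (at x) z
      = frechet_derivative (\<lambda>y. \<Phi> y (a x)) (at x) z + \<Phi> x (frechet_derivative a (at x) z)"
    unfolding 1 2 exp[OF x, of "frechet_derivative a (at x) z"] by (simp add: sum.distrib)
qed

text \<open>A linear connection on an open set of coordinates, given by its Christoffel symbols:
  \<open>\<Gamma> x u v\<close> is the covariant derivative along \<open>u\<close> of the constant field \<open>v\<close>.\<close>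
locale coordinate_connection =
  fixes S :: "(real^'n::finite) set" and \<Gamma> :: "real^'n \<Rightarrow> real^'n \<Rightarrow> real^'n \<Rightarrow> real^'n"
  assumes S: "open S"
    and \<Gamma>_bilinear: "x \<in> S \<Longrightarrow> bilinear (\<Gamma> x)"
    and \<Gamma>_smooth: "Cinf_on S (\<lambda>x. \<Gamma> x u v)"
begin

definition curv :: "real^'n \<Rightarrow> real^'n \<Rightarrow> real^'n \<Rightarrow> real^'n \<Rightarrow> real^'n" where
  "curv x a b w = frechet_derivative (\<lambda>y. \<Gamma> y b w) (at x) a - frechet_derivative (\<lambda>y. \<Gamma> y a w) (at x) b
     + \<Gamma> x a (\<Gamma> x b w) - \<Gamma> x b (\<Gamma> x a w)"

definition tor :: "real^'n \<Rightarrow> real^'n \<Rightarrow> real^'n \<Rightarrow> real^'n" where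
  "tor x u v = \<Gamma> x u v - \<Gamma> x v u"

lemma tor_bilinear: "x \<in> S \<Longrightarrow> bilinear (tor x)"
  using \<Gamma>_bilinear[of x] unfolding tor_def bilinear_def
  by (auto intro!: linear_compose_sub)

lemma tor_smooth: "Cinf_on S (\<lambda>x. tor x u v)"
proof -
  have "Cinf_on S (\<lambda>x. \<Gamma> x u v + (-1) *\<^sub>R \<Gamma> x v u)"
    by (intro Cinf_on_add[OF S] \<Gamma>_smooth Cinf_on_bounded_linear[OF S bounded_linear_scaleR_right])
  then show ?thesis by (simp add: tor_def)
qed

lemma linear_curv: "x \<in> S \<Longrightarrow> linear (curv x a b)"
proof -
  assume x: "x \<in> S"
  have l: "linear (\<Gamma> y u)" if "y \<in> S" for y u using \<Gamma>_bilinear[OF that] by (simp add: bilinear_def)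
  have add: "frechet_derivative (\<lambda>y. \<Gamma> y a (v + w)) (at x) b
     = frechet_derivative (\<lambda>y. \<Gamma> y a v) (at x) b + frechet_derivative (\<lambda>y. \<Gamma> y a w) (at x) b" for a b v w
  proof -
    have d: "((\<lambda>y. \<Gamma> y a v + \<Gamma> y a w) has_derivative (\<lambda>b. frechet_derivative (\<lambda>y. \<Gamma> y a v) (at x) b
        + frechet_derivative (\<lambda>y. \<Gamma> y a w) (at x) b)) (at x)"
      by (intro has_derivative_add Cinf_on_has_derivative[OF \<Gamma>_smooth x])
    have "frechet_derivative (\<lambda>y. \<Gamma> y a (v + w)) (at x) = frechet_derivative (\<lambda>y. \<Gamma> y a v + \<Gamma> y a w) (at x)"
      by (rule frechet_derivative_cong_open[OF S x]) (rule linear_add[OF l])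
    then show ?thesis using frechet_derivative_eqI[OF d] by simp
  qed
  have scale: "frechet_derivative (\<lambda>y. \<Gamma> y a (r *\<^sub>R v)) (at x) b
     = r *\<^sub>R frechet_derivative (\<lambda>y. \<Gamma> y a v) (at x) b" for a b v r
  proof -
    have d: "((\<lambda>y. r *\<^sub>R \<Gamma> y a v) has_derivative (\<lambda>b. r *\<^sub>R frechet_derivative (\<lambda>y. \<Gamma> y a v) (at x) b)) (at x)"
      by (intro has_derivative_scaleR_right Cinf_on_has_derivative[OF \<Gamma>_smooth x])
    have "frechet_derivative (\<lambda>y. \<Gamma> y a (r *\<^sub>R v)) (at x) = frechet_derivative (\<lambda>y. r *\<^sub>R \<Gamma> y a v) (at x)"
      by (rule frechet_derivative_cong_open[OF S x]) (rule linear_scale[OF l])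
    then show ?thesis using frechet_derivative_eqI[OF d] by simp
  qed
  show "linear (curv x a b)"
    by (rule linearI)
      (simp_all add: curv_def add scale linear_add[OF l[OF x]] linear_scale[OF l[OF x]] algebra_simps)
qed

text \<open>The Ricci identity: second derivatives commute, so antisymmetrising the derivative of the
  equation of parallelism leaves the action of the curvature.\<close>

lemma curv_annihilates_parallel2:
  fixes F :: "real^'n \<Rightarrow> real^'n \<Rightarrow> real^'n \<Rightarrow> real"
  assumes x: "x \<in> S" and lin: "\<And>y. y \<in> S \<Longrightarrow> bilinear (F y)"
    and F: "\<And>u v. Cinf_on S (\<lambda>y. F y u v)"
    and par: "\<And>y u v z. y \<in> S \<Longrightarrow> frechet_derivative (\<lambda>y. F y u v) (at y) z = F y (\<Gamma> y z u) v + F y u (\<Gamma> y z v)"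
  shows "F x (curv x a b u) v + F x u (curv x a b v) = 0"
proof -
  have l: "linear (F y u)" "linear (\<lambda>u. F y u v)" if "y \<in> S" for y u v
    using lin[OF that] by (simp_all add: bilinear_def)
  have dd: "frechet_derivative (\<lambda>y. frechet_derivative (\<lambda>y. F y u v) (at y) z) (at x) a
     = F x (\<Gamma> x a (\<Gamma> x z u)) v + F x (\<Gamma> x z u) (\<Gamma> x a v) + F x (frechet_derivative (\<lambda>y. \<Gamma> y z u) (at x) a) v
     + F x (\<Gamma> x a u) (\<Gamma> x z v) + F x u (\<Gamma> x a (\<Gamma> x z v)) + F x u (frechet_derivative (\<lambda>y. \<Gamma> y z v) (at x) a)"
    for a z
  proof -
    have 1: "Cinf_on S (\<lambda>y. F y (\<Gamma> y z u) v)"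
      "frechet_derivative (\<lambda>y. F y (\<Gamma> y z u) v) (at x) a = frechet_derivative (\<lambda>y. F y (\<Gamma> x z u) v) (at x) a
        + F x (frechet_derivative (\<lambda>y. \<Gamma> y z u) (at x) a) v"
      using evaluation_derivative[where \<Phi> = "\<lambda>y u. F y u v" and a = "\<lambda>y. \<Gamma> y z u", OF S l(2) F \<Gamma>_smooth] x by auto
    have 2: "Cinf_on S (\<lambda>y. F y u (\<Gamma> y z v))"
      "frechet_derivative (\<lambda>y. F y u (\<Gamma> y z v)) (at x) a = frechet_derivative (\<lambda>y. F y u (\<Gamma> x z v)) (at x) a
        + F x u (frechet_derivative (\<lambda>y. \<Gamma> y z v) (at x) a)"
      using evaluation_derivative[where \<Phi> = "\<lambda>y. F y u" and a = "\<lambda>y. \<Gamma> y z v", OF S l(1) F \<Gamma>_smooth] x by auto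
    have "frechet_derivative (\<lambda>y. frechet_derivative (\<lambda>y. F y u v) (at y) z) (at x)
      = frechet_derivative (\<lambda>y. F y (\<Gamma> y z u) v + F y u (\<Gamma> y z v)) (at x)"
      by (rule frechet_derivative_cong_open[OF S x par])
    also have "\<dots> = (\<lambda>a. frechet_derivative (\<lambda>y. F y (\<Gamma> y z u) v) (at x) a + frechet_derivative (\<lambda>y. F y u (\<Gamma> y z v)) (at x) a)"
      by (intro frechet_derivative_eqI has_derivative_add Cinf_on_has_derivative[OF _ x] 1(1) 2(1))
    finally show ?thesis by (simp add: 1(2) 2(2) par[OF x])
  qed
  have "frechet_derivative (\<lambda>y. frechet_derivative (\<lambda>y. F y u v) (at y) b) (at x) a
     = frechet_derivative (\<lambda>y. frechet_derivative (\<lambda>y. F y u v) (at y) a) (at x) b"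
    by (rule second_derivative_symmetric_real[OF S x F])
  then show ?thesis
    unfolding dd curv_def
    by (simp add: linear_add[OF l(1)[OF x]] linear_add[OF l(2)[OF x]] linear_diff[OF l(1)[OF x]] linear_diff[OF l(2)[OF x]])
qed

lemma curv_annihilates_parallel3:
  fixes F :: "real^'n \<Rightarrow> real^'n \<Rightarrow> real^'n \<Rightarrow> real^'n \<Rightarrow> real"
  assumes x: "x \<in> S"
    and l: "\<And>y u v. y \<in> S \<Longrightarrow> linear (F y u v)" "\<And>y u w. y \<in> S \<Longrightarrow> linear (\<lambda>v. F y u v w)"
      "\<And>y v w. y \<in> S \<Longrightarrow> linear (\<lambda>u. F y u v w)"
    and F: "\<And>u v w. Cinf_on S (\<lambda>y. F y u v w)"
    and par: "\<And>y u v w z. y \<in> S \<Longrightarrow> frechet_derivative (\<lambda>y. F y u v w) (at y) z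
      = F y (\<Gamma> y z u) v w + F y u (\<Gamma> y z v) w + F y u v (\<Gamma> y z w)"
  shows "F x (curv x a b u) v w + F x u (curv x a b v) w + F x u v (curv x a b w) = 0"
proof -
  have dd: "frechet_derivative (\<lambda>y. frechet_derivative (\<lambda>y. F y u v w) (at y) z) (at x) a
     = F x (\<Gamma> x a (\<Gamma> x z u)) v w + F x (\<Gamma> x z u) (\<Gamma> x a v) w + F x (\<Gamma> x z u) v (\<Gamma> x a w)
       + F x (frechet_derivative (\<lambda>y. \<Gamma> y z u) (at x) a) v w
     + F x (\<Gamma> x a u) (\<Gamma> x z v) w + F x u (\<Gamma> x a (\<Gamma> x z v)) w + F x u (\<Gamma> x z v) (\<Gamma> x a w)
       + F x u (frechet_derivative (\<lambda>y. \<Gamma> y z v) (at x) a) w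
     + F x (\<Gamma> x a u) v (\<Gamma> x z w) + F x u (\<Gamma> x a v) (\<Gamma> x z w) + F x u v (\<Gamma> x a (\<Gamma> x z w))
       + F x u v (frechet_derivative (\<lambda>y. \<Gamma> y z w) (at x) a)"
    for a z
  proof -
    have 1: "Cinf_on S (\<lambda>y. F y (\<Gamma> y z u) v w)"
      "frechet_derivative (\<lambda>y. F y (\<Gamma> y z u) v w) (at x) a = frechet_derivative (\<lambda>y. F y (\<Gamma> x z u) v w) (at x) a
        + F x (frechet_derivative (\<lambda>y. \<Gamma> y z u) (at x) a) v w"
      using evaluation_derivative[where \<Phi> = "\<lambda>y u. F y u v w" and a = "\<lambda>y. \<Gamma> y z u", OF S l(3) F \<Gamma>_smooth] x by auto
    have 2: "Cinf_on S (\<lambda>y. F y u (\<Gamma> y z v) w)"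
      "frechet_derivative (\<lambda>y. F y u (\<Gamma> y z v) w) (at x) a = frechet_derivative (\<lambda>y. F y u (\<Gamma> x z v) w) (at x) a
        + F x u (frechet_derivative (\<lambda>y. \<Gamma> y z v) (at x) a) w"
      using evaluation_derivative[where \<Phi> = "\<lambda>y v. F y u v w" and a = "\<lambda>y. \<Gamma> y z v", OF S l(2) F \<Gamma>_smooth] x by auto
    have 3: "Cinf_on S (\<lambda>y. F y u v (\<Gamma> y z w))"
      "frechet_derivative (\<lambda>y. F y u v (\<Gamma> y z w)) (at x) a = frechet_derivative (\<lambda>y. F y u v (\<Gamma> x z w)) (at x) a
        + F x u v (frechet_derivative (\<lambda>y. \<Gamma> y z w) (at x) a)"
      using evaluation_derivative[where \<Phi> = "\<lambda>y. F y u v" and a = "\<lambda>y. \<Gamma> y z w", OF S l(1) F \<Gamma>_smooth] x by auto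
    have "frechet_derivative (\<lambda>y. frechet_derivative (\<lambda>y. F y u v w) (at y) z) (at x)
      = frechet_derivative (\<lambda>y. F y (\<Gamma> y z u) v w + F y u (\<Gamma> y z v) w + F y u v (\<Gamma> y z w)) (at x)"
      by (rule frechet_derivative_cong_open[OF S x par])
    also have "\<dots> = (\<lambda>a. frechet_derivative (\<lambda>y. F y (\<Gamma> y z u) v w) (at x) a
        + frechet_derivative (\<lambda>y. F y u (\<Gamma> y z v) w) (at x) a + frechet_derivative (\<lambda>y. F y u v (\<Gamma> y z w)) (at x) a)"
      by (intro frechet_derivative_eqI has_derivative_add Cinf_on_has_derivative[OF _ x] 1(1) 2(1) 3(1))
    finally show ?thesis by (simp add: 1(2) 2(2) 3(2) par[OF x])
  qed
  have "frechet_derivative (\<lambda>y. frechet_derivative (\<lambda>y. F y u v w) (at y) b) (at x) a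
     = frechet_derivative (\<lambda>y. frechet_derivative (\<lambda>y. F y u v w) (at y) a) (at x) b"
    by (rule second_derivative_symmetric_real[OF S x F])
  then show ?thesis
    unfolding dd curv_def
    by (simp add: linear_add[OF l(1)[OF x]] linear_add[OF l(2)[OF x]] linear_add[OF l(3)[OF x]]
        linear_diff[OF l(1)[OF x]] linear_diff[OF l(2)[OF x]] linear_diff[OF l(3)[OF x]])
qed

text \<open>Parallelism of the torsion form becomes parallelism of the vector-valued torsion, because the metric
  is parallel and nondegenerate.\<close>
lemma parallel_torsion_derivative:
  assumes x: "x \<in> S"
    and H: "\<And>y. y \<in> S \<Longrightarrow> bilinear (H y)" "\<And>u v. Cinf_on S (\<lambda>y. H y u v)"
    and nondeg: "\<And>v. (\<And>w. H x v w = 0) \<Longrightarrow> v = 0"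
    and Hpar: "\<And>y u v z. y \<in> S \<Longrightarrow> frechet_derivative (\<lambda>y. H y u v :: real) (at y) z = H y (\<Gamma> y z u) v + H y u (\<Gamma> y z v)"
    and Tpar: "\<And>y u v w z. y \<in> S \<Longrightarrow> frechet_derivative (\<lambda>y. H y (tor y u v) w) (at y) z
      = H y (tor y (\<Gamma> y z u) v) w + H y (tor y u (\<Gamma> y z v)) w + H y (tor y u v) (\<Gamma> y z w)"
  shows "frechet_derivative (\<lambda>y. tor y u v) (at x) a
     = tor x (\<Gamma> x a u) v + tor x u (\<Gamma> x a v) - \<Gamma> x a (tor x u v)"
proof -
  have l: "linear (\<lambda>u. H y u v)" if "y \<in> S" for y v
    using H(1)[OF that] by (simp add: bilinear_def)
  have "H x (frechet_derivative (\<lambda>y. tor y u v) (at x) a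
     - (tor x (\<Gamma> x a u) v + tor x u (\<Gamma> x a v) - \<Gamma> x a (tor x u v))) w = 0" for w
    using evaluation_derivative(2)[where \<Phi> = "\<lambda>y u. H y u w" and a = "\<lambda>y. tor y u v", OF S l H(2) tor_smooth x, of a]
      Tpar[OF x, of u v w a] Hpar[OF x, of "tor x u v" w a]
    by (simp add: linear_diff[OF l[OF x]] linear_add[OF l[OF x]])
  from nondeg[OF this] show ?thesis by simp
qed

text \<open>The cyclic sum of the curvature involves the Christoffel symbols only through derivatives and values
  of the torsion; inserting the derivatives of a parallel torsion leaves its quadratic expression.\<close>
lemma first_bianchi:
  assumes x: "x \<in> S"
    and Tpar: "\<And>u v a. frechet_derivative (\<lambda>y. tor y u v) (at x) a
     = tor x (\<Gamma> x a u) v + tor x u (\<Gamma> x a v) - \<Gamma> x a (tor x u v)"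
  shows "curv x a b w + curv x b w a + curv x w a b
    = tor x (tor x a b) w + tor x (tor x b w) a + tor x (tor x w a) b"
proof -
  have G: "linear (\<Gamma> x u)" for u using \<Gamma>_bilinear[OF x] by (simp add: bilinear_def)
  have t: "linear (\<lambda>u. tor x u v)" for v using tor_bilinear[OF x] by (simp add: bilinear_def)
  have skew: "tor x u v = - tor x v u" for u v by (simp add: tor_def)
  have d: "frechet_derivative (\<lambda>y. tor y u v) (at x) a
     = frechet_derivative (\<lambda>y. \<Gamma> y u v) (at x) a - frechet_derivative (\<lambda>y. \<Gamma> y v u) (at x) a" for u v a
    unfolding tor_def
    by (subst frechet_derivative_eqI[OF has_derivative_diff[OF
          Cinf_on_has_derivative[OF \<Gamma>_smooth x] Cinf_on_has_derivative[OF \<Gamma>_smooth x]]]) (rule refl)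
  have tt: "tor x (tor x a b) w = tor x (\<Gamma> x a b) w - tor x (\<Gamma> x b a) w" for a b w
    using linear_diff[OF t] by (simp add: tor_def)
  have GT: "\<Gamma> x a (tor x b w) = \<Gamma> x a (\<Gamma> x b w) - \<Gamma> x a (\<Gamma> x w b)" for a b w
    using linear_diff[OF G] by (simp add: tor_def)
  have "curv x a b w + curv x b w a + curv x w a b
    = (frechet_derivative (\<lambda>y. tor y b w) (at x) a + \<Gamma> x a (tor x b w))
    + (frechet_derivative (\<lambda>y. tor y w a) (at x) b + \<Gamma> x b (tor x w a))
    + (frechet_derivative (\<lambda>y. tor y a b) (at x) w + \<Gamma> x w (tor x a b))"
    unfolding curv_def d GT by (simp add: algebra_simps)
  also have "\<dots> = tor x (tor x a b) w + tor x (tor x b w) a + tor x (tor x w a) b"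
    unfolding Tpar tt
    using skew[of b "\<Gamma> x a w"] skew[of w "\<Gamma> x b a"] skew[of a "\<Gamma> x w b"] by (simp add: algebra_simps)
  finally show ?thesis .
qed

end

section \<open>Vector fields and connections on a manifold, seen in a chart\<close>

text \<open>The field with constant components \<open>v\<close> in the chart \<open>c\<close>. Unlike \<open>ext\<close>, it does not tie the chart
  to the base point, so that one chart serves a whole neighbourhood.\<close>
definition cfield :: "('m, 'n::finite) chart set \<Rightarrow> ('m, 'n) chart \<Rightarrow> real^'n \<Rightarrow> ('m, 'n) field" where
  "cfield A c v = (\<lambda>q. change c (chart_at A q) q v)"

lemma ext_eq_cfield: "ext A p v = cfield A (chart_at A p) v"
  by (simp add: ext_def cfield_def)

text \<open>Defined from the coordinate basis fields, which makes linearity in \<open>w\<close> immediate.\<close>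
definition christoffel ::
  "('m, 'n::finite) chart set \<Rightarrow> ('m, 'n) conn \<Rightarrow> ('m, 'n) chart \<Rightarrow> real^'n \<Rightarrow> real^'n \<Rightarrow> real^'n \<Rightarrow> real^'n" where
  "christoffel A D c x u w = (\<Sum>i\<in>UNIV. (w $ i) *\<^sub>R
     components A c (par c x) (D (par c x) (cfield A c u (par c x)) (cfield A c (axis i 1))))"

locale manifold =
  fixes A :: "('m::{t2_space,second_countable_topology}, 'n::finite) chart set"
  assumes atlas: "smooth_atlas A"
begin

lemma chart_at [simp]: "chart_at A p \<in> A" "p \<in> cdom (chart_at A p)"
proof -
  have "\<exists>c. c \<in> A \<and> p \<in> cdom c" using atlas unfolding smooth_atlas_def by blast
  then have "chart_at A p \<in> A \<and> p \<in> cdom (chart_at A p)" unfolding chart_at_def by (rule someI_ex)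
  then show "chart_at A p \<in> A" "p \<in> cdom (chart_at A p)" by auto
qed

lemma chart:
  assumes "c \<in> A"
  shows open_cdom: "open (cdom c)" and open_crd: "open (crd c ` cdom c)"
    and chart_homeo: "homeomorphism (cdom c) (crd c ` cdom c) (crd c) (par c)"
  using atlas assms unfolding smooth_atlas_def by auto

lemma par_crd [simp]: "c \<in> A \<Longrightarrow> q \<in> cdom c \<Longrightarrow> par c (crd c q) = q"
  using chart_homeo unfolding homeomorphism_def by blast

lemma crd_par [simp]: "c \<in> A \<Longrightarrow> x \<in> crd c ` cdom c \<Longrightarrow> crd c (par c x) = x"
  using chart_homeo unfolding homeomorphism_def by blast

lemma open_crd_image:
  assumes c: "c \<in> A" and U: "open U"
  shows "open (crd c ` (U \<inter> cdom c))"
proof -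
  have "crd c ` (U \<inter> cdom c) = crd c ` cdom c \<inter> par c -` U" using c by auto
  moreover have "continuous_on (crd c ` cdom c) (par c)"
    using chart_homeo[OF c] unfolding homeomorphism_def by blast
  ultimately show ?thesis using continuous_open_preimage open_crd[OF c] U by metis
qed

lemma transition_smooth: "c \<in> A \<Longrightarrow> d \<in> A \<Longrightarrow> Cinf_on (crd c ` (cdom c \<inter> cdom d)) (crd d \<circ> par c)"
  using atlas unfolding smooth_atlas_def by blast

lemma open_overlap: "c \<in> A \<Longrightarrow> d \<in> A \<Longrightarrow> open (crd c ` (cdom c \<inter> cdom d))"
  using open_crd_image[OF _ open_cdom] by (simp add: Int_commute)

lemma change_has_derivative:
  assumes "c \<in> A" "d \<in> A" "q \<in> cdom c" "q \<in> cdom d"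
  shows "((crd d \<circ> par c) has_derivative change c d q) (at (crd c q))"
proof -
  have "change c d q = frechet_derivative (crd d \<circ> par c) (at (crd c q))"
    unfolding change_def by blast
  moreover have "crd c q \<in> crd c ` (cdom c \<inter> cdom d)" using assms by blast
  ultimately show ?thesis
    using Cinf_on_has_derivative[OF transition_smooth[OF assms(1,2)]] by simp
qed

lemma linear_change:
  assumes "c \<in> A" "d \<in> A" "q \<in> cdom c" "q \<in> cdom d"
  shows "linear (change c d q)"
  using change_has_derivative[OF assms] has_derivative_linear by blast

lemma change_chain:
  assumes c: "c \<in> A" "q \<in> cdom c" and d: "d \<in> A" "q \<in> cdom d" and e: "e \<in> A" "q \<in> cdom e"
  shows "change d e q (change c d q v) = change c e q v"
proof -
  have "((crd d \<circ> par c) has_derivative change c d q) (at (crd c q))"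
    by (rule change_has_derivative) (use c d in auto)
  moreover have "((crd e \<circ> par d) has_derivative change d e q) (at ((crd d \<circ> par c) (crd c q)))"
    using change_has_derivative[OF d(1) e(1) d(2) e(2)] c by simp
  ultimately have 1: "((crd e \<circ> par d) \<circ> (crd d \<circ> par c) has_derivative change d e q \<circ> change c d q) (at (crd c q))"
    by (rule diff_chain_at)
  let ?V = "crd c ` (cdom d \<inter> cdom c)"
  have "((crd e \<circ> par c) has_derivative change d e q \<circ> change c d q) (at (crd c q))"
  proof (rule has_derivative_transform_within_open[OF 1])
    show "open ?V" by (rule open_crd_image[OF c(1) open_cdom[OF d(1)]])
    show "crd c q \<in> ?V" using c d by blast
    show "((crd e \<circ> par d) \<circ> (crd d \<circ> par c)) x = (crd e \<circ> par c) x" if "x \<in> ?V" for x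
      using that c d by auto
  qed
  then have "change d e q \<circ> change c d q = change c e q"
    using has_derivative_unique change_has_derivative[OF c(1) e(1) c(2) e(2)] by blast
  then show ?thesis by (metis comp_apply)
qed

lemma change_id [simp]:
  assumes c: "c \<in> A" "q \<in> cdom c" shows "change c c q v = v"
proof -
  have "((\<lambda>x. x) has_derivative (\<lambda>x. x)) (at (crd c q))" by simp
  then have "((crd c \<circ> par c) has_derivative (\<lambda>x. x)) (at (crd c q))"
    by (rule has_derivative_transform_within_open[OF _ open_crd[OF c(1)]]) (use c in auto)
  then show ?thesis using has_derivative_unique change_has_derivative[OF c(1) c(1) c(2) c(2)] by metis
qed

lemma linear_components: "c \<in> A \<Longrightarrow> q \<in> cdom c \<Longrightarrow> linear (components A c q)"
  using linear_change[of "chart_at A q" c q] by (simp add: components_def[abs_def])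

lemma linear_cfield: "c \<in> A \<Longrightarrow> q \<in> cdom c \<Longrightarrow> linear (\<lambda>v. cfield A c v q)"
  using linear_change[of c "chart_at A q" q] by (simp add: cfield_def)

lemma components_cfield [simp]: "c \<in> A \<Longrightarrow> q \<in> cdom c \<Longrightarrow> components A c q (cfield A c v q) = v"
  using change_chain[of c q "chart_at A q" c] by (simp add: components_def cfield_def)

lemma cfield_components [simp]: "c \<in> A \<Longrightarrow> q \<in> cdom c \<Longrightarrow> cfield A c (components A c q v) q = v"
  using change_chain[of "chart_at A q" q c "chart_at A q"] by (simp add: components_def cfield_def)

lemma components_chart_at [simp]: "components A (chart_at A q) q v = v"
  by (simp add: components_def)

lemma cfield_chart_at [simp]: "cfield A (chart_at A q) v q = v"
  by (simp add: cfield_def)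

lemma change_components:
  "c \<in> A \<Longrightarrow> d \<in> A \<Longrightarrow> q \<in> cdom c \<Longrightarrow> q \<in> cdom d \<Longrightarrow>
    components A d q v = change c d q (components A c q v)"
  using change_chain[of "chart_at A q" q c d v] by (simp add: components_def)

lemma local_rep_at: "c \<in> A \<Longrightarrow> q \<in> cdom c \<Longrightarrow> local_rep A c X (crd c q) = components A c q (X q)"
  by (simp add: local_rep_def)

lemma local_rep_cfield: "c \<in> A \<Longrightarrow> x \<in> crd c ` cdom c \<Longrightarrow> local_rep A c (cfield A c v) x = v"
  by (auto simp: local_rep_at)

lemma smooth_field_local_rep:
  "smooth_field A U X \<Longrightarrow> c \<in> A \<Longrightarrow> Cinf_on (crd c ` (U \<inter> cdom c)) (local_rep A c X)"
  by (simp add: smooth_field_def)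

lemma smooth_field_subset: "V \<subseteq> U \<Longrightarrow> smooth_field A U X \<Longrightarrow> smooth_field A V X"
  unfolding smooth_field_def by (meson Cinf_on_subset Int_mono image_mono subset_refl)

lemma smooth_field_cong:
  assumes V: "open V" "\<And>q. q \<in> V \<Longrightarrow> X q = Y q" and X: "smooth_field A V X"
  shows "smooth_field A V Y"
  unfolding smooth_field_def
proof
  fix c assume c: "c \<in> A"
  show "Cinf_on (crd c ` (V \<inter> cdom c)) (local_rep A c Y)"
    by (rule Cinf_on_cong[OF open_crd_image[OF c V(1)] _ smooth_field_local_rep[OF X c]])
      (use V(2) c in \<open>auto simp: local_rep_at\<close>)
qed

lemma smooth_field_add:
  assumes V: "open V" and X: "smooth_field A V X" and Y: "smooth_field A V Y"
  shows "smooth_field A V (\<lambda>q. X q + Y q)"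
  unfolding smooth_field_def
proof
  fix c assume c: "c \<in> A"
  note o = open_crd_image[OF c V]
  show "Cinf_on (crd c ` (V \<inter> cdom c)) (local_rep A c (\<lambda>q. X q + Y q))"
    by (rule Cinf_on_cong[OF o _ Cinf_on_add[OF o smooth_field_local_rep[OF X c] smooth_field_local_rep[OF Y c]]])
      (use c in \<open>auto simp: local_rep_at linear_add[OF linear_components]\<close>)
qed

lemma smooth_field_zero:
  assumes V: "open V" shows "smooth_field A V (\<lambda>q. 0)"
  unfolding smooth_field_def
proof
  fix c assume c: "c \<in> A"
  show "Cinf_on (crd c ` (V \<inter> cdom c)) (local_rep A c (\<lambda>q. 0))"
    by (rule Cinf_on_cong[OF open_crd_image[OF c V] _ Cinf_on_const[of _ 0]])
      (use c in \<open>auto simp: local_rep_at linear_0[OF linear_components]\<close>)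
qed

text \<open>In any other chart the components arise by composing with the transition map and applying its
  derivative.\<close>

lemma smooth_field_in_chart:
  assumes c: "c \<in> A" and U: "open U" "U \<subseteq> cdom c" and X: "Cinf_on (crd c ` U) (local_rep A c X)"
  shows "smooth_field A U X"
  unfolding smooth_field_def
proof
  fix d assume d: "d \<in> A"
  let ?W = "crd d ` (U \<inter> cdom d)" and ?\<psi> = "crd c \<circ> par d" and ?\<phi> = "crd d \<circ> par c"
  have W: "open ?W" by (rule open_crd_image[OF d U(1)])
  have \<psi>: "Cinf_on ?W ?\<psi>"
    using Cinf_on_subset[OF _ transition_smooth[OF d c], of ?W] U(2) by blast
  have \<psi>W: "?\<psi> ` ?W \<subseteq> crd c ` U" "?\<psi> ` ?W \<subseteq> crd c ` (cdom c \<inter> cdom d)" using d U(2) by auto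
  have C: "Cinf_on ?W (\<lambda>y. \<Sum>i\<in>UNIV. (local_rep A c X (?\<psi> y) $ i) *\<^sub>R frechet_derivative ?\<phi> (at (?\<psi> y)) (axis i 1))"
    using W by (intro Cinf_on_sum[OF W] Cinf_on_scaleR[OF W] Cinf_on_bounded_linear[OF W bounded_linear_vec_nth]
        Cinf_on_compose[OF W \<psi> _ \<psi>W(1)] Cinf_on_compose[OF W \<psi> _ \<psi>W(2)] X
        Cinf_on_deriv[OF transition_smooth[OF c d]])
  show "Cinf_on ?W (local_rep A d X)"
  proof (rule Cinf_on_cong[OF W _ C])
    fix y assume "y \<in> ?W"
    then obtain q where q: "q \<in> U" "q \<in> cdom d" "y = crd d q" by blast
    then have qc: "q \<in> cdom c" using U(2) by blast
    have "local_rep A d X y = change c d q (local_rep A c X (crd c q))"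
      unfolding q(3) local_rep_at[OF d q(2)] local_rep_at[OF c qc] by (rule change_components[OF c d qc q(2)])
    also have "\<dots> = (\<Sum>i\<in>UNIV. (local_rep A c X (crd c q) $ i) *\<^sub>R change c d q (axis i 1))"
      by (rule linear_eq_sum_axis[OF linear_change[OF c d qc q(2)]])
    finally show "(\<Sum>i\<in>UNIV. (local_rep A c X (?\<psi> y) $ i) *\<^sub>R frechet_derivative ?\<phi> (at (?\<psi> y)) (axis i 1)) = local_rep A d X y"
      using q d by (simp add: change_def)
  qed
qed

lemma smooth_fun_in_chart:
  assumes c: "c \<in> A" and U: "open U" "U \<subseteq> cdom c" and f: "Cinf_on (crd c ` U) (f \<circ> par c)"
  shows "smooth_fun A U f"
  unfolding smooth_fun_def
proof
  fix d assume d: "d \<in> A"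
  let ?W = "crd d ` (U \<inter> cdom d)" and ?\<psi> = "crd c \<circ> par d"
  have W: "open ?W" by (rule open_crd_image[OF d U(1)])
  have \<psi>: "Cinf_on ?W ?\<psi>"
    using Cinf_on_subset[OF _ transition_smooth[OF d c], of ?W] U(2) by blast
  have "?\<psi> ` ?W \<subseteq> crd c ` U" using d by auto
  from Cinf_on_compose[OF W \<psi> f this]
  show "Cinf_on ?W (f \<circ> par d)"
    by (rule Cinf_on_cong[OF W, rotated]) (use d U(2) c in auto)
qed

lemma smooth_cfield: "c \<in> A \<Longrightarrow> smooth_field A (cdom c) (cfield A c v)"
  by (rule smooth_field_in_chart[OF _ open_cdom subset_refl])
    (auto intro!: Cinf_on_cong[OF open_crd _ Cinf_on_const[of _ v]] simp: local_rep_cfield)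

lemma dir_deriv_in_chart:
  assumes c: "c \<in> A" "q \<in> cdom c" and f: "(f \<circ> par c) differentiable (at (crd c q))"
  shows "dir_deriv A q v f = frechet_derivative (f \<circ> par c) (at (crd c q)) (components A c q v)"
proof -
  let ?d = "chart_at A q"
  let ?V = "crd ?d ` (cdom c \<inter> cdom ?d)"
  have "((crd c \<circ> par ?d) has_derivative change ?d c q) (at (crd ?d q))"
    by (rule change_has_derivative) (use c in auto)
  moreover have "((f \<circ> par c) has_derivative frechet_derivative (f \<circ> par c) (at (crd c q)))
      (at ((crd c \<circ> par ?d) (crd ?d q)))"
    using f by (simp add: frechet_derivative_works)
  ultimately have "((f \<circ> par c) \<circ> (crd c \<circ> par ?d) has_derivative
      frechet_derivative (f \<circ> par c) (at (crd c q)) \<circ> change ?d c q) (at (crd ?d q))"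
    by (rule diff_chain_at)
  then have "((f \<circ> par ?d) has_derivative
      frechet_derivative (f \<circ> par c) (at (crd c q)) \<circ> change ?d c q) (at (crd ?d q))"
  proof (rule has_derivative_transform_within_open)
    show "open ?V" by (rule open_crd_image[OF _ open_cdom]) (use c in auto)
    show "crd ?d q \<in> ?V" using c by auto
    show "((f \<circ> par c) \<circ> (crd c \<circ> par ?d)) x = (f \<circ> par ?d) x" if "x \<in> ?V" for x using that c by auto
  qed
  then show ?thesis unfolding dir_deriv_def components_def using frechet_derivative_eqI by fastforce
qed

end

locale manifold_connection = manifold A for A :: "('m::{t2_space,second_countable_topology}, 'n::finite) chart set" +
  fixes D :: "('m, 'n) conn"
  assumes connection: "linear_connection A D"
begin

lemma
  assumes "open U" "smooth_field A U Y" "q \<in> U"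
  shows D_linear: "linear (\<lambda>v. D q v Y)"
    and D_add: "smooth_field A U Z \<Longrightarrow> D q v (\<lambda>q. Y q + Z q) = D q v Y + D q v Z"
    and D_leibniz: "smooth_fun A U f \<Longrightarrow>
      D q v (\<lambda>q. f q *\<^sub>R Y q) = dir_deriv A q v f *\<^sub>R Y q + f q *\<^sub>R D q v Y"
    and D_smooth: "smooth_field A U X \<Longrightarrow> smooth_field A U (\<lambda>q. D q (X q) Y)"
proof -
  note con = connection[unfolded linear_connection_def]
  show "linear (\<lambda>v. D q v Y)"
    using con[THEN conjunct1, rule_format, of U Y q] assms by blast
  show "D q v (\<lambda>q. Y q + Z q) = D q v Y + D q v Z" if "smooth_field A U Z"
    using con[THEN conjunct2, THEN conjunct1, rule_format, of U Y Z q v] assms that by blast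
  show "D q v (\<lambda>q. f q *\<^sub>R Y q) = dir_deriv A q v f *\<^sub>R Y q + f q *\<^sub>R D q v Y" if "smooth_fun A U f"
    using con[THEN conjunct2, THEN conjunct2, THEN conjunct1, rule_format, of U f Y q v] assms that by blast
  show "smooth_field A U (\<lambda>q. D q (X q) Y)" if "smooth_field A U X"
    using con[THEN conjunct2, THEN conjunct2, THEN conjunct2, rule_format, of U X Y] assms that by blast
qed

text \<open>The Leibniz rule for the indicator function of \<open>V\<close>, which is smooth on \<open>V\<close> with zero derivative.\<close>
lemma D_local:
  assumes V: "open V" "q \<in> V" "\<And>r. r \<in> V \<Longrightarrow> X r = Y r" and X: "smooth_field A V X"
  shows "D q v X = D q v Y"
proof -
  define f :: "'m \<Rightarrow> real" where "f r = (if r \<in> V then 1 else 0)" for r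
  have f1: "Cinf_on (crd d ` (V \<inter> cdom d)) (f \<circ> par d)" if d: "d \<in> A" for d
    by (rule Cinf_on_cong[OF open_crd_image[OF d V(1)] _ Cinf_on_const[of _ 1]]) (use d in \<open>auto simp: f_def\<close>)
  then have f: "smooth_fun A V f" unfolding smooth_fun_def by blast
  have "frechet_derivative (f \<circ> par (chart_at A q)) (at (crd (chart_at A q) q)) = frechet_derivative (\<lambda>x. 1) (at (crd (chart_at A q) q))"
    by (rule frechet_derivative_cong_open[OF open_crd_image[OF chart_at(1) V(1)]])
      (use V(2) chart_at in \<open>auto simp: f_def\<close>)
  then have df: "dir_deriv A q v f = 0" unfolding dir_deriv_def by (simp add: frechet_derivative_const)
  have Y: "smooth_field A V Y" by (rule smooth_field_cong[OF V(1,3) X])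
  have "D q v X = D q v (\<lambda>r. f r *\<^sub>R X r)"
    using D_leibniz[OF V(1) X V(2) f] df V(2) by (simp add: f_def)
  also have "(\<lambda>r. f r *\<^sub>R X r) = (\<lambda>r. f r *\<^sub>R Y r)" using V(3) by (auto simp: f_def)
  also have "D q v \<dots> = D q v Y"
    using D_leibniz[OF V(1) Y V(2) f] df V(2) by (simp add: f_def)
  finally show ?thesis .
qed

lemma D_zero: "D q v (\<lambda>r. 0) = 0"
  using D_add[OF open_UNIV smooth_field_zero[OF open_UNIV] UNIV_I smooth_field_zero[OF open_UNIV], of q v] by simp

lemma D_sum:
  assumes V: "open V" "q \<in> V" and "finite I" "\<And>i. i \<in> I \<Longrightarrow> smooth_field A V (Y i)"
  shows "D q v (\<lambda>r. \<Sum>i\<in>I. Y i r) = (\<Sum>i\<in>I. D q v (Y i)) \<and> smooth_field A V (\<lambda>r. \<Sum>i\<in>I. Y i r)"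
  using assms(3,4)
proof (induction I)
  case empty
  then show ?case using D_zero smooth_field_zero[OF V(1)] by simp
next
  case (insert i I)
  have "smooth_field A V (Y i)" using insert by simp
  then show ?case
    using D_add[OF V(1) _ V(2), of "Y i" "\<lambda>r. \<Sum>i\<in>I. Y i r" v] insert smooth_field_add[OF V(1)] by simp
qed

text \<open>Expand \<open>X\<close> in the coordinate basis fields near \<open>q\<close>. In particular the value depends on \<open>X\<close> only
  through its first-order jet, which gives the tensoriality of the torsion.\<close>

lemma D_in_chart:
  assumes c: "c \<in> A" "q \<in> cdom c" and V: "open V" "q \<in> V" and X: "smooth_field A V X"
  shows "components A c q (D q v X) = frechet_derivative (local_rep A c X) (at (crd c q)) (components A c q v)
     + christoffel A D c (crd c q) (components A c q v) (components A c q (X q))"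
proof -
  let ?W = "V \<inter> cdom c"
  let ?f = "\<lambda>i r. components A c r (X r) $ i"
  let ?E = "\<lambda>i. cfield A c (axis i 1)"
  have W: "open ?W" "q \<in> ?W" "?W \<subseteq> cdom c" using V c open_Int[OF V(1) open_cdom[OF c(1)]] by auto
  have oW: "open (crd c ` ?W)" by (rule open_crd_image[OF c(1) V(1)])
  have xW: "crd c q \<in> crd c ` ?W" using W(2) by blast
  have XW: "Cinf_on (crd c ` ?W) (local_rep A c X)" by (rule smooth_field_local_rep[OF X c(1)])
  have fX: "(?f i \<circ> par c) x = local_rep A c X x $ i" for i x
    by (simp add: local_rep_def)
  have fC: "Cinf_on (crd c ` ?W) (?f i \<circ> par c)" for i
    by (rule Cinf_on_cong[OF oW _ Cinf_on_bounded_linear[OF oW bounded_linear_vec_nth XW]]) (rule fX[symmetric])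
  have f: "smooth_fun A ?W (?f i)" for i
    by (rule smooth_fun_in_chart[OF c(1) W(1,3) fC])
  have E: "smooth_field A ?W (?E i)" for i
    by (rule smooth_field_subset[OF W(3) smooth_cfield[OF c(1)]])
  have fE: "smooth_field A ?W (\<lambda>r. ?f i r *\<^sub>R ?E i r)" for i
  proof (rule smooth_field_in_chart[OF c(1) W(1,3)])
    show "Cinf_on (crd c ` ?W) (local_rep A c (\<lambda>r. ?f i r *\<^sub>R ?E i r))"
      by (rule Cinf_on_cong[OF oW _ Cinf_on_scaleR[OF oW fC[of i] Cinf_on_const[of _ "axis i 1"]]])
        (use c in \<open>auto simp: local_rep_at linear_scale[OF linear_components]\<close>)
  qed
  have Xexp: "X r = (\<Sum>i\<in>UNIV. ?f i r *\<^sub>R ?E i r)" if "r \<in> ?W" for r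
    using linear_eq_sum_axis[OF linear_cfield[OF c(1)], of r "components A c r (X r)"] that c by simp
  have df: "dir_deriv A q v (?f i) = frechet_derivative (local_rep A c X) (at (crd c q)) (components A c q v) $ i" for i
  proof -
    have "dir_deriv A q v (?f i) = frechet_derivative (?f i \<circ> par c) (at (crd c q)) (components A c q v)"
      by (rule dir_deriv_in_chart[OF c Cinf_on_differentiable[OF fC xW]])
    also have "?f i \<circ> par c = (\<lambda>x. local_rep A c X x $ i)" using fX by blast
    also have "frechet_derivative \<dots> (at (crd c q)) = (\<lambda>z. frechet_derivative (local_rep A c X) (at (crd c q)) z $ i)"
      by (intro frechet_derivative_eqI bounded_linear.has_derivative[OF bounded_linear_vec_nth] Cinf_on_has_derivative[OF XW xW])
    finally show ?thesis .
  qed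
  have "D q v X = D q v (\<lambda>r. \<Sum>i\<in>UNIV. ?f i r *\<^sub>R ?E i r)"
    by (rule D_local[OF W(1,2) Xexp smooth_field_subset[OF _ X]]) auto
  also have "\<dots> = (\<Sum>i\<in>UNIV. D q v (\<lambda>r. ?f i r *\<^sub>R ?E i r))"
    by (rule conjunct1[OF D_sum[OF W(1,2) finite_class.finite_UNIV]]) (rule fE)
  also have "\<dots> = (\<Sum>i\<in>UNIV. dir_deriv A q v (?f i) *\<^sub>R ?E i q + ?f i q *\<^sub>R D q v (?E i))"
    using D_leibniz[OF W(1) E W(2) f] by simp
  finally have "components A c q (D q v X) = (\<Sum>i\<in>UNIV. dir_deriv A q v (?f i) *\<^sub>R axis i 1)
      + (\<Sum>i\<in>UNIV. ?f i q *\<^sub>R components A c q (D q v (?E i)))"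
    using c by (simp add: linear_sum[OF linear_components[OF c]] linear_add[OF linear_components[OF c]]
        linear_scale[OF linear_components[OF c]] sum.distrib)
  moreover have "(\<Sum>i\<in>UNIV. dir_deriv A q v (?f i) *\<^sub>R axis i 1)
      = frechet_derivative (local_rep A c X) (at (crd c q)) (components A c q v)"
    unfolding df by (rule linear_eq_sum_axis[OF bounded_linear.linear[OF bounded_linear_ident], symmetric])
  ultimately show ?thesis using c by (simp add: christoffel_def)
qed

lemma D_cfield:
  assumes c: "c \<in> A" "q \<in> cdom c"
  shows "D q (cfield A c u q) (cfield A c v) = cfield A c (christoffel A D c (crd c q) u v) q"
proof -
  have "frechet_derivative (local_rep A c (cfield A c v)) (at (crd c q)) = frechet_derivative (\<lambda>x. v) (at (crd c q))"
    by (rule frechet_derivative_cong_open[OF open_crd[OF c(1)]]) (use c in \<open>auto simp: local_rep_cfield\<close>)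
  then have "components A c q (D q (cfield A c u q) (cfield A c v)) = christoffel A D c (crd c q) u v"
    using D_in_chart[OF c open_cdom[OF c(1)] c(2) smooth_cfield[OF c(1)], of "cfield A c u q" v] c
    by (simp add: frechet_derivative_const)
  then show ?thesis using cfield_components[OF c] by metis
qed

lemma coordinate_connection_christoffel:
  assumes c: "c \<in> A"
  shows "coordinate_connection (crd c ` cdom c) (christoffel A D c)"
proof
  let ?S = "crd c ` cdom c"
  show S: "open ?S" by (rule open_crd[OF c])
  note E = smooth_cfield[OF c]
  show "bilinear (christoffel A D c x)" if "x \<in> ?S" for x
  proof -
    have q: "par c x \<in> cdom c" using that c by auto
    note l = linear_components[OF c q] linear_cfield[OF c q] D_linear[OF open_cdom[OF c] E q]
    show ?thesis unfolding bilinear_def christoffel_def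
      by (auto intro!: linearI simp: linear_add[OF l(1)] linear_add[OF l(2)] linear_add[OF l(3)]
          linear_scale[OF l(1)] linear_scale[OF l(2)] linear_scale[OF l(3)] algebra_simps
          sum.distrib scaleR_sum_right)
  qed
  show "Cinf_on ?S (\<lambda>x. christoffel A D c x u v)" for u v
  proof -
    have "Cinf_on ?S (local_rep A c (\<lambda>q. D q (cfield A c u q) (cfield A c w)))" for w
    proof (cases "\<exists>q. q \<in> cdom c")
      case True
      then obtain q where "q \<in> cdom c" by blast
      from smooth_field_local_rep[OF D_smooth[OF open_cdom[OF c] E this E] c] show ?thesis by simp
    next
      case False
      then have "?S = {}" by blast
      then show ?thesis using Cinf_on_subset[of "{}" UNIV] Cinf_on_cong[OF open_empty _ Cinf_on_const] by fastforce
    qed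
    then have "Cinf_on ?S (\<lambda>x. \<Sum>i\<in>UNIV. (v $ i) *\<^sub>R local_rep A c (\<lambda>q. D q (cfield A c u q) (cfield A c (axis i 1))) x)"
      by (intro Cinf_on_sum[OF S] Cinf_on_bounded_linear[OF S bounded_linear_scaleR_right])
    then show ?thesis by (simp add: christoffel_def[abs_def] local_rep_def)
  qed
qed

lemma lie_bracket_cfield:
  "lie_bracket A (cfield A (chart_at A q) u) (cfield A (chart_at A q) v) q = 0"
proof -
  let ?c = "chart_at A q"
  have "frechet_derivative (local_rep A ?c (cfield A ?c v)) (at (crd ?c q)) = frechet_derivative (\<lambda>x. v) (at (crd ?c q))" for v
    by (rule frechet_derivative_cong_open[OF open_crd[OF chart_at(1)]]) (auto simp: local_rep_cfield)
  then show ?thesis by (simp add: lie_bracket_def Let_def frechet_derivative_const)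
qed

text \<open>The torsion form at a point is computed in the preferred chart of that point. The transition to
  another chart contributes second derivatives of the coordinate change, which cancel by symmetry.\<close>

lemma torsion_in_chart:
  assumes c: "c \<in> A" "q \<in> cdom c"
  shows "components A c q (torsion A D (ext A q u) (ext A q v) q)
     = coordinate_connection.tor (christoffel A D c) (crd c q) (components A c q u) (components A c q v)"
proof -
  interpret coordinate_connection "crd c ` cdom c" "christoffel A D c"
    by (rule coordinate_connection_christoffel[OF c(1)])
  let ?d = "chart_at A q"
  let ?\<phi> = "crd c \<circ> par ?d" and ?\<psi> = "crd ?d \<circ> par c"
  let ?W = "crd c ` (cdom c \<inter> cdom ?d)" and ?W' = "crd ?d ` (cdom ?d \<inter> cdom c)"
  have W: "open ?W" "crd c q \<in> ?W" using open_overlap c by auto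
  have W': "open ?W'" "crd ?d q \<in> ?W'" using open_overlap c by auto
  have \<phi>: "Cinf_on ?W' ?\<phi>" by (rule transition_smooth) (use c in auto)
  have d: "frechet_derivative (local_rep A c (cfield A ?d v)) (at (crd c q)) (components A c q u)
     = frechet_derivative (\<lambda>y. frechet_derivative ?\<phi> (at y) v) (at (crd ?d q)) u" for u v
  proof -
    have rep: "local_rep A c (cfield A ?d v) y = ((\<lambda>y. frechet_derivative ?\<phi> (at y) v) \<circ> ?\<psi>) y" if y: "y \<in> ?W" for y
    proof -
      from y obtain r where r: "r \<in> cdom c" "r \<in> cdom ?d" "y = crd c r" by blast
      then have "local_rep A c (cfield A ?d v) y = change ?d c r (components A ?d r (cfield A ?d v r))"
        unfolding r(3) local_rep_at[OF c(1) r(1)] by (intro change_components chart_at c)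
      then show ?thesis using r c by (simp add: change_def)
    qed
    have "(?\<psi> has_derivative change c ?d q) (at (crd c q))"
      by (rule change_has_derivative) (use c in auto)
    moreover have "((\<lambda>y. frechet_derivative ?\<phi> (at y) v) has_derivative
        frechet_derivative (\<lambda>y. frechet_derivative ?\<phi> (at y) v) (at (crd ?d q))) (at (?\<psi> (crd c q)))"
      using Cinf_on_has_derivative[OF Cinf_on_deriv[OF \<phi>] W'(2), of v] c by simp
    ultimately have "((\<lambda>y. frechet_derivative ?\<phi> (at y) v) \<circ> ?\<psi> has_derivative
        frechet_derivative (\<lambda>y. frechet_derivative ?\<phi> (at y) v) (at (crd ?d q)) \<circ> change c ?d q) (at (crd c q))"
      by (rule diff_chain_at)
    from frechet_derivative_eqI[OF this]
    have "frechet_derivative (local_rep A c (cfield A ?d v)) (at (crd c q))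
      = frechet_derivative (\<lambda>y. frechet_derivative ?\<phi> (at y) v) (at (crd ?d q)) \<circ> change c ?d q"
      by (subst frechet_derivative_cong_open[OF W rep]) simp_all
    moreover have "change c ?d q (components A c q u) = u"
      using change_components[of c ?d q u] c by simp
    ultimately show ?thesis by simp
  qed
  have "components A c q (torsion A D (ext A q u) (ext A q v) q)
      = components A c q (D q u (cfield A ?d v)) - components A c q (D q v (cfield A ?d u))"
    using c by (simp add: torsion_def ext_eq_cfield lie_bracket_cfield linear_diff[OF linear_components])
  also have "\<dots> = tor (crd c q) (components A c q u) (components A c q v)"
  proof -
    have o: "open (cdom ?d)" "q \<in> cdom ?d" "smooth_field A (cdom ?d) (cfield A ?d v)" for v
      using open_cdom smooth_cfield by auto
    show ?thesis
      unfolding D_in_chart[OF c o] d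
      using second_derivative_symmetric[OF W' \<phi>, of u v] by (simp add: tor_def)
  qed
  finally show ?thesis .
qed

lemma D_at:
  assumes "open V" "q \<in> V" "smooth_field A V X"
  shows "D q v X = frechet_derivative (local_rep A (chart_at A q) X) (at (crd (chart_at A q) q)) v
     + christoffel A D (chart_at A q) (crd (chart_at A q) q) v (X q)"
  using D_in_chart[OF chart_at assms] by simp

lemma lie_bracket_via_D:
  assumes V: "open V" "q \<in> V" and X: "smooth_field A V X" and Y: "smooth_field A V Y"
  shows "lie_bracket A X Y q = D q (X q) Y - D q (Y q) X
     - coordinate_connection.tor (christoffel A D (chart_at A q)) (crd (chart_at A q) q) (X q) (Y q)"
proof -
  interpret coordinate_connection "crd (chart_at A q) ` cdom (chart_at A q)" "christoffel A D (chart_at A q)"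
    by (rule coordinate_connection_christoffel) simp
  show ?thesis unfolding D_at[OF V X] D_at[OF V Y] by (simp add: lie_bracket_def Let_def tor_def)
qed

end

section \<open>The characteristic connection of a hermitian manifold of type \<open>\<W>\<^sub>3\<close>\<close>

text \<open>The components of a field of bilinear forms in the chart \<open>c\<close>.\<close>
definition pull2 ::
  "('m, 'n::finite) chart set \<Rightarrow> ('m, 'n) chart \<Rightarrow> ('m \<Rightarrow> real^'n \<Rightarrow> real^'n \<Rightarrow> real)
     \<Rightarrow> real^'n \<Rightarrow> real^'n \<Rightarrow> real^'n \<Rightarrow> real" where
  "pull2 A c F x u v = F (par c x) (cfield A c u (par c x)) (cfield A c v (par c x))"

context manifold_connection begin

lemma parallel2_in_chart:
  assumes c: "c \<in> A" and x: "x \<in> crd c ` cdom c"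
    and F: "Cinf_on (crd c ` cdom c) (\<lambda>y. pull2 A c F y u v)"
    and par: "cov_deriv2 A D F (par c x) (cfield A c z (par c x)) (cfield A c u) (cfield A c v) = 0"
  shows "frechet_derivative (\<lambda>y. pull2 A c F y u v) (at x) z
     = pull2 A c F x (christoffel A D c x z u) v + pull2 A c F x u (christoffel A D c x z v)"
proof -
  let ?q = "par c x" and ?f = "\<lambda>r. F r (cfield A c u r) (cfield A c v r)"
  have q: "?q \<in> cdom c" and xq: "crd c ?q = x" using x c by auto
  have f: "?f \<circ> par c = (\<lambda>y. pull2 A c F y u v)" by (simp add: pull2_def o_def)
  have "(?f \<circ> par c) differentiable (at (crd c ?q))"
    unfolding f xq by (rule Cinf_on_differentiable[OF F x])
  from dir_deriv_in_chart[OF c q this, of "cfield A c z ?q"]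
  have "dir_deriv A ?q (cfield A c z ?q) ?f = frechet_derivative (\<lambda>y. pull2 A c F y u v) (at x) z"
    unfolding f xq components_cfield[OF c q] .
  then show ?thesis using par unfolding cov_deriv2_def D_cfield[OF c q] xq by (simp add: pull2_def)
qed

lemma parallel3_in_chart:
  assumes c: "c \<in> A" and x: "x \<in> crd c ` cdom c"
    and F: "\<And>y u v w. y \<in> crd c ` cdom c \<Longrightarrow>
        T (par c y) (cfield A c u (par c y)) (cfield A c v (par c y)) (cfield A c w (par c y)) = F y u v w"
    and Fs: "Cinf_on (crd c ` cdom c) (\<lambda>y. F y u v w)"
    and par: "cov_deriv3 A D T (par c x) (cfield A c z (par c x)) (cfield A c u) (cfield A c v) (cfield A c w) = 0"
  shows "frechet_derivative (\<lambda>y. F y u v w) (at x) z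
     = F x (christoffel A D c x z u) v w + F x u (christoffel A D c x z v) w + F x u v (christoffel A D c x z w)"
proof -
  let ?q = "par c x" and ?f = "\<lambda>r. T r (cfield A c u r) (cfield A c v r) (cfield A c w r)"
  have q: "?q \<in> cdom c" and xq: "crd c ?q = x" using x c by auto
  have f: "(?f \<circ> par c) y = F y u v w" if "y \<in> crd c ` cdom c" for y using F[OF that] by simp
  have d: "(?f \<circ> par c) differentiable (at (crd c ?q))" unfolding xq
    by (rule differentiable_cong_open[OF open_crd[OF c] x f[symmetric] Cinf_on_differentiable[OF Fs x]])
  have "dir_deriv A ?q (cfield A c z ?q) ?f = frechet_derivative (?f \<circ> par c) (at x) z"
    using dir_deriv_in_chart[OF c q d, of "cfield A c z ?q"] unfolding xq components_cfield[OF c q] .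
  also have "frechet_derivative (?f \<circ> par c) (at x) = frechet_derivative (\<lambda>y. F y u v w) (at x)"
    by (rule frechet_derivative_cong_open[OF open_crd[OF c] x f])
  finally show ?thesis using par unfolding cov_deriv3_def D_cfield[OF c q] xq F[OF x] by simp
qed

end

locale metric_connection = manifold_connection A D
  for A :: "('m::{t2_space,second_countable_topology}, 'n::finite) chart set" and D +
  fixes g :: "'m \<Rightarrow> real^'n \<Rightarrow> real^'n \<Rightarrow> real"
  assumes metric: "riemannian_metric A g" and g_parallel: "parallel2 A D g"
begin

lemma
  shows g_bilinear: "bilinear (g p)" and g_sym: "g p v w = g p w v" and g_pos: "v \<noteq> 0 \<Longrightarrow> g p v v > 0"
    and g_smooth: "open U \<Longrightarrow> smooth_field A U X \<Longrightarrow> smooth_field A U Y \<Longrightarrow> smooth_fun A U (\<lambda>p. g p (X p) (Y p))"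
  using metric unfolding riemannian_metric_def by auto

lemma pull_metric:
  assumes c: "c \<in> A"
  shows "Cinf_on (crd c ` cdom c) (\<lambda>y. pull2 A c g y u v)"
    and "x \<in> crd c ` cdom c \<Longrightarrow> bilinear (pull2 A c g x)"
    and "x \<in> crd c ` cdom c \<Longrightarrow> frechet_derivative (\<lambda>y. pull2 A c g y u v) (at x) z
     = pull2 A c g x (christoffel A D c x z u) v + pull2 A c g x u (christoffel A D c x z v)"
proof -
  note E = smooth_cfield[OF c]
  have "smooth_fun A (cdom c) (\<lambda>p. g p (cfield A c u p) (cfield A c v p))"
    by (rule g_smooth[OF open_cdom[OF c] E E])
  then show 1: "Cinf_on (crd c ` cdom c) (\<lambda>y. pull2 A c g y u v)"
    using c unfolding smooth_fun_def by (auto simp: pull2_def o_def dest: bspec[of _ _ c])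
  assume x: "x \<in> crd c ` cdom c"
  then have q: "par c x \<in> cdom c" using c by auto
  show "bilinear (pull2 A c g x)"
    unfolding bilinear_def
    by (auto intro!: linearI simp: pull2_def linear_add[OF linear_cfield[OF c q]] linear_scale[OF linear_cfield[OF c q]]
        bilinear_ladd[OF g_bilinear] bilinear_radd[OF g_bilinear] bilinear_lmul[OF g_bilinear] bilinear_rmul[OF g_bilinear])
  show "frechet_derivative (\<lambda>y. pull2 A c g y u v) (at x) z
     = pull2 A c g x (christoffel A D c x z u) v + pull2 A c g x u (christoffel A D c x z v)"
    by (rule parallel2_in_chart[OF c x 1])
      (use g_parallel open_cdom[OF c] E q in \<open>unfold parallel2_def, blast\<close>)
qed

lemma pull_metric_at: "pull2 A (chart_at A p) g (crd (chart_at A p) p) u v = g p u v"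
  by (simp add: pull2_def)

end

lemma (in hermitian_space) orthonormal_set_exists:
  "k \<le> DIM('a) \<Longrightarrow> \<exists>S. orthonormal S \<and> card S = k"
proof (induction k)
  case 0
  then show ?case by (intro exI[of _ "{}"]) (simp add: orthonormal_def)
next
  case (Suc k)
  then obtain S where S: "orthonormal S" "card S = k" by auto
  have "card S < DIM('a)" using S Suc.prems by simp
  from orthogonal_vector_exists[OF S(1) this]
  obtain v where v: "v \<noteq> 0" "\<And>x. x \<in> S \<Longrightarrow> h v x = 0" by blast
  let ?v = "(1 / sqrt (h v v)) *\<^sub>R v"
  have 1: "h ?v ?v = 1" using h_pos[OF v(1)] by simp
  have 0: "h ?v x = 0" "h x ?v = 0" if "x \<in> S" for x
  proof -
    show "h ?v x = 0" using v(2)[OF that] by simp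
    then show "h x ?v = 0" by (metis h_sym)
  qed
  have "?v \<notin> S" using 0(1)[of ?v] 1 by auto
  moreover have "orthonormal (insert ?v S)"
    using S(1) 1 0 \<open>?v \<notin> S\<close> unfolding orthonormal_def by (auto simp del: h_simps)
  ultimately show ?case using S by (intro exI[of _ "insert ?v S"]) (auto simp: orthonormal_def)
qed

locale characteristic_geometry =
  D: metric_connection A D g + L: metric_connection A L g
  for A :: "('m::{t2_space,second_countable_topology}, 'n::finite) chart set" and g D L +
  fixes J :: "'m \<Rightarrow> real^'n \<Rightarrow> real^'n"
  assumes hermitian: "almost_hermitian A g J"
    and J_parallel: "parallel_endo A D J"
    and torsion_skew: "torsion_form A g D p v u w = - torsion_form A g D p u v w"
      "torsion_form A g D p u w v = - torsion_form A g D p u v w"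
    and L_torsion_free: "open U \<Longrightarrow> smooth_field A U X \<Longrightarrow> smooth_field A U Y \<Longrightarrow> p \<in> U \<Longrightarrow> torsion A L X Y p = 0"
    and W3: "type_W3 A g J L"
    and torsion_parallel: "parallel3 A D (torsion_form A g D)"
begin

lemma
  shows J_linear: "linear (J p)" and J_J: "J p (J p v) = - v" and g_J: "g p (J p v) (J p w) = g p v w"
    and J_smooth: "open U \<Longrightarrow> smooth_field A U X \<Longrightarrow> smooth_field A U (\<lambda>p. J p (X p))"
  using hermitian unfolding almost_hermitian_def almost_complex_def by blast+

lemma hermitian_space: "hermitian_space (g p) (J p)"
  by (rule hermitian_space.intro) (rule D.g_bilinear D.g_sym D.g_pos J_linear J_J g_J; assumption?)+

lemma D_J: "open U \<Longrightarrow> smooth_field A U X \<Longrightarrow> p \<in> U \<Longrightarrow> D p v (\<lambda>q. J q (X q)) = J p (D p v X)"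
  using J_parallel unfolding parallel_endo_def by blast

lemma g_J_left: "g p (J p v) w = - g p v (J p w)"
proof -
  interpret hermitian_space "g p" "J p" by (rule hermitian_space)
  show ?thesis by (rule h_j_left)
qed

text \<open>The Kaehler form is used in place of \<open>J\<close> so that the Ricci identity for bilinear forms applies to it.\<close>
lemma kaehler_parallel: "parallel2 A D (kaehler_form g J)"
  unfolding parallel2_def
proof (intro allI impI ballI, elim conjE)
  fix U X Y p v assume U: "open U" and X: "smooth_field A U X" and Y: "smooth_field A U Y" and p: "p \<in> U"
  have "cov_deriv2 A D (kaehler_form g J) p v X Y = cov_deriv2 A D g p v (\<lambda>q. J q (X q)) Y"
    by (simp add: cov_deriv2_def kaehler_form_def D_J[OF U X p])
  also have "\<dots> = 0" using D.g_parallel U J_smooth[OF U X] Y p unfolding parallel2_def by blast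
  finally show "cov_deriv2 A D (kaehler_form g J) p v X Y = 0" .
qed

definition tor :: "'m \<Rightarrow> real^'n \<Rightarrow> real^'n \<Rightarrow> real^'n" where
  "tor p = coordinate_connection.tor (christoffel A D (chart_at A p)) (crd (chart_at A p) p)"

definition curv :: "'m \<Rightarrow> real^'n \<Rightarrow> real^'n \<Rightarrow> real^'n \<Rightarrow> real^'n" where
  "curv p = coordinate_connection.curv (christoffel A D (chart_at A p)) (crd (chart_at A p) p)"

lemma torsion_form_eq: "torsion_form A g D p u v w = g p (tor p u v) w"
  using D.torsion_in_chart[OF D.chart_at, of p u v] by (simp add: torsion_form_def tor_def)

text \<open>As \<open>J\<close> is parallel, rewriting brackets through the connection cancels all covariant derivatives in
  the Nijenhuis tensor and leaves the torsion terms.\<close>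
lemma torsion_type:
  "tor p (J p u) (J p v) - tor p u v = J p (tor p (J p u) v + tor p u (J p v))"
proof -
  let ?c = "chart_at A p"
  let ?U = "cdom ?c" and ?X = "cfield A ?c u" and ?Y = "cfield A ?c v"
  have U: "open ?U" "p \<in> ?U" using D.open_cdom by auto
  have X: "smooth_field A ?U ?X" and Y: "smooth_field A ?U ?Y" using D.smooth_cfield by auto
  note JX = J_smooth[OF U(1) X] and JY = J_smooth[OF U(1) Y]
  have "nijenhuis A J ?X ?Y p = 0"
    using W3 U X Y unfolding type_W3_def integrable_J_def by blast
  then show ?thesis
    unfolding nijenhuis_def
      D.lie_bracket_via_D[OF U JX JY] D.lie_bracket_via_D[OF U JX Y]
      D.lie_bracket_via_D[OF U X JY] D.lie_bracket_via_D[OF U X Y]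
      D_J[OF U(1) X U(2)] D_J[OF U(1) Y U(2)] tor_def[symmetric] D.cfield_chart_at
    by (simp add: linear_add[OF J_linear] linear_diff[OF J_linear] J_J algebra_simps)
qed

lemma hermitian_torsion: "hermitian_torsion (g p) (J p) (tor p)"
proof -
  interpret hermitian_space "g p" "J p" by (rule hermitian_space)
  let ?c = "chart_at A p"
  interpret cc: coordinate_connection "crd ?c ` cdom ?c" "christoffel A D ?c"
    by (rule D.coordinate_connection_christoffel) simp
  show ?thesis
  proof
    show "bilinear (tor p)" unfolding tor_def by (rule cc.tor_bilinear) simp
    show "tor p y x = - tor p x y" for x y by (simp add: tor_def cc.tor_def)
    show "g p (tor p x y) z = - g p (tor p x z) y" for x y z
      using torsion_skew(2)[of p x y z] by (simp add: torsion_form_eq)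
    show "tor p (J p x) (J p y) - tor p x y = J p (tor p (J p x) y + tor p x (J p y))" for x y
      by (rule torsion_type)
  qed
qed

text \<open>Both connections are metric, so their difference is skew in the last two arguments; after
  subtracting half the torsion it is also symmetric in the first two, and hence zero.\<close>

lemma difference_tensor:
  fixes p defines "c \<equiv> chart_at A p" and "x \<equiv> crd (chart_at A p) p"
  shows "2 * g p (christoffel A D c x u v - christoffel A L c x u v) w = g p (tor p u v) w"
proof -
  interpret T: hermitian_torsion "g p" "J p" "tor p" by (rule hermitian_torsion)
  have c: "c \<in> A" "p \<in> cdom c" by (simp_all add: c_def)
  have x: "x \<in> crd c ` cdom c" "par c x = p" using c by (auto simp: x_def c_def)
  define Q where "Q u v = christoffel A D c x u v - christoffel A L c x u v" for u v
  have at: "pull2 A c g x u v = g p u v" for u v unfolding c_def x_def by (rule D.pull_metric_at)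
  have "g p (christoffel A D c x u v) w + g p v (christoffel A D c x u w)
      = g p (christoffel A L c x u v) w + g p v (christoffel A L c x u w)" for u v w
    using D.pull_metric(3)[OF c(1) x(1), of v w u] L.pull_metric(3)[OF c(1) x(1), of v w u] unfolding at by simp
  then have Qskew: "g p (Q u v) w = - g p v (Q u w)" for u v w
    unfolding Q_def by (simp add: algebra_simps)
  have Lsym: "christoffel A L c x u v = christoffel A L c x v u" for u v
  proof -
    have "torsion A L (cfield A c u) (cfield A c v) p = 0"
      by (rule L_torsion_free[OF D.open_cdom[OF c(1)] D.smooth_cfield[OF c(1)] D.smooth_cfield[OF c(1)] c(2)])
    then have "cfield A c (christoffel A L c x u v) p = cfield A c (christoffel A L c x v u) p"
      using L.D_cfield[OF c, of u v] L.D_cfield[OF c, of v u] L.lie_bracket_cfield[of p u v]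
      by (simp add: torsion_def c_def x_def)
    then show ?thesis by (simp add: c_def)
  qed
  have Qtor: "Q u v - Q v u = tor p u v" for u v
    unfolding Q_def tor_def coordinate_connection.tor_def[OF D.coordinate_connection_christoffel[OF D.chart_at(1)]]
    using Lsym[of u v] by (simp add: c_def x_def)
  define d where "d u v w = 2 * g p (Q u v) w - g p (tor p u v) w" for u v w
  have d1: "d u v w = - d u w v" for u v w
    unfolding d_def using Qskew[of u v w] T.T_skew_form[of u v w] D.g_sym[of p v "Q u w"] by simp
  have d2: "d u v w = d v u w" for u v w
    unfolding d_def using arg_cong[OF Qtor[of u v], of "\<lambda>z. g p z w"] T.T_skew[of u v] by simp
  have "d u v w = d v u w" by (rule d2)
  also have "\<dots> = - d v w u" by (rule d1)
  also have "\<dots> = - d w v u" using d2[of v w u] by simp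
  also have "\<dots> = d w u v" using d1[of w v u] by simp
  also have "\<dots> = d u w v" by (rule d2)
  also have "\<dots> = - d u v w" by (rule d1)
  finally have "d u v w = 0" by simp
  then show ?thesis by (simp add: d_def Q_def)
qed

text \<open>Since \<open>\<Omega>\<close> is parallel for the characteristic connection, its Levi-Civita derivative is the action of
  the difference tensor, and the codifferential becomes half the contraction of the torsion with \<open>\<Omega>\<close>.\<close>
lemma torsion_primitive:
  obtains S where "hermitian_space.orthonormal (g p) S" "card S = CARD('n)"
    "\<And>w. (\<Sum>x\<in>S. g p (tor p x (J p x)) w) = 0"
proof -
  interpret T: hermitian_torsion "g p" "J p" "tor p" by (rule hermitian_torsion)
  define e where "e = (SOME e :: 'n \<Rightarrow> real^'n. orthonormal_frame (g p) e)"
  have "\<exists>e :: 'n \<Rightarrow> real^'n. orthonormal_frame (g p) e"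
  proof -
    obtain S where S: "T.orthonormal S" "card S = CARD('n)"
      using T.orthonormal_set_exists[of "CARD('n)"] by auto
    then have "finite S" by (simp add: T.orthonormal_def)
    then obtain e :: "'n \<Rightarrow> real^'n" where e: "bij_betw e UNIV S"
      using S(2) finite_same_card_bij[of "UNIV :: 'n set" S] by auto
    have "orthonormal_frame (g p) e"
      unfolding orthonormal_frame_def
    proof (intro allI)
      fix i k
      have "e i \<in> S" "e k \<in> S" "e i = e k \<longleftrightarrow> i = k" using e by (auto simp: bij_betw_def inj_on_def)
      then show "g p (e i) (e k) = (if i = k then 1 else 0)" using S(1) by (simp add: T.orthonormal_def)
    qed
    then show ?thesis by blast
  qed
  then have e: "orthonormal_frame (g p) e" unfolding e_def by (rule someI_ex)
  then have e': "g p (e i) (e k) = (if i = k then 1 else 0)" for i k by (simp add: orthonormal_frame_def)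
  have inj: "inj e" by (rule injI) (metis e' zero_neq_one)
  have on: "T.orthonormal (range e)"
    unfolding T.orthonormal_def using e' inj by (auto dest: injD)
  let ?c = "chart_at A p"
  let ?x = "crd ?c p"
  let ?q = "\<lambda>a b. christoffel A D ?c ?x a b - christoffel A L ?c ?x a b"
  have q: "2 * g p (?q a b) w = g p (tor p a b) w" for a b w by (rule difference_tensor)
  have U: "open (cdom ?c)" "p \<in> cdom ?c" using D.open_cdom by auto
  have E: "smooth_field A (cdom ?c) (cfield A ?c v)" for v using D.smooth_cfield by simp
  have LD: "L p a (cfield A ?c b) = D p a (cfield A ?c b) - ?q a b" for a b
    using D.D_cfield[OF D.chart_at, of p a b] L.D_cfield[OF D.chart_at, of p a b] by simp
  have cov: "2 * cov_deriv2 A L (kaehler_form g J) p a (cfield A ?c a) (cfield A ?c w) = - g p (tor p a (J p a)) w" for a w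
  proof -
    have "cov_deriv2 A D (kaehler_form g J) p a (cfield A ?c a) (cfield A ?c w) = 0"
      using kaehler_parallel U E unfolding parallel2_def by blast
    then have "cov_deriv2 A L (kaehler_form g J) p a (cfield A ?c a) (cfield A ?c w)
       = g p (J p (?q a a)) w + g p (J p a) (?q a w)"
      unfolding cov_deriv2_def LD by (simp add: kaehler_form_def)
    moreover have "2 * g p (J p (?q a a)) w = 0"
      using q[of a a "J p w"] by (simp add: g_J_left)
    moreover have "2 * g p (J p a) (?q a w) = - g p (tor p a (J p a)) w"
      using q[of a w "J p a"] T.T_skew_form[of a w "J p a"] D.g_sym[of p "J p a" "?q a w"] by simp
    ultimately show ?thesis by simp
  qed
  have "(\<Sum>x\<in>range e. g p (tor p x (J p x)) w) = 0" for w
  proof -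
    have "codifferential A g L (kaehler_form g J) p w = 0"
      using W3 unfolding type_W3_def by blast
    then have "(\<Sum>i\<in>UNIV. cov_deriv2 A L (kaehler_form g J) p (e i) (cfield A ?c (e i)) (cfield A ?c w)) = 0"
      unfolding codifferential_def e_def[symmetric] by (simp add: ext_eq_cfield)
    then have "(\<Sum>i\<in>UNIV. 2 * cov_deriv2 A L (kaehler_form g J) p (e i) (cfield A ?c (e i)) (cfield A ?c w)) = 0"
      by (simp add: sum_distrib_left[symmetric])
    then show ?thesis unfolding cov by (simp add: sum.reindex[OF inj] sum_negf)
  qed
  moreover have "card (range e) = CARD('n)" using inj by (simp add: card_image)
  ultimately show ?thesis using that[of "range e"] on by blast
qed

text \<open>The metric, the Kaehler form and the torsion form have parallel components in the chart at \<open>p\<close>, so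
  the curvature annihilates each of them.\<close>
lemma curvature:
  shows curvature_stabilizes: "hermitian_torsion.torsion_stabilizer (g p) (J p) (tor p) (curv p a b)"
    and curvature_bianchi: "curv p a b w + curv p b w a + curv p w a b
      = tor p (tor p a b) w + tor p (tor p b w) a + tor p (tor p w a) b"
proof -
  interpret T: hermitian_torsion "g p" "J p" "tor p" by (rule hermitian_torsion)
  define c where "c = chart_at A p"
  define x where "x = crd c p"
  define S where "S = crd c ` cdom c"
  have c: "c \<in> A" "p \<in> cdom c" by (simp_all add: c_def)
  have x: "x \<in> S" using c by (auto simp: x_def S_def)
  interpret cc: coordinate_connection S "christoffel A D c"
    unfolding S_def by (rule D.coordinate_connection_christoffel[OF c(1)])
  have tor: "tor p = cc.tor x" and curv: "curv p = cc.curv x"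
    by (simp_all add: tor_def curv_def c_def x_def)
  let ?H = "pull2 A c g" and ?W = "pull2 A c (kaehler_form g J)"
  let ?t = "\<lambda>y u v w. ?H y (cc.tor y u v) w"
  have Hx: "?H x u v = g p u v" for u v unfolding x_def c_def by (rule D.pull_metric_at)
  have Wx: "?W x u v = g p (J p u) v" for u v by (simp add: pull2_def kaehler_form_def x_def c_def)
  note H = D.pull_metric[OF c(1), folded S_def]
  have Wsm: "Cinf_on S (\<lambda>y. ?W y u v)" for u v
  proof -
    note E = D.smooth_cfield[OF c(1)]
    have "smooth_fun A (cdom c) (\<lambda>p. g p (J p (cfield A c u p)) (cfield A c v p))"
      by (rule D.g_smooth[OF D.open_cdom[OF c(1)] J_smooth[OF D.open_cdom[OF c(1)] E] E])
    then show ?thesis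
      using c unfolding smooth_fun_def S_def
      by (auto simp: pull2_def kaehler_form_def o_def dest: bspec[of _ _ c])
  qed
  have Wbil: "bilinear (?W y)" if "y \<in> S" for y
  proof -
    have q: "par c y \<in> cdom c" using that c(1) by (auto simp: S_def)
    note lE = D.linear_cfield[OF c(1) q] and gb = D.g_bilinear
    show ?thesis unfolding bilinear_def
      by (auto intro!: linearI simp: pull2_def kaehler_form_def linear_add[OF lE] linear_scale[OF lE]
          linear_add[OF J_linear] linear_scale[OF J_linear]
          bilinear_ladd[OF gb] bilinear_radd[OF gb] bilinear_lmul[OF gb] bilinear_rmul[OF gb])
  qed
  have Wpar: "frechet_derivative (\<lambda>y. ?W y u v) (at y) z
      = ?W y (christoffel A D c y z u) v + ?W y u (christoffel A D c y z v)" if "y \<in> S" for y u v z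
  proof (rule D.parallel2_in_chart[OF c(1)])
    show "y \<in> crd c ` cdom c" using that by (simp add: S_def)
    show "Cinf_on (crd c ` cdom c) (\<lambda>y. ?W y u v)" using Wsm by (simp add: S_def)
    have "par c y \<in> cdom c" using that c(1) by (auto simp: S_def)
    then show "cov_deriv2 A D (kaehler_form g J) (par c y) (cfield A c z (par c y)) (cfield A c u) (cfield A c v) = 0"
      using kaehler_parallel D.open_cdom[OF c(1)] D.smooth_cfield[OF c(1)] unfolding parallel2_def by blast
  qed
  have Hl: "linear (\<lambda>u. ?H y u w)" "linear (?H y u)" if "y \<in> S" for y u w
    using H(2)[OF that] by (simp_all add: bilinear_def)
  have tl: "linear (cc.tor y u)" "linear (\<lambda>u. cc.tor y u v)" if "y \<in> S" for y u v
    using cc.tor_bilinear[OF that] by (simp_all add: bilinear_def)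
  have tsm: "Cinf_on S (\<lambda>y. ?t y u v w)" for u v w
    by (rule evaluation_derivative(1)[OF cc.S Hl(1) H(1) cc.tor_smooth])
  have teq: "torsion_form A g D (par c y) (cfield A c u (par c y)) (cfield A c v (par c y)) (cfield A c w (par c y)) = ?t y u v w"
    if y: "y \<in> S" for y u v w
  proof -
    let ?q = "par c y"
    have q: "?q \<in> cdom c" "crd c ?q = y" using that c(1) by (auto simp: S_def)
    have "components A c ?q (torsion A D (ext A ?q (cfield A c u ?q)) (ext A ?q (cfield A c v ?q)) ?q) = cc.tor y u v"
      using D.torsion_in_chart[OF c(1) q(1), of "cfield A c u ?q" "cfield A c v ?q"]
      unfolding q(2) D.components_cfield[OF c(1) q(1)] .
    then have "torsion A D (ext A ?q (cfield A c u ?q)) (ext A ?q (cfield A c v ?q)) ?q = cfield A c (cc.tor y u v) ?q"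
      using D.cfield_components[OF c(1) q(1)] by metis
    then show ?thesis by (simp add: torsion_form_def pull2_def)
  qed
  have tpar: "frechet_derivative (\<lambda>y. ?t y u v w) (at y) z
      = ?t y (christoffel A D c y z u) v w + ?t y u (christoffel A D c y z v) w + ?t y u v (christoffel A D c y z w)"
    if "y \<in> S" for y u v w z
  proof (rule D.parallel3_in_chart[OF c(1)])
    show "y \<in> crd c ` cdom c" using that by (simp add: S_def)
    show "Cinf_on (crd c ` cdom c) (\<lambda>y. ?t y u v w)" using tsm by (simp add: S_def)
    show "torsion_form A g D (par c y) (cfield A c u (par c y)) (cfield A c v (par c y)) (cfield A c w (par c y)) = ?t y u v w"
      if "y \<in> crd c ` cdom c" for y u v w using teq that by (simp add: S_def)
    have "par c y \<in> cdom c" using that c(1) by (auto simp: S_def)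
    then show "cov_deriv3 A D (torsion_form A g D) (par c y) (cfield A c z (par c y)) (cfield A c u) (cfield A c v) (cfield A c w) = 0"
      using torsion_parallel D.open_cdom[OF c(1)] D.smooth_cfield[OF c(1)] unfolding parallel3_def by blast
  qed
  have skew: "g p (curv p a b v) w = - g p v (curv p a b w)" for a b v w
    using cc.curv_annihilates_parallel2[OF x H(2) H(1) H(3), of a b v w] unfolding Hx curv by simp
  have comm: "curv p a b (J p v) = J p (curv p a b v)" for a b v
  proof (rule T.h_eqI)
    fix w
    have "g p (J p (curv p a b v)) w + g p (J p v) (curv p a b w) = 0"
      using cc.curv_annihilates_parallel2[OF x Wbil Wsm Wpar, of a b v w] unfolding Wx curv by simp
    then show "g p (curv p a b (J p v)) w = g p (J p (curv p a b v)) w" using skew[of a b "J p v" w] by simp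
  qed
  have der: "curv p a b (tor p u v) = tor p (curv p a b u) v + tor p u (curv p a b v)" for a b u v
  proof (rule T.h_eqI)
    fix w
    have "?t x (cc.curv x a b u) v w + ?t x u (cc.curv x a b v) w + ?t x u v (cc.curv x a b w) = 0"
    proof (rule cc.curv_annihilates_parallel3[where F = ?t, OF x _ _ _ tsm tpar])
      show "linear (?t y u v)" if "y \<in> S" for y u v using Hl(2)[OF that] .
      show "linear (\<lambda>v. ?t y u v w)" if "y \<in> S" for y u w
        using linear_compose[OF tl(1)[OF that] Hl(1)[OF that]] by (simp add: o_def)
      show "linear (\<lambda>u. ?t y u v w)" if "y \<in> S" for y v w
        using linear_compose[OF tl(2)[OF that] Hl(1)[OF that]] by (simp add: o_def)
    qed
    then show "g p (curv p a b (tor p u v)) w = g p (tor p (curv p a b u) v + tor p u (curv p a b v)) w"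
      using skew[of a b "tor p u v" w] unfolding Hx tor curv by simp
  qed
  show "T.torsion_stabilizer (curv p a b)"
    unfolding T.torsion_stabilizer_def T.unitary_algebra_def
    using skew comm der cc.linear_curv[OF x, of a b] curv by auto
  have nondeg: "v = 0" if "\<And>w. ?H x v w = 0" for v
    using that[of v] unfolding Hx by (simp only: T.h_eq_0_iff)
  show "curv p a b w + curv p b w a + curv p w a b
      = tor p (tor p a b) w + tor p (tor p b w) a + tor p (tor p w a) b"
    unfolding curv tor
    by (rule cc.first_bianchi[OF x cc.parallel_torsion_derivative[where H = ?H, OF x H(2) H(1) nondeg H(3) tpar]])
qed

text \<open>A one-dimensional isotropy algebra would be a stabilizer line that contains the curvature.\<close>
theorem torsion_isotropy_dim:
  assumes "CARD('n) = 6" shows "lie_group_dim (torsion_isotropy A g J D p) \<noteq> 1"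
proof
  interpret T: hermitian_torsion "g p" "J p" "tor p" by (rule hermitian_torsion)
  assume dim: "lie_group_dim (torsion_isotropy A g J D p) = 1"
  have form: "torsion_form A g D p = (\<lambda>u v w. g p (tor p u v) w)"
    using torsion_form_eq by blast
  let ?G = "{B. T.torsion_stabilizer ((*v) B)}"
  have "dim ?G = 1"
    using dim isotropy_lie_algebra[OF hermitian_torsion, of p]
    unfolding lie_group_dim_def torsion_isotropy_def form by simp
  then obtain b where b: "b \<subseteq> ?G" "independent b" "?G \<subseteq> span b" "card b = 1"
    using basis_exists[of ?G] by metis
  then obtain B where B: "b = {B}" using card_1_singletonE by blast
  have line: "T.stabilizer_line ((*v) B)"
    unfolding T.stabilizer_line_def
  proof (intro conjI allI impI)
    show "T.torsion_stabilizer ((*v) B)" using b(1) B by simp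
    show "\<exists>v. B *v v \<noteq> 0"
    proof (rule ccontr)
      assume "\<nexists>v. B *v v \<noteq> 0"
      then have "\<forall>v. B *v v = 0 *v v" by simp
      then have "B = 0" by (rule matrix_eq[THEN iffD2])
      then show False using b(2) B dependent_zero by blast
    qed
    fix F assume F: "T.torsion_stabilizer F"
    then have "linear F" by (simp add: T.torsion_stabilizer_def T.unitary_algebra_def)
    then have FM: "F = (*v) (matrix F)" by (simp add: fun_eq_iff matrix_works)
    then have "matrix F \<in> span {B}" using F b(3) B by auto
    then obtain k where "matrix F = k *\<^sub>R B" using span_singleton[of B] by auto
    then have "F v = k *\<^sub>R (B *v v)" for v using FM scaleR_matrix_vector_assoc[of k B v] by metis
    then show "\<exists>k. \<forall>v. F v = k *\<^sub>R (B *v v)" by blast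
  qed
  obtain S where S: "T.orthonormal S" "card S = CARD('n)" "\<And>w. (\<Sum>x\<in>S. g p (tor p x (J p x)) w) = 0"
    using torsion_primitive[of p] by blast
  interpret P: primitive_torsion "g p" "J p" "tor p" S
    by unfold_locales (use S in simp_all)
  show False
    by (rule P.stabilizer_line_not_holonomy[OF _ line curvature_stabilizes curvature_bianchi])
      (use assms in simp)
qed

end

theorem theorem4p8:
  shows "\<not> (\<exists>(A :: ('m::{t2_space,second_countable_topology}, 6) chart set)
             (g :: 'm \<Rightarrow> real^6 \<Rightarrow> real^6 \<Rightarrow> real) (J :: 'm \<Rightarrow> real^6 \<Rightarrow> real^6)
             (L :: ('m, 6) conn) (D :: ('m, 6) conn).
           smooth_atlas A \<and> almost_hermitian A g J \<and>
           levi_civita A g L \<and> complete_manifold A L \<and> type_W3 A g J L \<and>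
           characteristic_connection A g J D \<and>
           parallel3 A D (torsion_form A g D) \<and>
           (\<exists>p. lie_group_dim (torsion_isotropy A g J D p) = 1))"
proof
  assume "\<exists>(A :: ('m::{t2_space,second_countable_topology}, 6) chart set)
             (g :: 'm \<Rightarrow> real^6 \<Rightarrow> real^6 \<Rightarrow> real) (J :: 'm \<Rightarrow> real^6 \<Rightarrow> real^6)
             (L :: ('m, 6) conn) (D :: ('m, 6) conn).
           smooth_atlas A \<and> almost_hermitian A g J \<and>
           levi_civita A g L \<and> complete_manifold A L \<and> type_W3 A g J L \<and>
           characteristic_connection A g J D \<and>
           parallel3 A D (torsion_form A g D) \<and>
           (\<exists>p. lie_group_dim (torsion_isotropy A g J D p) = 1)"
  then obtain A :: "('m, 6) chart set" and g J L D p where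
    A: "smooth_atlas A" "almost_hermitian A g J" and L: "levi_civita A g L" and W: "type_W3 A g J L"
    and D: "characteristic_connection A g J D" and par: "parallel3 A D (torsion_form A g D)"
    and p: "lie_group_dim (torsion_isotropy A g J D p) = 1"
    by blast
  have gm: "riemannian_metric A g" using A(2) by (simp add: almost_hermitian_def)
  have D': "linear_connection A D" "parallel2 A D g" "parallel_endo A D J"
    "\<And>p u v w. torsion_form A g D p v u w = - torsion_form A g D p u v w"
    "\<And>p u v w. torsion_form A g D p u w v = - torsion_form A g D p u v w"
    using D unfolding characteristic_connection_def by blast+
  have L': "linear_connection A L" "parallel2 A L g"
    "\<And>U X Y p. open U \<Longrightarrow> smooth_field A U X \<Longrightarrow> smooth_field A U Y \<Longrightarrow> p \<in> U \<Longrightarrow> torsion A L X Y p = 0"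
    using L unfolding levi_civita_def by blast+
  interpret characteristic_geometry A g D L J
    by unfold_locales (fact A gm D' L' W par)+
  show False using torsion_isotropy_dim[of p] p by simp
qed

end
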